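(* Let $m,n\ge1$ be integers, let $q$ be a Fermat prime, and let $H$ be a finite group with $\gcd(m,|H|)=1$. Then $$s_{\Gamma_m(q)}^H(n)=\sum_{d\mid m}s_{\Gamma_d(q)}^H(1,n),$$ where, for each $d\mid m$, one has $s_{\Gamma_d(q)}^H(1,n)\equiv1\pmod2$ if and only if at least one of the following two conditions holds: (1) $q\nmid d$ and $n=2d\,\dfrac{2(q-1)^\sigma-q}{q-2}$ for some integer $\sigma\ge1$; or (2) $2\nmid d$, $q\nmid d$, $2\nmid|H|$, and $n=d\,\dfrac{2(q-1)^\sigma-q}{q-2}$ for some integer $\sigma\ge1$.
   Context: A Fermat prime is an odd prime $q$ such that $q-1$ is a power of $2$ (so $q=3$ is included). For an odd prime $q$ and a positive integer $m$, $\Gamma_m(q)=\langle x,y\mid x^{2m}=y^{qm}=1,\ x^2=y^q\rangle$, i.e. the free product of cyclic groups of orders $2m$ and $qm$ amalgamated along their subgroups of order $m$. Put $\zeta:=x^2=y^q$, a central element of order $m$ in $\Gamma_m(q)$. For a finitely generated group $\Gamma$, a finite group $H$ and $n\ge1$, $$s_\Gamma^H(n)=\sum_{\Delta\le\Gamma,\ (\Gamma:\Delta)=n}|\mathrm{Hom}(\Delta,H)|.$$ Moreover, for a positive integer $d$, $$s_{\Gamma_d(q)}^H(1,n)=\sum_{\Delta}|\mathrm{Hom}(\Delta,H)|,$$ the sum being over all subgroups $\Delta\le\Gamma_d(q)$ of index $n$ with $\Delta\cap\langle\zeta\rangle=1$, where $\zeta=x^2=y^q$ is the corresponding element of $\Gamma_d(q)$.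 *)

theory Defs
  imports "HOL-Algebra.Algebra" "HOL-Number_Theory.Cong"
begin

text \<open>A word over the generators \<open>'a\<close> is a list of letters, where \<open>(g, True)\<close> stands for \<open>g\<close> and
  \<open>(g, False)\<close> for its formal inverse. A pair \<open>(l, r)\<close> in \<open>R\<close> is the defining relation \<open>l = r\<close>.\<close>

type_synonym 'a word = "('a \<times> bool) list"

inductive pres_eq :: "('a word \<times> 'a word) set \<Rightarrow> 'a word \<Rightarrow> 'a word \<Rightarrow> bool"
  for R :: "('a word \<times> 'a word) set" where
  refl: "pres_eq R u u"
| sym: "pres_eq R u v \<Longrightarrow> pres_eq R v u"
| trans: "pres_eq R u v \<Longrightarrow> pres_eq R v w \<Longrightarrow> pres_eq R u w"
| cancel: "pres_eq R (u @ [(g, b), (g, \<not> b)] @ v) (u @ v)"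
| relation: "(l, r) \<in> R \<Longrightarrow> pres_eq R (u @ l @ v) (u @ r @ v)"

definition pres_class :: "('a word \<times> 'a word) set \<Rightarrow> 'a word \<Rightarrow> 'a word set" where
  "pres_class R u = {v. pres_eq R u v}"

text \<open>The group with all elements of the type \<open>'a\<close> as generators and defining relations \<open>R\<close>.\<close>

definition presented_group :: "('a word \<times> 'a word) set \<Rightarrow> 'a word set monoid" where
  "presented_group R =
    \<lparr>carrier = range (pres_class R),
     monoid.mult = (\<lambda>A B. \<Union>a\<in>A. \<Union>b\<in>B. pres_class R (a @ b)),
     one = pres_class R []\<rparr>"

definition pres_gen :: "('a word \<times> 'a word) set \<Rightarrow> 'a \<Rightarrow> 'a word set" where
  "pres_gen R g = pres_class R [(g, True)]"

lemma pres_eq_append_left: "pres_eq R u v \<Longrightarrow> pres_eq R (w @ u) (w @ v)"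
proof (induction rule: pres_eq.induct)
  case (cancel u g b v)
  then show ?case using pres_eq.cancel[of R "w @ u" g b v] by simp
next
  case (relation l r u v)
  then show ?case using pres_eq.relation[of l r R "w @ u" v] by simp
next
  case (refl u)
  show ?case by (rule pres_eq.refl)
next
  case (sym u v)
  from sym.IH show ?case by (rule pres_eq.sym)
next
  case (trans u v x)
  from trans.IH show ?case by (rule pres_eq.trans)
qed

lemma pres_eq_append_right: "pres_eq R u v \<Longrightarrow> pres_eq R (u @ w) (v @ w)"
proof (induction rule: pres_eq.induct)
  case (cancel u g b v)
  then show ?case using pres_eq.cancel[of R u g b "v @ w"] by simp
next
  case (relation l r u v)
  then show ?case using pres_eq.relation[of l r R u "v @ w"] by simp
next
  case (refl u)
  show ?case by (rule pres_eq.refl)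
next
  case (sym u v)
  from sym.IH show ?case by (rule pres_eq.sym)
next
  case (trans u v x)
  from trans.IH show ?case by (rule pres_eq.trans)
qed

lemma pres_class_eq_iff: "pres_class R u = pres_class R v \<longleftrightarrow> pres_eq R u v"
proof
  assume "pres_class R u = pres_class R v"
  moreover have "v \<in> pres_class R v" by (simp add: pres_class_def pres_eq.refl)
  ultimately show "pres_eq R u v" by (simp add: pres_class_def set_eq_iff)
next
  assume "pres_eq R u v"
  then have "pres_eq R u w \<longleftrightarrow> pres_eq R v w" for w
    by (metis pres_eq.sym pres_eq.trans)
  then show "pres_class R u = pres_class R v" by (simp add: pres_class_def)
qed

lemma presented_group_mult:
  "pres_class R u \<otimes>\<^bsub>presented_group R\<^esub> pres_class R v = pres_class R (u @ v)"
proof -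
  have "pres_class R (a @ b) = pres_class R (u @ v)"
    if "a \<in> pres_class R u" "b \<in> pres_class R v" for a b
  proof -
    have "pres_eq R (a @ b) (u @ b)"
      using that by (simp add: pres_class_def pres_eq.sym pres_eq_append_right)
    moreover have "pres_eq R (u @ b) (u @ v)"
      using that by (simp add: pres_class_def pres_eq.sym pres_eq_append_left)
    ultimately show ?thesis
      unfolding pres_class_eq_iff by (rule pres_eq.trans)
  qed
  then have "(\<Union>a\<in>pres_class R u. \<Union>b\<in>pres_class R v. pres_class R (a @ b))
      = (\<Union>a\<in>pres_class R u. \<Union>b\<in>pres_class R v. pres_class R (u @ v))"
    by (intro SUP_cong HOL.refl)
  also have "\<dots> = pres_class R (u @ v)"
  proof -
    have "u \<in> pres_class R u" "v \<in> pres_class R v"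
      by (simp_all add: pres_class_def pres_eq.refl)
    then show ?thesis by blast
  qed
  finally show ?thesis
    unfolding presented_group_def by simp
qed

lemma pres_eq_inverse_word:
  "pres_eq R (rev (map (\<lambda>(g, b). (g, \<not> b)) u) @ u) []"
proof (induction u)
  case (Cons a u)
  obtain g b where a: "a = (g, b)" by (cases a)
  have "pres_eq R (rev (map (\<lambda>(g, b). (g, \<not> b)) u) @ [(g, \<not> b), (g, \<not> \<not> b)] @ u)
          (rev (map (\<lambda>(g, b). (g, \<not> b)) u) @ u)"
    by (rule pres_eq.cancel)
  from pres_eq.trans[OF this Cons.IH] show ?case by (simp add: a)
qed (simp add: pres_eq.refl)

lemma group_presented_group: "group (presented_group R)"
proof (rule groupI)
  fix x assume "x \<in> carrier (presented_group R)"
  then obtain u where u: "x = pres_class R u"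
    by (auto simp: presented_group_def)
  let ?v = "rev (map (\<lambda>(g, b). (g, \<not> b)) u)"
  have "pres_class R ?v \<otimes>\<^bsub>presented_group R\<^esub> x = pres_class R []"
    unfolding u presented_group_mult pres_class_eq_iff by (rule pres_eq_inverse_word)
  then show "\<exists>y\<in>carrier (presented_group R). y \<otimes>\<^bsub>presented_group R\<^esub> x = \<one>\<^bsub>presented_group R\<^esub>"
    by (intro bexI[of _ "pres_class R ?v"]) (simp_all add: presented_group_def)
next
  fix x y assume "x \<in> carrier (presented_group R)" "y \<in> carrier (presented_group R)"
  then obtain u v where "x = pres_class R u" "y = pres_class R v"
    by (auto simp: presented_group_def)
  then have "x \<otimes>\<^bsub>presented_group R\<^esub> y = pres_class R (u @ v)"
    by (simp add: presented_group_mult)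
  then show "x \<otimes>\<^bsub>presented_group R\<^esub> y \<in> carrier (presented_group R)"
    by (simp add: presented_group_def)
next
  fix x y z
  assume "x \<in> carrier (presented_group R)" "y \<in> carrier (presented_group R)"
    "z \<in> carrier (presented_group R)"
  then obtain u v w where "x = pres_class R u" "y = pres_class R v" "z = pres_class R w"
    by (auto simp: presented_group_def)
  then show "x \<otimes>\<^bsub>presented_group R\<^esub> y \<otimes>\<^bsub>presented_group R\<^esub> z
      = x \<otimes>\<^bsub>presented_group R\<^esub> (y \<otimes>\<^bsub>presented_group R\<^esub> z)"
    by (simp add: presented_group_mult)
next
  fix x assume "x \<in> carrier (presented_group R)"
  then obtain u where "x = pres_class R u" by (auto simp: presented_group_def)
  moreover have "\<one>\<^bsub>presented_group R\<^esub> = pres_class R []" by (simp add: presented_group_def)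
  ultimately show "\<one>\<^bsub>presented_group R\<^esub> \<otimes>\<^bsub>presented_group R\<^esub> x = x"
    by (simp add: presented_group_mult)
qed (simp add: presented_group_def)

definition fermat_prime :: "nat \<Rightarrow> bool" where
  "fermat_prime q \<longleftrightarrow> Factorial_Ring.prime q \<and> odd q \<and> (\<exists>k. q - 1 = 2 ^ k)"

datatype xy = gen_x | gen_y

definition Gamma_rels :: "nat \<Rightarrow> nat \<Rightarrow> (xy word \<times> xy word) set" where
  "Gamma_rels m q =
    {(replicate (2 * m) (gen_x, True), []),
     (replicate (q * m) (gen_y, True), []),
     (replicate 2 (gen_x, True), replicate q (gen_y, True))}"

definition Gamma_group :: "nat \<Rightarrow> nat \<Rightarrow> xy word set monoid" where
  "Gamma_group m q = presented_group (Gamma_rels m q)"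

definition Gamma_zeta :: "nat \<Rightarrow> nat \<Rightarrow> xy word set" where
  "Gamma_zeta m q = pres_gen (Gamma_rels m q) gen_x [^]\<^bsub>Gamma_group m q\<^esub> (2::nat)"

text \<open>Since \<open>card\<close> is \<open>0\<close> on infinite sets, this is the intended notion only for \<open>n \<ge> 1\<close>.\<close>

definition subgroups_of_index :: "('g, 'c) monoid_scheme \<Rightarrow> nat \<Rightarrow> 'g set set" where
  "subgroups_of_index G n = {\<Delta>. subgroup \<Delta> G \<and> card (rcosets\<^bsub>G\<^esub> \<Delta>) = n}"

text \<open>Homomorphisms are taken to be extensional, because \<open>hom\<close> does not constrain the values of a
  function outside the carrier, so that its cardinality is not the number of homomorphisms.\<close>

definition Hom :: "('g, 'c) monoid_scheme \<Rightarrow> 'g set \<Rightarrow> ('h, 'e) monoid_scheme \<Rightarrow> ('g \<Rightarrow> 'h) set" where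
  "Hom G \<Delta> H = hom (G\<lparr>carrier := \<Delta>\<rparr>) H \<inter> extensional \<Delta>"

definition subgroup_hom_sum ::
    "('g, 'c) monoid_scheme \<Rightarrow> ('h, 'e) monoid_scheme \<Rightarrow> nat \<Rightarrow> nat" where
  "subgroup_hom_sum G H n = (\<Sum>\<Delta>\<in>subgroups_of_index G n. card (Hom G \<Delta> H))"

definition Gamma_hom_sum_1 :: "nat \<Rightarrow> nat \<Rightarrow> ('h, 'e) monoid_scheme \<Rightarrow> nat \<Rightarrow> nat" where
  "Gamma_hom_sum_1 d q H n =
    (\<Sum>\<Delta> | \<Delta> \<in> subgroups_of_index (Gamma_group d q) n \<and>
           \<Delta> \<inter> generate (Gamma_group d q) {Gamma_zeta d q} = {\<one>\<^bsub>Gamma_group d q\<^esub>}.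
       card (Hom (Gamma_group d q) \<Delta> H))"

end

theory Submission
  imports Defs "HOL-Number_Theory.Residues"
begin

text \<open>Let \<open>C = C\<^sub>2 * C\<^sub>q\<close> be the quotient of \<open>\<Gamma>\<^sub>m(q)\<close> by the central subgroup generated by \<open>\<zeta>\<close>.
For a subgroup \<open>\<Delta>\<close> of \<open>\<Gamma>\<^sub>m(q)\<close> the exponents \<open>i\<close> with \<open>\<zeta>\<^sup>i \<in> \<Delta>\<close> are the multiples of a unique
divisor \<open>d\<close> of \<open>m\<close>. For a fixed \<open>d\<close>, and since \<open>m\<close> is coprime to \<open>|H|\<close>, a pair of such a \<open>\<Delta>\<close> of index \<open>n\<close>
and a homomorphism \<open>\<chi>\<close> from \<open>\<Delta>\<close> to \<open>H\<close> is the same as a pair of a subgroup \<open>W\<close> of \<open>C\<close> of index \<open>n / d\<close> (the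
image of \<open>\<Delta>\<close>) and a function \<open>\<psi>\<close> from the words representing elements of \<open>W\<close> to \<open>A = \<int>/d \<times> H\<close> that is
multiplicative and is multiplied by the central element \<open>z = (1, 1)\<close> of \<open>A\<close>, the pair of the residue 1 and the
identity of \<open>H\<close>, whenever a relator \<open>x\<^sup>2\<close> or \<open>y\<^sup>q\<close> is inserted. This description
(\<open>gamma_pairs.hom_sum_good\<close>) does not mention \<open>m\<close>, so the pairs in \<open>\<Gamma>\<^sub>m(q)\<close> belonging to \<open>d\<close> are as many as
those in \<open>\<Gamma>\<^sub>d(q)\<close>, which gives the sum formula.

The functions \<open>\<psi>\<close> are counted by gauge fixing (\<open>wcover.card_coc\<close>): they come from labellings of the edges of
the coset graph of \<open>W\<close> by elements of \<open>A\<close>, and each of them comes from \<open>|A|\<^bsup>N-1\<^esup>\<close> labellings, where \<open>N\<close> is the index.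
If \<open>a\<close> and \<open>b\<close> are the numbers of cosets fixed by \<open>x\<close> and by \<open>y\<close> and \<open>r\<close> is the free rank of \<open>W\<close>, there
are \<open>s\<^sup>a t\<^sup>b |A|\<^sup>r\<close> functions, where \<open>s\<close> and \<open>t\<close> count the \<open>\<alpha> \<in> A\<close> with \<open>\<alpha>\<^sup>2 = z\<close> and with \<open>\<alpha>\<^sup>q = z\<close>. So
the parity of the sum is that of a number of subgroups of \<open>C\<close>: all of them, those with \<open>a = r = 0\<close>, or those with
\<open>b = 0\<close>, depending on the parity of \<open>d |H|\<close> and on whether \<open>q\<close> divides \<open>d\<close>.

Two actions of 2-groups on subgroups of \<open>C\<close> compute these parities. Conjugation by \<open>x\<close> leaves the subgroups
containing \<open>x\<close>, and the kernels of homomorphisms from subgroups \<open>L \<ni> x\<close> of half the index to \<open>\<int>/2\<close> that are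
nontrivial on \<open>x\<close> (\<open>conj_parity\<close>). The second action replaces \<open>y\<close> by \<open>y\<^sup>k\<close> on the \<open>y\<close>-orbit of the
trivial coset only, for \<open>k\<close> in the unit group of \<open>\<int>/q\<close>; this unit group is a 2-group precisely because \<open>q\<close> is a
Fermat prime. It acts on the subgroups for which \<open>y\<close> moves the trivial coset and either \<open>x\<close> fixes it, or \<open>x\<close>
moves it to a coset fixed by \<open>y\<close>. A fixed point amounts to an isomorphism of coset graphs for every \<open>k\<close>, and
these isomorphisms show that beyond the \<open>y\<close>-orbit the coset graph is a covering with fibre the unit group. The
fixed points are thus in bijection with pairs of a subgroup \<open>L \<ni> y\<close> and a homomorphism from \<open>L\<close> to the unit
group (\<open>twist_parity\<close>), and by the counting formula only the \<open>L\<close> with \<open>a = r = 0\<close> contribute to the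
parity. Conjugating such an \<open>L\<close> by \<open>x\<close> makes the second action applicable again and yields a recursion in which the
index \<open>N = 2 + (q - 1) M\<close> descends to \<open>M\<close> (\<open>vY_step\<close>). With
\<open>\<lambda> = (2 (q - 1)\<^sup>\<sigma> - q) / (q - 2)\<close> for \<open>\<sigma> = 1, 2, \<dots>\<close> the outcome (\<open>subs_parity\<close>) is that the number of all
subgroups of index \<open>N\<close> is odd if and only if \<open>N\<close> is some \<open>\<lambda>\<close> or \<open>2 \<lambda>\<close>, that the number of those with
\<open>a = r = 0\<close> is odd if and only if \<open>N\<close> is some \<open>2 \<lambda>\<close>, and that the number of those with \<open>b = 0\<close> is even. No
subgroup has \<open>a = b = r = 0\<close>.\<close>

section \<open>Subgroups of the free product of cyclic groups as sets of words\<close>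

text \<open>The free product \<open>C\<^sub>2 * C\<^sub>q\<close> is presented as a monoid by the generators \<open>x\<close>, \<open>y\<close> and the relators
\<open>x\<^sup>2\<close>, \<open>y\<^sup>q\<close>, so that its elements are represented by positive words. The exponent of the relator of a generator is
\<open>ordr\<close>.\<close>

definition ordr :: "nat \<Rightarrow> xy \<Rightarrow> nat" where
  "ordr q s = (case s of gen_x \<Rightarrow> 2 | gen_y \<Rightarrow> q)"

lemma ordr_simps [simp]: "ordr q gen_x = 2" "ordr q gen_y = q"
  by (simp_all add: ordr_def)

text \<open>A positive word representing the inverse of the element represented by \<open>w\<close>.\<close>

definition winv :: "nat \<Rightarrow> xy list \<Rightarrow> xy list" where
  "winv q w = concat (map (\<lambda>s. replicate (ordr q s - 1) s) (rev w))"

lemma winv_Nil [simp]: "winv q [] = []" by (simp add: winv_def)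

lemma winv_Cons: "winv q (s # w) = winv q w @ replicate (ordr q s - 1) s"
  by (simp add: winv_def)

lemma winv_snoc: "winv q (w @ [s]) = replicate (ordr q s - 1) s @ winv q w"
  by (simp add: winv_def)

text \<open>The left residual of a set of words by a letter. If \<open>V\<close> is the set of words leading from one coset to
the trivial coset, then \<open>del s V\<close> is the set of words leading from the image of that coset under \<open>s\<close> to the
trivial coset.\<close>

definition del :: "xy \<Rightarrow> xy list set \<Rightarrow> xy list set" where
  "del s V = {t. s # t \<in> V}"

lemma fold_del: "fold del w V = {t. w @ t \<in> V}"
  by (induction w arbitrary: V) (simp_all add: del_def)

text \<open>A subgroup of \<open>C\<^sub>2 * C\<^sub>q\<close>, encoded as the set of all positive words representing its elements: it is
invariant under insertion and deletion of relators. Closure under inverses need not be required, by \<open>winv\<close>.\<close>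

definition wsub :: "nat \<Rightarrow> xy list set \<Rightarrow> bool" where
  "wsub q W \<longleftrightarrow> [] \<in> W \<and> (\<forall>u\<in>W. \<forall>v. u @ v \<in> W \<longleftrightarrow> v \<in> W) \<and>
     (\<forall>s u v. u @ replicate (ordr q s) s @ v \<in> W \<longleftrightarrow> u @ v \<in> W)"

text \<open>The residuals of \<open>W\<close> by words correspond to the right cosets of the subgroup, with \<open>W\<close> itself as
the trivial coset and \<open>del s\<close> as the right action of \<open>s\<close>.\<close>

definition orb :: "xy list set \<Rightarrow> xy list set set" where
  "orb W = range (\<lambda>w. fold del w W)"

text \<open>The subgroups of finite index \<open>N\<close>.\<close>

definition subs :: "nat \<Rightarrow> nat \<Rightarrow> xy list set set" where
  "subs q N = {W. wsub q W \<and> finite (orb W) \<and> card (orb W) = N}"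

text \<open>The number of cosets fixed by the generator \<open>s\<close>.\<close>

definition fixc :: "xy \<Rightarrow> xy list set \<Rightarrow> nat" where
  "fixc s W = card {V \<in> orb W. del s V = V}"

text \<open>The words that fix the point \<open>e\<close> under the right action \<open>\<delta>\<close> of the two generators.\<close>

definition stab :: "(xy \<Rightarrow> 'a \<Rightarrow> 'a) \<Rightarrow> 'a \<Rightarrow> xy list set" where
  "stab \<delta> e = {w. fold \<delta> w e = e}"

text \<open>A finite transitive permutation representation \<open>\<delta>\<close> of \<open>C\<^sub>2 * C\<^sub>q\<close> on \<open>D\<close> with base point \<open>e\<close>.
Up to isomorphism it is the action on the cosets of the subgroup \<open>stab \<delta> e\<close>.\<close>

locale pmodel =
  fixes q :: nat and D :: "'a set" and \<delta> :: "xy \<Rightarrow> 'a \<Rightarrow> 'a" and e :: 'a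
  assumes qpos: "q > 0" and finD: "finite D" and eD: "e \<in> D"
    and closed: "p \<in> D \<Longrightarrow> \<delta> s p \<in> D"
    and order: "p \<in> D \<Longrightarrow> (\<delta> s ^^ ordr q s) p = p"
    and reach: "p \<in> D \<Longrightarrow> \<exists>w. fold \<delta> w e = p"
begin

lemma ordr_pos: "ordr q s > 0"
  using qpos by (cases s) auto

lemma fold_closed: "p \<in> D \<Longrightarrow> fold \<delta> w p \<in> D"
  by (induction w arbitrary: p) (auto simp: closed)

lemma fold_rel: "p \<in> D \<Longrightarrow> fold \<delta> (replicate (ordr q s) s) p = p"
  by (simp add: order)

lemma funpow_closed: "p \<in> D \<Longrightarrow> (\<delta> s ^^ i) p \<in> D"
  by (induction i) (auto simp: closed)

lemma funpow_pred:
  assumes "p \<in> D" shows "(\<delta> s ^^ (ordr q s - 1)) (\<delta> s p) = p"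
proof -
  have "(\<delta> s ^^ Suc (ordr q s - 1)) p = p"
    using order[OF assms] ordr_pos[of s] by simp
  then show ?thesis by (simp only: funpow_Suc_right comp_apply)
qed

lemma funpow_pred':
  assumes "p \<in> D" shows "\<delta> s ((\<delta> s ^^ (ordr q s - 1)) p) = p"
proof -
  have "(\<delta> s ^^ Suc (ordr q s - 1)) p = p"
    using order[OF assms] ordr_pos[of s] by simp
  then show ?thesis by (simp only: funpow.simps(2) comp_apply)
qed

lemma fold_winv: "p \<in> D \<Longrightarrow> fold \<delta> (winv q w) (fold \<delta> w p) = p"
proof (induction w arbitrary: p)
  case (Cons s w)
  then show ?case
    by (simp add: winv_Cons closed funpow_pred del: One_nat_def)
qed simp

lemma fold_winv': "p \<in> D \<Longrightarrow> fold \<delta> w (fold \<delta> (winv q w) p) = p"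
proof (induction w arbitrary: p rule: rev_induct)
  case (snoc s w)
  then show ?case
    by (simp add: winv_snoc funpow_closed funpow_pred' del: One_nat_def)
qed simp

lemma step_inj:
  assumes "p \<in> D" "p' \<in> D" "\<delta> s p = \<delta> s p'" shows "p = p'"
  using funpow_pred[OF assms(1), of s] funpow_pred[OF assms(2), of s] unfolding assms(3)
  by metis

lemma fold_inj:
  assumes "p \<in> D" "p' \<in> D" "fold \<delta> w p = fold \<delta> w p'" shows "p = p'"
  using fold_winv[OF assms(1), of w] fold_winv[OF assms(2), of w] unfolding assms(3)
  by metis

text \<open>The coset of \<open>stab \<delta> e\<close> that corresponds to the point \<open>p\<close>.\<close>

definition res :: "'a \<Rightarrow> xy list set" where "res p = {t. fold \<delta> t p = e}"

lemma res_e: "res e = stab \<delta> e" by (simp add: res_def stab_def)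

lemma res_step: "res (\<delta> s p) = del s (res p)"
  by (auto simp: res_def del_def)

lemma res_fold: "res (fold \<delta> w p) = fold del w (res p)"
  by (induction w arbitrary: p) (auto simp: res_step)

lemma res_inj: "inj_on res D"
proof (rule inj_onI)
  fix p p' assume a: "p \<in> D" "p' \<in> D" "res p = res p'"
  obtain u where u: "fold \<delta> u e = p" using reach a by blast
  have "winv q u \<in> res p" using u by (auto simp: res_def fold_winv eD)
  then have "fold \<delta> (winv q u) p' = e" unfolding \<open>res p = res p'\<close> by (simp add: res_def)
  then show "p = p'" using fold_winv'[of p' u] a u by simp
qed

lemma res_image: "res ` D = orb (stab \<delta> e)"
proof -
  have "D = range (\<lambda>w. fold \<delta> w e)"
  proof
    show "D \<subseteq> range (\<lambda>w. fold \<delta> w e)" using reach by blast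
    show "range (\<lambda>w. fold \<delta> w e) \<subseteq> D" using fold_closed[OF eD] by blast
  qed
  then have "res ` D = range (\<lambda>w. res (fold \<delta> w e))" by (simp only: image_image)
  then show ?thesis by (simp add: orb_def res_fold res_e)
qed

lemma wsub_stab: "wsub q (stab \<delta> e)"
  unfolding wsub_def
proof (intro conjI ballI allI)
  show "[] \<in> stab \<delta> e" by (simp add: stab_def)
next
  fix u v assume "u \<in> stab \<delta> e"
  then show "(u @ v \<in> stab \<delta> e) = (v \<in> stab \<delta> e)" by (simp add: stab_def)
next
  fix s u v
  show "(u @ replicate (ordr q s) s @ v \<in> stab \<delta> e) = (u @ v \<in> stab \<delta> e)"
    by (simp add: stab_def order fold_closed eD)
qed

lemma bij_res: "bij_betw res D (orb (stab \<delta> e))"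
  using res_inj res_image by (simp add: bij_betw_def)

lemma stab_in_subs: "stab \<delta> e \<in> subs q (card D)"
  using wsub_stab finD bij_betw_finite[OF bij_res] bij_betw_same_card[OF bij_res]
  by (simp add: subs_def)

lemma fixc_stab: "fixc s (stab \<delta> e) = card {p \<in> D. \<delta> s p = p}"
proof -
  have "bij_betw res {p \<in> D. \<delta> s p = p} {V \<in> orb (stab \<delta> e). del s V = V}"
    unfolding bij_betw_def
  proof
    show "inj_on res {p \<in> D. \<delta> s p = p}" using res_inj by (rule inj_on_subset) auto
    show "res ` {p \<in> D. \<delta> s p = p} = {V \<in> orb (stab \<delta> e). del s V = V}"
    proof (intro equalityI subsetI)
      fix V assume "V \<in> {V \<in> orb (stab \<delta> e). del s V = V}"
      then have V: "V \<in> res ` D" "del s V = V" unfolding res_image by blast+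
      then obtain p where p: "p \<in> D" "V = res p" by blast
      have "res (\<delta> s p) = res p" using V(2) p(2) res_step by metis
      then have "\<delta> s p = p" using inj_onD[OF res_inj _ closed] p(1) by blast
      with p show "V \<in> res ` {p \<in> D. \<delta> s p = p}" by auto
    next
      fix V assume "V \<in> res ` {p \<in> D. \<delta> s p = p}"
      then obtain p where p: "p \<in> D" "\<delta> s p = p" "V = res p" by auto
      then show "V \<in> {V \<in> orb (stab \<delta> e). del s V = V}"
        using res_step[of s p] unfolding res_image[symmetric] by auto
    qed
  qed
  then show ?thesis unfolding fixc_def by (rule bij_betw_same_card[symmetric])
qed

end

text \<open>Pointed permutation representations and subgroups determine each other up to isomorphism; this is the
first half, and \<open>pmodel_same_stab_iso\<close> is the second one.\<close>

lemma pmodel_iso_stab: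
  assumes "pmodel q D \<delta> e" "inj_on \<phi> D" "\<phi> e = e'"
    and eq: "\<And>s p. p \<in> D \<Longrightarrow> \<phi> (\<delta> s p) = \<delta>' s (\<phi> p)"
  shows "stab \<delta> e = stab \<delta>' e'"
proof -
  interpret pmodel q D \<delta> e by fact
  have *: "fold \<delta>' w (\<phi> p) = \<phi> (fold \<delta> w p)" if "p \<in> D" for w p
    using that
  proof (induction w arbitrary: p)
    case (Cons s w)
    then show ?case using eq[of p s] Cons.IH[of "\<delta> s p"] by (simp add: closed)
  qed simp
  have "fold \<delta>' w e' = e' \<longleftrightarrow> fold \<delta> w e = e" for w
    using *[OF eD, of w] inj_onD[OF assms(2) _ fold_closed[OF eD, of w] eD]
    unfolding assms(3)[symmetric] by auto
  then show ?thesis by (simp add: stab_def)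
qed

lemma pmodel_same_stab_iso:
  assumes "pmodel q D \<delta> e" "pmodel q D' \<delta>' e'" "stab \<delta> e = stab \<delta>' e'"
  obtains \<phi> where "bij_betw \<phi> D D'" "\<phi> e = e'"
    "\<And>s p. p \<in> D \<Longrightarrow> \<phi> (\<delta> s p) = \<delta>' s (\<phi> p)"
proof -
  interpret a: pmodel q D \<delta> e by fact
  interpret b: pmodel q D' \<delta>' e' by fact
  let ?g = "inv_into D' b.res"
  have bg: "bij_betw ?g (orb (stab \<delta> e)) D'"
    unfolding assms(3) using b.bij_res by (rule bij_betw_inv_into)
  define \<phi> where "\<phi> = ?g \<circ> a.res"
  have bij: "bij_betw \<phi> D D'" unfolding \<phi>_def using a.bij_res bg by (rule bij_betw_trans)
  have key: "b.res (\<phi> p) = a.res p" if "p \<in> D" for p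
  proof -
    have "a.res p \<in> b.res ` D'" unfolding b.res_image assms(3)[symmetric] a.res_image[symmetric]
      using that by (rule imageI)
    then show ?thesis by (simp add: \<phi>_def f_inv_into_f)
  qed
  have inD: "\<phi> p \<in> D'" if "p \<in> D" for p using bij that by (rule bij_betwE[THEN bspec])
  show ?thesis
  proof
    show "bij_betw \<phi> D D'" by fact
    show "\<phi> e = e'"
      by (rule inj_onD[OF b.res_inj _ inD[OF a.eD] b.eD])
        (unfold key[OF a.eD] a.res_e b.res_e, rule assms(3))
    fix s p assume p: "p \<in> D"
    have "b.res (\<phi> (\<delta> s p)) = b.res (\<delta>' s (\<phi> p))"
      unfolding key[OF a.closed[OF p]] b.res_step key[OF p] by (rule a.res_step)
    then show "\<phi> (\<delta> s p) = \<delta>' s (\<phi> p)"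
      by (rule inj_onD[OF b.res_inj _ inD[OF a.closed[OF p]] b.closed[OF inD[OF p]]])
  qed
qed

lemma wsubD:
  assumes "wsub q W"
  shows "[] \<in> W" "u \<in> W \<Longrightarrow> u @ v \<in> W \<longleftrightarrow> v \<in> W"
    "u @ replicate (ordr q s) s @ v \<in> W \<longleftrightarrow> u @ v \<in> W"
  using assms unfolding wsub_def by blast+

lemma orb_self: "W \<in> orb W"
  unfolding orb_def by (rule range_eqI[of _ _ "[]"]) simp

lemma del_orb: "V \<in> orb W \<Longrightarrow> del s V \<in> orb W"
  unfolding orb_def
proof -
  assume "V \<in> range (\<lambda>w. fold del w W)"
  then obtain w where "V = fold del w W" by auto
  then have "del s V = fold del (w @ [s]) W" by simp
  then show "del s V \<in> range (\<lambda>w. fold del w W)" by blast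
qed

lemma stab_del: assumes "wsub q W" shows "stab del W = W"
proof -
  have "{t. w @ t \<in> W} = W \<longleftrightarrow> w \<in> W" for w
  proof
    assume "{t. w @ t \<in> W} = W"
    then have "[] \<in> {t. w @ t \<in> W}" using wsubD(1)[OF assms] by (rule ssubst)
    then show "w \<in> W" by simp
  next
    assume "w \<in> W"
    then show "{t. w @ t \<in> W} = W" using wsubD(2)[OF assms] by blast
  qed
  then show ?thesis by (simp add: stab_def fold_del)
qed

lemma wsub_pmodel:
  assumes "wsub q W" "finite (orb W)" "q > 0"
  shows "pmodel q (orb W) del W"
proof (intro pmodel.intro)
  fix p s assume "p \<in> orb W"
  then obtain w where w: "p = fold del w W" unfolding orb_def by blast
  have "fold del (w @ replicate (ordr q s) s) W = p"
    unfolding w fold_del append_assoc using wsubD(3)[OF assms(1)] by blast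
  then show "(del s ^^ ordr q s) p = p" by (simp add: w)
  show "\<exists>w. fold del w W = p" using w by blast
qed (rule assms orb_self del_orb | assumption)+

lemma subs_pmodel: "W \<in> subs q N \<Longrightarrow> q > 0 \<Longrightarrow> pmodel q (orb W) del W"
  by (auto simp: subs_def wsub_pmodel)

lemma subs_stab: "W \<in> subs q N \<Longrightarrow> stab del W = W"
  by (auto simp: subs_def stab_del)

lemma subs_card: "W \<in> subs q N \<Longrightarrow> card (orb W) = N"
  by (simp add: subs_def)

lemma subs_pos: assumes "W \<in> subs q N" shows "N > 0"
proof -
  have fin: "finite (orb W)" and N: "card (orb W) = N" using assms by (simp_all add: subs_def)
  have "orb W \<noteq> {}" using orb_self by blast
  then show ?thesis unfolding N[symmetric] card_gt_0_iff using fin by blast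
qed

lemma mem_wsub_iff: assumes "wsub q W" shows "w \<in> W \<longleftrightarrow> fold del w W = W"
proof -
  have "w \<in> W \<longleftrightarrow> w \<in> stab del W" by (simp only: stab_del[OF assms])
  then show ?thesis by (simp only: stab_def mem_Collect_eq)
qed

lemma finite_subs: assumes "q > 0" shows "finite (subs q N)"
proof -
  let ?F = "{\<delta> :: xy \<Rightarrow> nat \<Rightarrow> nat. \<forall>s. \<delta> s \<in> {..<N} \<rightarrow>\<^sub>E {..<N}}"
  let ?g = "\<lambda>(a, b) s. case s of gen_x \<Rightarrow> a | gen_y \<Rightarrow> b"
  have "?F \<subseteq> ?g ` (({..<N} \<rightarrow>\<^sub>E {..<N}) \<times> ({..<N} \<rightarrow>\<^sub>E {..<N}))"
  proof
    fix d :: "xy \<Rightarrow> nat \<Rightarrow> nat" assume "d \<in> ?F"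
    moreover have "d = ?g (d gen_x, d gen_y)" by (auto split: xy.splits)
    ultimately show "d \<in> ?g ` (({..<N} \<rightarrow>\<^sub>E {..<N}) \<times> ({..<N} \<rightarrow>\<^sub>E {..<N}))" by blast
  qed
  then have fin: "finite ?F"
    by (rule finite_subset) (intro finite_imageI finite_cartesian_product finite_PiE finite_lessThan)
  have "subs q N \<subseteq> (\<lambda>(\<delta>, e). stab \<delta> e) ` (?F \<times> {..<N})"
  proof
    fix W assume W: "W \<in> subs q N"
    interpret pmodel q "orb W" del W using W assms by (rule subs_pmodel)
    obtain h where h: "bij_betw h (orb W) {..<N}"
      using finD subs_card[OF W] by (metis ex_bij_betw_finite_nat lessThan_atLeast0)
    define d where "d = (\<lambda>s. \<lambda>i\<in>{..<N}. h (del s (inv_into (orb W) h i)))"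
    have inj: "inj_on h (orb W)" using h by (simp add: bij_betw_def)
    have inN: "h V \<in> {..<N}" if "V \<in> orb W" for V using h that by (auto simp: bij_betw_def)
    have "stab del W = stab d (h W)"
    proof (rule pmodel_iso_stab[OF pmodel_axioms inj HOL.refl])
      fix s p assume p: "p \<in> orb W"
      then show "h (del s p) = d s (h p)" using inN[OF p] inj by (simp add: d_def)
    qed
    moreover have "d \<in> ?F"
    proof (intro CollectI allI)
      fix s
      have "inv_into (orb W) h i \<in> orb W" if "i < N" for i
        using h that by (metis bij_betw_imp_surj_on inv_into_into lessThan_iff)
      then show "d s \<in> {..<N} \<rightarrow>\<^sub>E {..<N}"
        unfolding d_def by (intro restrict_PiE_iff[THEN iffD2] ballI inN closed) simp_all
    qed
    ultimately show "W \<in> (\<lambda>(\<delta>, e). stab \<delta> e) ` (?F \<times> {..<N})"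
      using subs_stab[OF W] inN[OF eD] by (intro image_eqI[of _ _ "(d, h W)"]) simp_all
  qed
  then show ?thesis using fin by (meson finite_SigmaI finite_imageI finite_lessThan finite_subset)
qed

section \<open>Functions with prescribed products along cycles\<close>

lemma bij_xy_fun:
  "bij_betw (\<lambda>f. (f gen_x, f gen_y)) {f. f gen_x \<in> A \<and> f gen_y \<in> B} (A \<times> B)"
proof (rule bij_betw_byWitness[where f' = "\<lambda>(a, b) s. case s of gen_x \<Rightarrow> a | gen_y \<Rightarrow> b"])
  show "\<forall>f\<in>{f. f gen_x \<in> A \<and> f gen_y \<in> B}.
      (case (f gen_x, f gen_y) of (a, b) \<Rightarrow> \<lambda>s. case s of gen_x \<Rightarrow> a | gen_y \<Rightarrow> b) = f"
    by (auto simp: fun_eq_iff split: xy.splits)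
qed auto

text \<open>The product of the labels \<open>f\<close> along the path that starts at the coset \<open>V\<close> and reads the word.\<close>

fun hol :: "('a, 'b) monoid_scheme \<Rightarrow> (xy \<Rightarrow> xy list set \<Rightarrow> 'a) \<Rightarrow> xy list set \<Rightarrow> xy list \<Rightarrow> 'a" where
  "hol G f V [] = \<one>\<^bsub>G\<^esub>"
| "hol G f V (s # w) = f s V \<otimes>\<^bsub>G\<^esub> hol G f (del s V) w"

text \<open>The product of the labels \<open>g\<close> along \<open>n\<close> steps of \<open>\<sigma>\<close> starting at \<open>p\<close>.\<close>

fun hp :: "('a, 'b) monoid_scheme \<Rightarrow> ('p \<Rightarrow> 'a) \<Rightarrow> ('p \<Rightarrow> 'p) \<Rightarrow> nat \<Rightarrow> 'p \<Rightarrow> 'a" where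
  "hp G g \<sigma> 0 p = \<one>\<^bsub>G\<^esub>"
| "hp G g \<sigma> (Suc n) p = g p \<otimes>\<^bsub>G\<^esub> hp G g \<sigma> n (\<sigma> p)"

lemma hol_replicate: "hol G f V (replicate n s) = hp G (f s) (del s) n V"
  by (induction n arbitrary: V) simp_all

text \<open>The labellings of the edges of the coset graph of \<open>W\<close> by elements of \<open>G\<close> for which every closed path
that reads a relator has product \<open>z\<close>.\<close>

definition lifts :: "nat \<Rightarrow> ('a, 'b) monoid_scheme \<Rightarrow> 'a \<Rightarrow> xy list set \<Rightarrow> (xy \<Rightarrow> xy list set \<Rightarrow> 'a) set" where
  "lifts q G z W = {f. \<forall>s. f s \<in> orb W \<rightarrow>\<^sub>E carrier G \<and>
     (\<forall>V\<in>orb W. hol G f V (replicate (ordr q s) s) = z)}"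

text \<open>The functions on \<open>W\<close> that are multiplicative and get multiplied by \<open>z\<close> when a relator is inserted
into a word. For trivial \<open>z\<close> they are the homomorphisms from \<open>W\<close> to \<open>G\<close>. They are taken to be extensional so that
they can be counted.\<close>

definition coc :: "nat \<Rightarrow> ('a, 'b) monoid_scheme \<Rightarrow> 'a \<Rightarrow> xy list set \<Rightarrow> (xy list \<Rightarrow> 'a) set" where
  "coc q G z W = {\<psi> \<in> W \<rightarrow>\<^sub>E carrier G. (\<forall>u\<in>W. \<forall>v\<in>W. \<psi> (u @ v) = \<psi> u \<otimes>\<^bsub>G\<^esub> \<psi> v) \<and>
     (\<forall>s u v. u @ v \<in> W \<longrightarrow> \<psi> (u @ replicate (ordr q s) s @ v) = z \<otimes>\<^bsub>G\<^esub> \<psi> (u @ v))}"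

text \<open>The labellings of \<open>S\<close> whose product along \<open>l\<close> steps of \<open>\<sigma>\<close> is \<open>z\<close> from every starting point; those
for \<open>l = 2\<close> and \<open>l = q\<close> are the two components of \<open>lifts\<close>.\<close>

definition sols where
  "sols G z l \<sigma> S = {g \<in> S \<rightarrow>\<^sub>E carrier G. \<forall>p\<in>S. hp G g \<sigma> l p = z}"

lemma funpow_add_apply: fixes f :: "'a \<Rightarrow> 'a" shows "(f ^^ a) ((f ^^ b) p) = (f ^^ (a + b)) p"
  by (simp only: funpow_add comp_apply)

text \<open>A point moved by a permutation of prime order \<open>l\<close> has a cycle of length \<open>l\<close>.\<close>

lemma funpow_prime_inj:
  fixes l :: nat
  assumes "Factorial_Ring.prime l" "(\<sigma> ^^ l) p = p" "\<sigma> p \<noteq> p"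
  shows "inj_on (\<lambda>i. (\<sigma> ^^ i) p) {..<l}"
proof (rule ccontr)
  have l: "l > 1" using assms(1) prime_gt_1_nat by blast
  assume "\<not> ?thesis"
  then obtain i j where ij: "i < j" "j < l" "(\<sigma> ^^ i) p = (\<sigma> ^^ j) p"
    unfolding inj_on_def by (metis lessThan_iff linorder_neqE_nat)
  have "(\<sigma> ^^ (l - i)) ((\<sigma> ^^ i) p) = (\<sigma> ^^ (l - i)) ((\<sigma> ^^ j) p)" using ij(3) by (rule arg_cong)
  moreover have "l - i + i = l" "l - i + j = (j - i) + l" using ij by simp_all
  ultimately have "(\<sigma> ^^ l) p = (\<sigma> ^^ ((j - i) + l)) p" by (simp only: funpow_add_apply)
  then have e: "(\<sigma> ^^ (j - i)) p = p" by (simp only: funpow_add_apply[symmetric] assms(2))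
  have "\<not> l dvd (j - i)" using ij by (intro nat_dvd_not_less) auto
  then have cop: "coprime (j - i) l"
    using assms(1) by (simp add: prime_imp_coprime coprime_commute)
  obtain a b where ab: "(j - i) * a = l * b + 1"
    using coprime_bezout_strong[OF cop] l by blast
  have "(\<sigma> ^^ ((j - i) * a)) p = p" using funpow_mod_eq[OF e, of "(j - i) * a"] by simp
  moreover have "(\<sigma> ^^ (l * b + 1)) p = \<sigma> p"
    using funpow_mod_eq[OF assms(2), of "l * b"] by simp
  ultimately show False using assms(3) ab by simp
qed

text \<open>A finite group with a distinguished central element.\<close>

locale central_group = group G for G (structure) +
  fixes z assumes fin: "finite (carrier G)" and z [simp]: "z \<in> carrier G"
    and zc: "g \<in> carrier G \<Longrightarrow> z \<otimes> g = g \<otimes> z"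
begin

lemma hp_cong:
  assumes "\<And>i. i < n \<Longrightarrow> g ((\<sigma> ^^ i) p) = g' ((\<sigma> ^^ i) p)"
  shows "hp G g \<sigma> n p = hp G g' \<sigma> n p"
  using assms
proof (induction n arbitrary: p)
  case (Suc n)
  have "hp G g \<sigma> n (\<sigma> p) = hp G g' \<sigma> n (\<sigma> p)"
  proof (rule Suc.IH)
    fix i assume "i < n"
    then show "g ((\<sigma> ^^ i) (\<sigma> p)) = g' ((\<sigma> ^^ i) (\<sigma> p))"
      using Suc.prems[of "Suc i"] by (simp add: funpow_swap1)
  qed
  then show ?case using Suc.prems[of 0] by simp
qed simp

lemma hp_closed:
  assumes "\<forall>p\<in>S. \<sigma> p \<in> S" "\<forall>p\<in>S. g p \<in> carrier G"
  shows "p \<in> S \<Longrightarrow> hp G g \<sigma> n p \<in> carrier G"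
  by (induction n arbitrary: p) (simp_all add: assms)

lemma hp_Suc_right:
  assumes "\<forall>p\<in>S. \<sigma> p \<in> S" "\<forall>p\<in>S. g p \<in> carrier G"
  shows "p \<in> S \<Longrightarrow> hp G g \<sigma> (Suc n) p = hp G g \<sigma> n p \<otimes> g ((\<sigma> ^^ n) p)"
proof (induction n arbitrary: p)
  case (Suc n)
  have S: "(\<sigma> ^^ i) r \<in> S" if "r \<in> S" for i r using that assms(1) by (induction i) simp_all
  have sp: "\<sigma> p \<in> S" using assms(1) Suc.prems by blast
  have c: "g p \<in> carrier G" "hp G g \<sigma> n (\<sigma> p) \<in> carrier G" "g ((\<sigma> ^^ n) (\<sigma> p)) \<in> carrier G"
    using hp_closed[OF assms sp] assms(2) Suc.prems S[OF sp] by blast+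
  have "hp G g \<sigma> (Suc (Suc n)) p = g p \<otimes> (hp G g \<sigma> n (\<sigma> p) \<otimes> g ((\<sigma> ^^ n) (\<sigma> p)))"
    using Suc.IH[OF sp] by simp
  also have "\<dots> = hp G g \<sigma> (Suc n) p \<otimes> g ((\<sigma> ^^ n) (\<sigma> p))"
    using c by (simp add: m_assoc)
  finally show ?case by (simp only: funpow_Suc_right comp_apply)
qed (simp add: assms)

text \<open>For a central \<open>z\<close> the condition at one point of a cycle implies the condition at the next one, because
the two products are conjugate.\<close>

lemma hp_shift:
  assumes "\<forall>p\<in>S. \<sigma> p \<in> S" "\<forall>p\<in>S. g p \<in> carrier G"
    and p: "p \<in> S" "(\<sigma> ^^ l) p = p" "hp G g \<sigma> l p = z" and l: "l > 0"
  shows "hp G g \<sigma> l (\<sigma> p) = z"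
proof -
  obtain n where n: "l = Suc n" using l by (cases l) auto
  have sp: "\<sigma> p \<in> S" using assms(1) p(1) by blast
  have c: "hp G g \<sigma> n (\<sigma> p) \<in> carrier G" using sp by (rule hp_closed[OF assms(1,2)])
  have gp: "g p \<in> carrier G" using assms(2) p(1) by blast
  have eq: "g p \<otimes> hp G g \<sigma> n (\<sigma> p) = z" using p(3) unfolding n hp.simps .
  have "hp G g \<sigma> l (\<sigma> p) = hp G g \<sigma> n (\<sigma> p) \<otimes> g ((\<sigma> ^^ n) (\<sigma> p))"
    unfolding n using sp by (rule hp_Suc_right[OF assms(1,2)])
  also have "(\<sigma> ^^ n) (\<sigma> p) = p" using p(2) unfolding n by (simp only: funpow_Suc_right comp_apply)
  also have "hp G g \<sigma> n (\<sigma> p) \<otimes> g p = z"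
  proof -
    have "g p \<otimes> (hp G g \<sigma> n (\<sigma> p) \<otimes> g p) = g p \<otimes> hp G g \<sigma> n (\<sigma> p) \<otimes> g p"
      using c gp by (simp add: m_assoc)
    also have "\<dots> = g p \<otimes> z" unfolding eq by (rule zc[OF gp])
    finally show ?thesis using c gp by simp
  qed
  finally show ?thesis .
qed

lemma hp_const: "\<sigma> p = p \<Longrightarrow> g p \<in> carrier G \<Longrightarrow> hp G g \<sigma> n p = g p [^] n"
proof (induction n)
  case (Suc n)
  then show ?case by (simp only: hp.simps nat_pow_Suc2)
qed simp

lemma card_sols_fixed:
  assumes "\<sigma> p = p"
  shows "card (sols G z l \<sigma> {p}) = card {\<alpha> \<in> carrier G. \<alpha> [^] l = z}"
proof (rule bij_betw_same_card[of "\<lambda>g. g p"],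
    rule bij_betw_byWitness[where f' = "\<lambda>a. \<lambda>r\<in>{p}. a"])
  show "\<forall>g\<in>sols G z l \<sigma> {p}. (\<lambda>r\<in>{p}. g p) = g"
    by (auto simp: sols_def fun_eq_iff restrict_def PiE_def extensional_def)
  show "(\<lambda>g. g p) ` sols G z l \<sigma> {p} \<subseteq> {\<alpha> \<in> carrier G. \<alpha> [^] l = z}"
    using hp_const[of \<sigma> p, OF assms] by (auto simp: sols_def PiE_def)
  show "(\<lambda>a. \<lambda>r\<in>{p}. a) ` {\<alpha> \<in> carrier G. \<alpha> [^] l = z} \<subseteq> sols G z l \<sigma> {p}"
  proof clarify
    fix a assume "a \<in> carrier G" "z = a [^] l"
    then show "(\<lambda>r\<in>{p}. a) \<in> sols G (a [^] l) l \<sigma> {p}"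
      using hp_const[of \<sigma> p "\<lambda>r\<in>{p}. a", OF assms] by (simp add: sols_def)
  qed
qed simp

text \<open>On a cycle of full length all labels but one are arbitrary, and the last one is determined.\<close>

lemma card_sols_cycle:
  assumes T: "T = (\<lambda>i. (\<sigma> ^^ i) p) ` {..<l}" and inj: "inj_on (\<lambda>i. (\<sigma> ^^ i) p) {..<l}"
    and cyc: "(\<sigma> ^^ l) p = p" and l: "l > 0"
  shows "card (sols G z l \<sigma> T) = card (carrier G) ^ (l - 1)"
proof -
  obtain n where n: "l = Suc n" using l by (cases l) auto
  have pT: "p \<in> T" unfolding T using l by (intro image_eqI[of _ _ 0]) auto
  have iT: "(\<sigma> ^^ i) p \<in> T" for i
  proof -
    have "(\<sigma> ^^ (i mod l)) p = (\<sigma> ^^ i) p" by (rule funpow_mod_eq[OF cyc])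
    then show ?thesis unfolding T using l by (intro image_eqI[of _ _ "i mod l"]) auto
  qed
  have clo: "\<sigma> r \<in> T" if r: "r \<in> T" for r
  proof -
    obtain i where "r = (\<sigma> ^^ i) p" using r unfolding T by blast
    then have "\<sigma> r = (\<sigma> ^^ Suc i) p" by simp
    then show ?thesis by (simp only: iT)
  qed
  have cT: "(\<sigma> ^^ l) r = r" if r: "r \<in> T" for r
  proof -
    obtain i where i: "r = (\<sigma> ^^ i) p" using r unfolding T by blast
    have "(\<sigma> ^^ l) r = (\<sigma> ^^ (i + l)) p" unfolding i by (simp only: add.commute[of i] funpow_add comp_apply)
    also have "\<dots> = r" unfolding funpow_add comp_apply cyc i ..
    finally show ?thesis .
  qed
  have ne: "(\<sigma> ^^ i) (\<sigma> p) \<noteq> p" if "i < n" for i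
    using inj_onD[OF inj, of "Suc i" 0] that n by (auto simp: funpow_swap1)
  have mem: "(\<sigma> ^^ i) (\<sigma> p) \<in> T" for i
  proof -
    have "(\<sigma> ^^ i) (\<sigma> p) = (\<sigma> ^^ Suc i) p" by (simp only: funpow_Suc_right comp_apply)
    then show ?thesis by (simp only: iT)
  qed
  have "bij_betw (\<lambda>g. restrict g (T - {p})) (sols G z l \<sigma> T) (T - {p} \<rightarrow>\<^sub>E carrier G)"
  proof (intro bij_betw_imageI inj_onI)
    fix g g' assume g: "g \<in> sols G z l \<sigma> T" and g': "g' \<in> sols G z l \<sigma> T"
      and eq: "restrict g (T - {p}) = restrict g' (T - {p})"
    have gc: "g r \<in> carrier G" "g' r \<in> carrier G" if "r \<in> T" for r
      using g g' that by (auto simp: sols_def PiE_def Pi_def)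
    have e: "g r = g' r" if "r \<in> T" "r \<noteq> p" for r
      using fun_cong[OF eq, of r] that by (simp add: restrict_def)
    have h: "hp G g \<sigma> n (\<sigma> p) = hp G g' \<sigma> n (\<sigma> p)" by (rule hp_cong) (use e mem ne in blast)
    have hc: "hp G g \<sigma> n (\<sigma> p) \<in> carrier G" using hp_closed[of T \<sigma> g "\<sigma> p" n] clo gc(1) pT by blast
    have "g p \<otimes> hp G g \<sigma> n (\<sigma> p) = z" "g' p \<otimes> hp G g' \<sigma> n (\<sigma> p) = z"
      using g g' pT by (simp_all add: sols_def n)
    then have "g p = g' p" using h hc gc[OF pT] by (metis r_cancel)
    then show "g = g'" using e g g'
      by (intro extensionalityI[of _ T]) (auto simp: sols_def PiE_def)
  next
    show "(\<lambda>g. restrict g (T - {p})) ` sols G z l \<sigma> T = T - {p} \<rightarrow>\<^sub>E carrier G"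
    proof (intro equalityI subsetI)
      fix k assume "k \<in> (\<lambda>g. restrict g (T - {p})) ` sols G z l \<sigma> T"
      then show "k \<in> T - {p} \<rightarrow>\<^sub>E carrier G" by (auto simp: sols_def PiE_def Pi_def)
    next
      fix k assume k: "k \<in> T - {p} \<rightarrow>\<^sub>E carrier G"
      define k1 where "k1 = k(p := \<one>)"
      define h where "h = hp G k1 \<sigma> n (\<sigma> p)"
      have k1c: "k1 r \<in> carrier G" if "r \<in> T" for r using k that by (auto simp: k1_def PiE_def Pi_def)
      have hc: "h \<in> carrier G" unfolding h_def
        using hp_closed[of T \<sigma> k1 "\<sigma> p" n] clo k1c pT by blast
      define g where "g = k(p := z \<otimes> inv h)"
      have gT: "g \<in> T \<rightarrow>\<^sub>E carrier G"
        using k pT hc by (auto simp: g_def PiE_def Pi_def extensional_def)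
      have gc: "g r \<in> carrier G" if "r \<in> T" for r using gT that by auto
      have "hp G g \<sigma> n (\<sigma> p) = h" unfolding h_def
        by (rule hp_cong) (use ne in \<open>auto simp: g_def k1_def\<close>)
      then have base: "hp G g \<sigma> l p = z" using hc by (simp add: n g_def m_assoc)
      have "hp G g \<sigma> l ((\<sigma> ^^ i) p) = z" for i
      proof (induction i)
        case (Suc i)
        then show ?case
          using hp_shift[of T \<sigma> g "(\<sigma> ^^ i) p" l] clo gc iT cT l by simp
      qed (simp add: base)
      then have "g \<in> sols G z l \<sigma> T" using gT by (auto simp: sols_def T)
      moreover have "restrict g (T - {p}) = k"
        using k by (auto simp: fun_eq_iff g_def restrict_def PiE_def extensional_def)
      ultimately show "k \<in> (\<lambda>g. restrict g (T - {p})) ` sols G z l \<sigma> T" by blast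
    qed
  qed
  then have "card (sols G z l \<sigma> T) = card (T - {p} \<rightarrow>\<^sub>E carrier G)" by (rule bij_betw_same_card)
  also have "\<dots> = card (carrier G) ^ card (T - {p})"
    using T by (simp add: card_PiE)
  also have "card (T - {p}) = l - 1"
    using card_image[OF inj] pT T by (simp add: card_Diff_singleton)
  finally show ?thesis .
qed

lemma card_sols_union:
  assumes "T \<inter> S = {}" "\<And>p. p \<in> T \<Longrightarrow> \<sigma> p \<in> T" "\<And>p. p \<in> S \<Longrightarrow> \<sigma> p \<in> S"
  shows "card (sols G z l \<sigma> (T \<union> S)) = card (sols G z l \<sigma> T) * card (sols G z l \<sigma> S)"
proof -
  have T: "(\<sigma> ^^ i) p \<in> T" if "p \<in> T" for i p using that assms(2) by (induction i) auto
  have S: "(\<sigma> ^^ i) p \<in> S" if "p \<in> S" for i p using that assms(3) by (induction i) auto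
  let ?c = "\<lambda>(a, b) p. if p \<in> T then a p else b p"
  have "bij_betw (\<lambda>g. (restrict g T, restrict g S)) (sols G z l \<sigma> (T \<union> S))
     (sols G z l \<sigma> T \<times> sols G z l \<sigma> S)"
  proof (rule bij_betw_byWitness[where f' = ?c])
    show "\<forall>g\<in>sols G z l \<sigma> (T \<union> S). ?c (restrict g T, restrict g S) = g"
      by (auto simp: sols_def fun_eq_iff restrict_def PiE_def extensional_def)
    show "\<forall>ab\<in>sols G z l \<sigma> T \<times> sols G z l \<sigma> S. (restrict (?c ab) T, restrict (?c ab) S) = ab"
      using assms(1) by (auto simp: sols_def fun_eq_iff restrict_def PiE_def extensional_def)
    show "(\<lambda>g. (restrict g T, restrict g S)) ` sols G z l \<sigma> (T \<union> S) \<subseteq> sols G z l \<sigma> T \<times> sols G z l \<sigma> S"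
    proof clarify
      fix g assume g: "g \<in> sols G z l \<sigma> (T \<union> S)"
      have "hp G (restrict g T) \<sigma> l p = z" if "p \<in> T" for p
        using hp_cong[of l "restrict g T" \<sigma> p g] T[OF that] that g by (simp add: sols_def)
      moreover have "hp G (restrict g S) \<sigma> l p = z" if "p \<in> S" for p
        using hp_cong[of l "restrict g S" \<sigma> p g] S[OF that] that g by (simp add: sols_def)
      ultimately show "restrict g T \<in> sols G z l \<sigma> T \<and> restrict g S \<in> sols G z l \<sigma> S"
        using g by (auto simp: sols_def PiE_def Pi_def)
    qed
    show "?c ` (sols G z l \<sigma> T \<times> sols G z l \<sigma> S) \<subseteq> sols G z l \<sigma> (T \<union> S)"
    proof clarify
      fix a b assume ab: "a \<in> sols G z l \<sigma> T" "b \<in> sols G z l \<sigma> S"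
      let ?d = "\<lambda>p. if p \<in> T then a p else b p"
      have "hp G ?d \<sigma> l p = z" if "p \<in> T" for p
        using hp_cong[of l ?d \<sigma> p a] T[OF that] that ab by (simp add: sols_def)
      moreover have "hp G ?d \<sigma> l p = z" if "p \<in> S" for p
      proof -
        have "(\<sigma> ^^ i) p \<notin> T" for i using S[OF that, of i] assms(1) by blast
        then show ?thesis using hp_cong[of l ?d \<sigma> p b] that ab by (simp add: sols_def)
      qed
      ultimately show "?d \<in> sols G z l \<sigma> (T \<union> S)"
        using ab assms(1) by (auto simp: sols_def PiE_def Pi_def extensional_def)
    qed
  qed
  then show ?thesis by (simp add: bij_betw_same_card card_cartesian_product)
qed

text \<open>A permutation of prime order \<open>l\<close> has fixed points, where the label is an \<open>l\<close>-th root of \<open>z\<close>, and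
cycles of length \<open>l\<close>; here \<open>k\<close> is the number of these cycles.\<close>

lemma card_sols:
  fixes l :: nat
  assumes "Factorial_Ring.prime l" "finite S" "\<And>p. p \<in> S \<Longrightarrow> \<sigma> p \<in> S"
    "\<And>p. p \<in> S \<Longrightarrow> (\<sigma> ^^ l) p = p"
  shows "\<exists>k. card S = card {p \<in> S. \<sigma> p = p} + l * k \<and>
    card (sols G z l \<sigma> S) = card {\<alpha> \<in> carrier G. \<alpha> [^] l = z} ^ card {p \<in> S. \<sigma> p = p}
       * card (carrier G) ^ ((l - 1) * k)"
  using assms(2-)
proof (induction "card S" arbitrary: S rule: less_induct)
  case less
  have l: "l > 1" using assms(1) prime_gt_1_nat by blast
  show ?case
  proof (cases "S = {}")
    case True
    then have "sols G z l \<sigma> S = {\<lambda>_. undefined}" by (auto simp: sols_def)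
    then show ?thesis using True by (intro exI[of _ 0]) simp
  next
    case False
    then obtain p where p: "p \<in> S" by blast
    have iS: "(\<sigma> ^^ i) p \<in> S" for i using p less.prems(2) by (induction i) auto
    \<comment> \<open>The orbit of a point is split off, and the rest is smaller.\<close>
    define T where "T = (\<lambda>i. (\<sigma> ^^ i) p) ` {..<l}"
    have cyc: "(\<sigma> ^^ l) p = p" using less.prems(3) p by blast
    have pT: "p \<in> T" unfolding T_def using l by (intro image_eqI[of _ _ 0]) auto
    have TS: "T \<subseteq> S" using iS by (auto simp: T_def)
    have iT: "(\<sigma> ^^ i) p \<in> T" for i
    proof -
      have "(\<sigma> ^^ (i mod l)) p = (\<sigma> ^^ i) p" by (rule funpow_mod_eq[OF cyc])
      then show ?thesis unfolding T_def using l by (intro image_eqI[of _ _ "i mod l"]) auto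
    qed
    have clo: "(\<sigma> ^^ j) r \<in> T" if r: "r \<in> T" for r j
    proof -
      obtain i where "r = (\<sigma> ^^ i) p" using r unfolding T_def by blast
      then have "(\<sigma> ^^ j) r = (\<sigma> ^^ (j + i)) p" by (simp only: funpow_add comp_apply)
      then show ?thesis by (simp only: iT)
    qed
    have clo1: "\<sigma> r \<in> T" if "r \<in> T" for r using clo[OF that, of 1] by simp
    define S' where "S' = S - T"
    have S'clo: "\<sigma> r \<in> S'" if r: "r \<in> S'" for r
    proof -
      have "r \<in> S" "r \<notin> T" using r by (auto simp: S'_def)
      moreover have "r \<in> T" if "\<sigma> r \<in> T"
      proof -
        have "(\<sigma> ^^ Suc (l - 1)) r = r" using less.prems(3)[OF \<open>r \<in> S\<close>] l by simp
        then have "(\<sigma> ^^ (l - 1)) (\<sigma> r) = r" by (simp only: funpow_Suc_right comp_apply)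
        then show ?thesis using clo[OF that, of "l - 1"] by simp
      qed
      ultimately show ?thesis using less.prems(2) by (auto simp: S'_def)
    qed
    have fS': "finite S'" "finite T" using less.prems(1) TS finite_subset by (auto simp: S'_def)
    have "card S' < card S" unfolding S'_def
      by (rule psubset_card_mono) (use less.prems(1) p pT in auto)
    then obtain k where k: "card S' = card {p \<in> S'. \<sigma> p = p} + l * k"
      "card (sols G z l \<sigma> S') = card {\<alpha> \<in> carrier G. \<alpha> [^] l = z} ^ card {p \<in> S'. \<sigma> p = p}
         * card (carrier G) ^ ((l - 1) * k)"
      using less.hyps[of S'] fS' S'clo less.prems(3) S'_def by blast
    have SU: "S = T \<union> S'" "T \<inter> S' = {}" using TS by (auto simp: S'_def)
    have cS: "card S = card T + card S'" using SU fS' card_Un_disjoint by metis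
    have m: "card (sols G z l \<sigma> S) = card (sols G z l \<sigma> T) * card (sols G z l \<sigma> S')"
      using card_sols_union[OF SU(2) clo1 S'clo] SU(1) by simp
    have fS: "{p \<in> S. \<sigma> p = p} = {p \<in> T. \<sigma> p = p} \<union> {p \<in> S'. \<sigma> p = p}" using SU(1) by blast
    have cf: "card {p \<in> S. \<sigma> p = p} = card {p \<in> T. \<sigma> p = p} + card {p \<in> S'. \<sigma> p = p}"
      unfolding fS by (rule card_Un_disjoint) (use fS' SU in auto)
    show ?thesis
    proof (cases "\<sigma> p = p")
      case True
      then have "(\<sigma> ^^ i) p = p" for i by (induction i) auto
      then have T: "T = {p}" using l by (auto simp: T_def)
      have "{r \<in> T. \<sigma> r = r} = {p}" using T True by auto
      then show ?thesis
        using k cS cf m card_sols_fixed[of \<sigma> p, OF True] T by (intro exI[of _ k]) simp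
    next
      case False
      have inj: "inj_on (\<lambda>i. (\<sigma> ^^ i) p) {..<l}"
        by (rule funpow_prime_inj[OF assms(1) cyc False])
      have nf: "{r \<in> T. \<sigma> r = r} = {}"
      proof (rule ccontr)
        assume "\<not> ?thesis"
        then obtain i where i: "i < l" "\<sigma> ((\<sigma> ^^ i) p) = (\<sigma> ^^ i) p" by (auto simp: T_def)
        have f: "(\<sigma> ^^ j) ((\<sigma> ^^ i) p) = (\<sigma> ^^ i) p" for j using i(2) by (induction j) auto
        have "(\<sigma> ^^ (l - i)) ((\<sigma> ^^ i) p) = (\<sigma> ^^ (l - i + i)) p" by (simp only: funpow_add comp_apply)
        then have "p = (\<sigma> ^^ i) p" using f cyc i(1) by simp
        then show False using i(2) False by simp
      qed
      have cT: "card T = l" unfolding T_def using card_image[OF inj] by simp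
      have "card (sols G z l \<sigma> T) = card (carrier G) ^ (l - 1)"
        by (rule card_sols_cycle[OF T_def inj cyc]) (use l in simp)
      then show ?thesis
        using k cS cf m nf cT by (intro exI[of _ "Suc k"]) (simp add: power_add)
    qed
  qed
qed

end

section \<open>Counting cocycles by gauge fixing\<close>

text \<open>A subgroup \<open>W\<close> of finite index together with a group of labels and its central element \<open>z\<close>.\<close>

locale wcover = central_group G z for G (structure) and z +
  fixes q W
  assumes wW: "wsub q W" and finW: "finite (orb W)" and q0: "q > 0"
begin

sublocale M: pmodel q "orb W" del W
  by (rule wsub_pmodel[OF wW finW q0])

lemma mem_W: "w \<in> W \<longleftrightarrow> fold del w W = W"
  by (rule mem_wsub_iff[OF wW])

lemma W_Nil: "[] \<in> W" by (rule wsubD(1)[OF wW])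
lemma W_app: "u \<in> W \<Longrightarrow> u @ v \<in> W \<longleftrightarrow> v \<in> W" by (rule wsubD(2)[OF wW])
lemma W_rel: "u @ replicate (ordr q s) s @ v \<in> W \<longleftrightarrow> u @ v \<in> W" by (rule wsubD(3)[OF wW])

lemma hol_closed:
  assumes "\<forall>s. \<forall>V\<in>orb W. f s V \<in> carrier G"
  shows "V \<in> orb W \<Longrightarrow> hol G f V w \<in> carrier G"
  by (induction w arbitrary: V) (simp_all add: assms M.closed)

lemma hol_append:
  assumes "\<forall>s. \<forall>V\<in>orb W. f s V \<in> carrier G"
  shows "V \<in> orb W \<Longrightarrow> hol G f V (u @ v) = hol G f V u \<otimes> hol G f (fold del u V) v"
proof (induction u arbitrary: V)
  case Nil
  then show ?case using hol_closed[OF assms] by simp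
next
  case (Cons s u)
  have V: "del s V \<in> orb W" using Cons.prems by (rule M.closed)
  show ?case using Cons.IH[OF V] assms Cons.prems hol_closed[OF assms V]
      hol_closed[OF assms M.fold_closed[OF V]]
    by (simp add: m_assoc)
qed

lemma liftsD:
  assumes "f \<in> lifts q G z W"
  shows "\<forall>s. \<forall>V\<in>orb W. f s V \<in> carrier G"
    "V \<in> orb W \<Longrightarrow> hol G f V (replicate (ordr q s) s) = z"
    "f s \<in> orb W \<rightarrow>\<^sub>E carrier G"
  using assms by (auto simp: lifts_def PiE_def Pi_def)

lemma cocD:
  assumes "\<psi> \<in> coc q G z W"
  shows "u \<in> W \<Longrightarrow> \<psi> u \<in> carrier G"
    "u \<in> W \<Longrightarrow> v \<in> W \<Longrightarrow> \<psi> (u @ v) = \<psi> u \<otimes> \<psi> v"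
    "u @ v \<in> W \<Longrightarrow> \<psi> (u @ replicate (ordr q s) s @ v) = z \<otimes> \<psi> (u @ v)"
    "\<psi> \<in> W \<rightarrow>\<^sub>E carrier G"
  using assms unfolding coc_def by blast+

lemma coc_Nil: assumes "\<psi> \<in> coc q G z W" shows "\<psi> [] = \<one>"
proof -
  have "\<psi> [] = \<psi> [] \<otimes> \<psi> []" using cocD(2)[OF assms W_Nil W_Nil] by simp
  then show ?thesis using cocD(1)[OF assms W_Nil] by (metis l_cancel_one')
qed

lemma zpow_comm:
  assumes g: "g \<in> carrier G" shows "z [^] (n::nat) \<otimes> g = g \<otimes> z [^] n"
proof (induction n)
  case (Suc n)
  have "z [^] Suc n \<otimes> g = z [^] n \<otimes> (z \<otimes> g)" using g by (simp add: m_assoc)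
  also have "\<dots> = z [^] n \<otimes> g \<otimes> z" unfolding zc[OF g] using g by (simp add: m_assoc)
  also have "\<dots> = g \<otimes> z [^] Suc n" unfolding Suc.IH using g by (simp add: m_assoc)
  finally show ?case .
qed (use g in simp)

text \<open>The holonomy of a labelling at the trivial coset.\<close>

definition holW where "holW f = restrict (hol G f W) W"

lemma holW_coc: assumes f: "f \<in> lifts q G z W" shows "holW f \<in> coc q G z W"
proof -
  note c = liftsD(1)[OF f]
  have cl: "hol G f W u \<in> carrier G" for u by (rule hol_closed[OF c orb_self])
  have "hol G f W (u @ replicate (ordr q s) s @ v) = z \<otimes> hol G f W (u @ v)" for u v s
  proof -
    let ?V = "fold del u W"
    have V: "?V \<in> orb W" by (rule M.fold_closed[OF orb_self])
    have a: "hol G f W u \<in> carrier G" "hol G f ?V v \<in> carrier G"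
      by (rule cl, rule hol_closed[OF c V])
    have "hol G f W (u @ replicate (ordr q s) s @ v) = hol G f W u \<otimes> (z \<otimes> hol G f ?V v)"
      unfolding hol_append[OF c orb_self] hol_append[OF c V] liftsD(2)[OF f V] M.fold_rel[OF V] ..
    also have "\<dots> = (hol G f W u \<otimes> z) \<otimes> hol G f ?V v" using a by (simp add: m_assoc)
    also have "\<dots> = z \<otimes> hol G f W (u @ v)"
      unfolding zc[OF a(1), symmetric] hol_append[OF c orb_self] using a by (simp add: m_assoc)
    finally show ?thesis .
  qed
  moreover have "hol G f W (u @ v) = hol G f W u \<otimes> hol G f W v" if "u \<in> W" for u v
    using that unfolding mem_W hol_append[OF c orb_self] by (simp only:)
  ultimately show ?thesis
    using cl W_app W_rel unfolding coc_def holW_def by (simp add: restrict_PiE_iff)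
qed

text \<open>A transversal: a word leading from the trivial coset to the coset \<open>V\<close>. It is empty for the trivial coset,
which makes the gauge below normalised there.\<close>

definition tr :: "xy list set \<Rightarrow> xy list" where
  "tr V = (if V = W then [] else SOME w. fold del w W = V)"

lemma tr_W [simp]: "tr W = []" by (simp add: tr_def)

lemma fold_tr: assumes "V \<in> orb W" shows "fold del (tr V) W = V"
proof (cases "V = W")
  case False
  then show ?thesis using someI_ex[OF M.reach[OF assms]] by (simp only: tr_def if_False)
qed simp

lemma coc_winv:
  assumes p: "\<psi> \<in> coc q G z W"
  shows "u @ v \<in> W \<Longrightarrow> u @ winv q t @ t @ v \<in> W \<and>
      \<psi> (u @ winv q t @ t @ v) = z [^] length t \<otimes> \<psi> (u @ v)"
proof (induction t arbitrary: u v)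
  case Nil
  then show ?case using cocD(1)[OF p] by simp
next
  case (Cons s t)
  have IH: "u @ winv q t @ t @ v \<in> W" "\<psi> (u @ winv q t @ t @ v) = z [^] length t \<otimes> \<psi> (u @ v)"
    using Cons.IH[OF Cons.prems] by blast+
  have rep: "replicate (ordr q s - 1) s @ [s] = replicate (ordr q s) s"
    using M.ordr_pos[of s] by (metis Suc_pred' replicate_Suc replicate_append_same)
  have w: "u @ winv q (s # t) @ (s # t) @ v = (u @ winv q t) @ replicate (ordr q s) s @ (t @ v)"
    unfolding rep[symmetric] winv_Cons by simp
  have m: "(u @ winv q t) @ (t @ v) \<in> W" using IH(1) by simp
  have "\<psi> ((u @ winv q t) @ replicate (ordr q s) s @ (t @ v)) = z \<otimes> (z [^] length t \<otimes> \<psi> (u @ v))"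
    unfolding cocD(3)[OF p m] using IH(2) by simp
  also have "\<dots> = z [^] length (s # t) \<otimes> \<psi> (u @ v)"
    using cocD(1)[OF p Cons.prems] zpow_comm[OF z, of "length t"]
    by (simp add: m_assoc[symmetric])
  finally show ?case unfolding w using m by (simp only: W_rel simp_thms)
qed

lemma coc_winv':
  assumes p: "\<psi> \<in> coc q G z W"
  shows "u @ v \<in> W \<Longrightarrow> u @ t @ winv q t @ v \<in> W \<and>
      \<psi> (u @ t @ winv q t @ v) = z [^] length t \<otimes> \<psi> (u @ v)"
proof (induction t arbitrary: u v)
  case Nil
  then show ?case using cocD(1)[OF p] by simp
next
  case (Cons s t)
  have rep: "[s] @ replicate (ordr q s - 1) s = replicate (ordr q s) s"
    using M.ordr_pos[of s] by (metis Suc_pred' replicate_Suc append_Cons append_Nil)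
  have m: "u @ replicate (ordr q s) s @ v \<in> W" using Cons.prems by (simp only: W_rel)
  have m': "(u @ [s]) @ (replicate (ordr q s - 1) s @ v) \<in> W"
    using m unfolding rep[symmetric] by simp
  have w: "u @ (s # t) @ winv q (s # t) @ v
      = (u @ [s]) @ t @ winv q t @ (replicate (ordr q s - 1) s @ v)"
    unfolding winv_Cons by simp
  have "(u @ [s]) @ (replicate (ordr q s - 1) s @ v) = u @ replicate (ordr q s) s @ v"
    unfolding rep[symmetric] by simp
  then have "\<psi> ((u @ [s]) @ (replicate (ordr q s - 1) s @ v)) = z \<otimes> \<psi> (u @ v)"
    by (simp only: cocD(3)[OF p Cons.prems])
  then show ?case unfolding w using Cons.IH[OF m'] cocD(1)[OF p Cons.prems]
    by (simp add: m_assoc[symmetric])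
qed

lemma tr_mem: assumes V: "V \<in> orb W" shows "tr V @ w @ winv q (tr (fold del w V)) \<in> W"
proof -
  have V': "fold del w V \<in> orb W" by (rule M.fold_closed[OF V])
  have "fold del (winv q (tr (fold del w V))) (fold del w V) = W"
    using M.fold_winv[OF orb_self, of "tr (fold del w V)"] unfolding fold_tr[OF V'] .
  then show ?thesis unfolding mem_W fold_append comp_apply fold_tr[OF V] .
qed

text \<open>If a path is closed up by the transversal, the value of \<open>\<psi>\<close> on the concatenation of two paths is the
product of the two values, up to the power of \<open>z\<close> that comes from cancelling the transversal against its
inverse word.\<close>

lemma coc_cross:
  assumes p: "\<psi> \<in> coc q G z W" and V: "V \<in> orb W"
  shows "\<psi> (tr V @ (w @ w') @ winv q (tr (fold del (w @ w') V)))
    = \<psi> (tr V @ w @ winv q (tr (fold del w V))) \<otimes> inv (z [^] length (tr (fold del w V)))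
      \<otimes> \<psi> (tr (fold del w V) @ w' @ winv q (tr (fold del w' (fold del w V))))"
    (is "_ = ?A \<otimes> inv ?z \<otimes> ?B")
proof -
  let ?t = "tr (fold del w V)" and ?r = "winv q (tr (fold del (w @ w') V))"
  have V': "fold del w V \<in> orb W" by (rule M.fold_closed[OF V])
  have m: "(tr V @ w) @ (w' @ ?r) \<in> W" using tr_mem[OF V, of "w @ w'"] by simp
  have mA: "tr V @ w @ winv q ?t \<in> W" by (rule tr_mem[OF V])
  have mB: "?t @ w' @ ?r \<in> W" using tr_mem[OF V', of w'] by simp
  have c: "?A \<in> carrier G" "\<psi> (?t @ w' @ ?r) \<in> carrier G" "?z \<in> carrier G"
      "\<psi> ((tr V @ w) @ (w' @ ?r)) \<in> carrier G"
    using cocD(1)[OF p] mA mB m by simp_all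
  have "?A \<otimes> \<psi> (?t @ w' @ ?r) = \<psi> ((tr V @ w) @ winv q ?t @ ?t @ (w' @ ?r))"
    using cocD(2)[OF p mA mB] by simp
  also have "\<dots> = ?z \<otimes> \<psi> ((tr V @ w) @ (w' @ ?r))" using coc_winv[OF p m] by blast
  finally have e: "?A \<otimes> \<psi> (?t @ w' @ ?r) = ?z \<otimes> \<psi> ((tr V @ w) @ (w' @ ?r))" .
  have zA: "inv ?z \<otimes> g = g \<otimes> inv ?z" if g: "g \<in> carrier G" for g
  proof -
    have "?z \<otimes> (inv ?z \<otimes> g) = ?z \<otimes> (g \<otimes> inv ?z)"
      using g c(3) zpow_comm[OF g, of "length ?t"] by (simp add: m_assoc[symmetric]) (simp add: m_assoc)
    then show ?thesis using g c(3) by (simp only: l_cancel inv_closed m_closed)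
  qed
  have "?A \<otimes> inv ?z \<otimes> \<psi> (?t @ w' @ ?r) = inv ?z \<otimes> (?A \<otimes> \<psi> (?t @ w' @ ?r))"
    using c zA[OF c(1)] by (simp add: m_assoc[symmetric])
  also have "\<dots> = \<psi> ((tr V @ w) @ (w' @ ?r))" unfolding e using c by (simp add: m_assoc[symmetric])
  finally show ?thesis by simp
qed

lemma inv_cancel: "a \<in> carrier G \<Longrightarrow> x \<in> carrier G \<Longrightarrow> a \<otimes> (inv a \<otimes> x) = x"
  by (simp add: m_assoc[symmetric])

text \<open>Every \<open>\<psi>\<close> is the holonomy of a labelling whose values on the transversal can be prescribed arbitrarily.
By \<open>gauge_unique\<close> these values determine the labelling.\<close>

lemma gauge_lift:
  assumes p: "\<psi> \<in> coc q G z W" and g: "g \<in> orb W - {W} \<rightarrow>\<^sub>E carrier G"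
  obtains f where "f \<in> lifts q G z W" "holW f = \<psi>"
    "\<And>V. V \<in> orb W - {W} \<Longrightarrow> hol G f W (tr V) = g V"
proof -
  define g' where "g' V = (if V = W then \<one> else g V)" for V
  define hz where "hz V = z [^] length (tr V)" for V
  define P where "P V w = \<psi> (tr V @ w @ winv q (tr (fold del w V)))" for V w
  \<comment> \<open>The label of an edge is its value closed up by the transversal, corrected by the power of \<open>z\<close> and by the prescribed gauge at both ends.\<close>
  define f where "f s = (\<lambda>V\<in>orb W. inv (g' V) \<otimes> (P V [s] \<otimes> inv (hz (del s V))) \<otimes> g' (del s V))" for s
  have gc: "g' V \<in> carrier G" if "V \<in> orb W" for V
    using g that by (auto simp: g'_def PiE_def Pi_def)
  have hc: "hz V \<in> carrier G" for V by (simp add: hz_def)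
  have Pc: "P V w \<in> carrier G" if "V \<in> orb W" for V w
    unfolding P_def by (rule cocD(1)[OF p tr_mem[OF that]])
  have fc: "f s V \<in> carrier G" if "V \<in> orb W" for s V
    using that gc[OF that] gc[OF M.closed[OF that]] hc Pc[OF that] by (simp add: f_def)
  have f_eq: "f s V = inv (g' V) \<otimes> (P V [s] \<otimes> inv (hz (del s V))) \<otimes> g' (del s V)"
    if "V \<in> orb W" for s V using that by (simp add: f_def)
  have hol: "V \<in> orb W \<Longrightarrow> hol G f V w
      = inv (g' V) \<otimes> (P V w \<otimes> inv (hz (fold del w V))) \<otimes> g' (fold del w V)" for V w
  proof (induction w arbitrary: V)
    case Nil
    have "P V [] = hz V"
      using coc_winv'[OF p, of "[]" "[]" "tr V"] W_Nil coc_Nil[OF p] by (simp add: P_def hz_def)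
    then show ?case using gc[OF Nil] hc by simp
  next
    case (Cons s w)
    let ?V = "del s V" and ?V' = "fold del w (del s V)"
    have V: "?V \<in> orb W" by (rule M.closed[OF Cons.prems])
    have V': "?V' \<in> orb W" by (rule M.fold_closed[OF V])
    note c = gc[OF Cons.prems] gc[OF V] gc[OF V'] hc[of ?V] hc[of ?V'] Pc[OF Cons.prems] Pc[OF V]
    have P: "P V (s # w) = P V [s] \<otimes> inv (hz ?V) \<otimes> P ?V w"
      using coc_cross[OF p Cons.prems, of "[s]" w] by (simp add: P_def hz_def)
    have "hol G f V (s # w) = (inv (g' V) \<otimes> (P V [s] \<otimes> inv (hz ?V)) \<otimes> g' ?V)
        \<otimes> (inv (g' ?V) \<otimes> (P ?V w \<otimes> inv (hz ?V')) \<otimes> g' ?V')"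
      by (simp only: hol.simps Cons.IH[OF V] f_eq[OF Cons.prems])
    also have "\<dots> = inv (g' V) \<otimes> (P V (s # w) \<otimes> inv (hz ?V')) \<otimes> g' ?V'"
      unfolding P using c by (simp add: m_assoc inv_cancel)
    finally show ?case by simp
  qed
  have "f \<in> lifts q G z W"
    unfolding lifts_def
  proof (intro CollectI allI conjI ballI)
    fix s show "f s \<in> orb W \<rightarrow>\<^sub>E carrier G" using fc by (auto simp: f_def)
  next
    fix s V assume V: "V \<in> orb W"
    have m: "tr V @ winv q (tr V) \<in> W" "\<psi> (tr V @ winv q (tr V)) = hz V"
      using coc_winv'[OF p, of "[]" "[]" "tr V"] W_Nil coc_Nil[OF p] by (simp_all add: hz_def)
    have "P V (replicate (ordr q s) s) = z \<otimes> hz V"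
      unfolding P_def M.fold_rel[OF V] cocD(3)[OF p m(1)] m(2) ..
    then show "hol G f V (replicate (ordr q s) s) = z"
      unfolding hol[OF V] M.fold_rel[OF V] using gc[OF V] hc[of V] zc[OF gc[OF V]]
      by (simp add: m_assoc) (simp add: m_assoc[symmetric])
  qed
  moreover have "holW f = \<psi>"
  proof
    fix w show "holW f w = \<psi> w"
    proof (cases "w \<in> W")
      case True
      then have "fold del w W = W" by (simp only: mem_W)
      then show ?thesis using True cocD(1)[OF p True]
        by (simp add: holW_def hol[OF orb_self] g'_def P_def hz_def)
    next
      case False
      then show ?thesis using cocD(4)[OF p] by (simp add: holW_def PiE_def extensional_def)
    qed
  qed
  moreover have "hol G f W (tr V) = g V" if V: "V \<in> orb W - {W}" for V
  proof -
    have V1: "V \<in> orb W" "V \<noteq> W" using V by blast+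
    have m: "\<psi> (tr V @ winv q (tr V)) = hz V"
      using coc_winv'[OF p, of "[]" "[]" "tr V"] W_Nil coc_Nil[OF p] by (simp add: hz_def)
    show ?thesis
      unfolding hol[OF orb_self] fold_tr[OF V1(1)] P_def
      using gc[OF V1(1)] hc[of V] V1 m by (simp add: g'_def)
  qed
  ultimately show ?thesis by (rule that)
qed

lemma gauge_unique:
  assumes f: "f \<in> lifts q G z W" and f': "f' \<in> lifts q G z W" and e: "holW f = holW f'"
    and t: "\<And>V. V \<in> orb W - {W} \<Longrightarrow> hol G f W (tr V) = hol G f' W (tr V)"
  shows "f = f'"
proof
  fix s
  note c = liftsD(1)[OF f] and c' = liftsD(1)[OF f']
  have eq: "hol G f W w = hol G f' W w" if "w \<in> W" for w
    using fun_cong[OF e, of w] that by (simp add: holW_def)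
  have tr: "hol G f W (tr V) = hol G f' W (tr V)" if "V \<in> orb W" for V
    using t[of V] that by (cases "V = W") auto
  have cl: "hol G f V w \<in> carrier G" "hol G f' V w \<in> carrier G" if "V \<in> orb W" for V w
    using hol_closed[OF c that] hol_closed[OF c' that] by blast+
  have inv_eq: "hol G f V (winv q (tr V)) = hol G f' V (winv q (tr V))" if V: "V \<in> orb W" for V
  proof -
    have "tr V @ winv q (tr V) \<in> W" using tr_mem[OF V, of "[]"] by simp
    from eq[OF this] show ?thesis
      unfolding hol_append[OF c orb_self] hol_append[OF c' orb_self] fold_tr[OF V] tr[OF V]
      using cl[OF V] cl[OF orb_self] by simp
  qed
  show "f s = f' s"
  proof (rule extensionalityI[of _ "orb W"])
    fix V assume V: "V \<in> orb W"
    let ?V = "del s V"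
    have V': "?V \<in> orb W" by (rule M.closed[OF V])
    have k: "f s V \<in> carrier G" "f' s V \<in> carrier G" using c c' V by blast+
    have "tr V @ [s] @ winv q (tr ?V) \<in> W" using tr_mem[OF V, of "[s]"] by simp
    from eq[OF this] show "f s V = f' s V"
      unfolding hol_append[OF c orb_self] hol_append[OF c' orb_self] fold_tr[OF V] tr[OF V]
      using cl[OF V'] cl[OF orb_self] k inv_eq[OF V'] by simp
  qed (use liftsD(3)[OF f, of s] liftsD(3)[OF f', of s] in \<open>auto simp: PiE_def\<close>)
qed

lemma finite_lifts: "finite (lifts q G z W)"
proof -
  let ?A = "orb W \<rightarrow>\<^sub>E carrier G"
  have "finite (?A \<times> ?A)" using finW fin by (intro finite_cartesian_product finite_PiE) auto
  then have "finite {f. f gen_x \<in> ?A \<and> f gen_y \<in> ?A}"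
    using bij_betw_finite[OF bij_xy_fun[of ?A ?A]] by simp
  then show ?thesis by (rule rev_finite_subset) (auto dest: liftsD(3))
qed

lemma card_fibre:
  assumes p: "\<psi> \<in> coc q G z W"
  shows "card {f \<in> lifts q G z W. holW f = \<psi>} = card (carrier G) ^ (card (orb W) - 1)"
proof -
  let ?F = "{f \<in> lifts q G z W. holW f = \<psi>}" and ?r = "\<lambda>f. \<lambda>V\<in>orb W - {W}. hol G f W (tr V)"
  have "bij_betw ?r ?F (orb W - {W} \<rightarrow>\<^sub>E carrier G)"
  proof (intro bij_betw_imageI inj_onI)
    fix f f' assume ff: "f \<in> ?F" "f' \<in> ?F" and e: "?r f = ?r f'"
    show "f = f'"
    proof (rule gauge_unique)
      fix V assume "V \<in> orb W - {W}"
      then show "hol G f W (tr V) = hol G f' W (tr V)" using fun_cong[OF e, of V] by simp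
    qed (use ff in auto)
  next
    show "?r ` ?F = (orb W - {W} \<rightarrow>\<^sub>E carrier G)"
    proof (intro equalityI subsetI)
      fix g assume "g \<in> ?r ` ?F"
      then obtain f where f: "f \<in> lifts q G z W" "g = ?r f" by blast
      show "g \<in> orb W - {W} \<rightarrow>\<^sub>E carrier G" unfolding f(2)
        by (intro restrict_PiE_iff[THEN iffD2] ballI hol_closed[OF liftsD(1)[OF f(1)] orb_self])
    next
      fix g assume g: "g \<in> orb W - {W} \<rightarrow>\<^sub>E carrier G"
      obtain f where f: "f \<in> lifts q G z W" "holW f = \<psi>"
        "\<And>V. V \<in> orb W - {W} \<Longrightarrow> hol G f W (tr V) = g V"
        by (rule gauge_lift[OF p g]) blast
      have "?r f = g"
        by (rule extensionalityI[of _ "orb W - {W}"]) (use f(3) g in \<open>auto simp: PiE_def\<close>)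
      then show "g \<in> ?r ` ?F" using f(1,2) by blast
    qed
  qed
  then have "card ?F = card (orb W - {W} \<rightarrow>\<^sub>E carrier G)" by (rule bij_betw_same_card)
  also have "\<dots> = card (carrier G) ^ card (orb W - {W})" using finW by (simp add: card_PiE)
  also have "card (orb W - {W}) = card (orb W) - 1" using finW orb_self by (simp add: card_Diff_singleton)
  finally show ?thesis .
qed

lemma finite_coc: "finite (coc q G z W)"
proof -
  have "coc q G z W \<subseteq> holW ` lifts q G z W"
  proof
    fix \<psi> assume p: "\<psi> \<in> coc q G z W"
    have "restrict (\<lambda>_. \<one>) (orb W - {W}) \<in> orb W - {W} \<rightarrow>\<^sub>E carrier G" by simp
    from gauge_lift[OF p this] show "\<psi> \<in> holW ` lifts q G z W" by blast
  qed
  then show ?thesis using finite_lifts finite_surj by blast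
qed

lemma card_lifts_coc:
  "card {f \<in> lifts q G z W. P (holW f)} = card {\<psi> \<in> coc q G z W. P \<psi>} * card (carrier G) ^ (card (orb W) - 1)"
proof -
  let ?C = "{\<psi> \<in> coc q G z W. P \<psi>}" and ?F = "\<lambda>\<psi>. {f \<in> lifts q G z W. holW f = \<psi>}"
  have "{f \<in> lifts q G z W. P (holW f)} = (\<Union>\<psi>\<in>?C. ?F \<psi>)"
    using holW_coc by auto
  also have "card \<dots> = (\<Sum>\<psi>\<in>?C. card (?F \<psi>))"
    by (rule card_UN_disjoint) (use finite_coc finite_lifts in auto)
  also have "\<dots> = (\<Sum>\<psi>\<in>?C. card (carrier G) ^ (card (orb W) - 1))"
    by (rule sum.cong) (use card_fibre in auto)
  finally show ?thesis by simp
qed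

lemma lifts_eq:
  "lifts q G z W = {f. f gen_x \<in> sols G z 2 (del gen_x) (orb W) \<and> f gen_y \<in> sols G z q (del gen_y) (orb W)}"
  (is "_ = ?R")
proof
  show "lifts q G z W \<subseteq> ?R"
  proof
    fix f assume "f \<in> lifts q G z W"
    then have "f s \<in> sols G z (ordr q s) (del s) (orb W)" for s
      by (auto simp: lifts_def sols_def hol_replicate)
    from this[of gen_x] this[of gen_y] show "f \<in> ?R" by simp
  qed
  show "?R \<subseteq> lifts q G z W"
  proof
    fix f assume "f \<in> ?R"
    then have "f s \<in> sols G z (ordr q s) (del s) (orb W)" for s by (cases s) auto
    then show "f \<in> lifts q G z W" by (auto simp: lifts_def sols_def hol_replicate)
  qed
qed

lemma card_lifts_prod:
  "card {f \<in> lifts q G z W. Q (f gen_x)} =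
    card {g \<in> sols G z 2 (del gen_x) (orb W). Q g} * card (sols G z q (del gen_y) (orb W))"
proof -
  have "{f \<in> lifts q G z W. Q (f gen_x)} = {f. f gen_x \<in> {g \<in> sols G z 2 (del gen_x) (orb W). Q g} \<and>
      f gen_y \<in> sols G z q (del gen_y) (orb W)}" unfolding lifts_eq by blast
  then show ?thesis by (simp only: bij_betw_same_card[OF bij_xy_fun] card_cartesian_product)
qed

lemma card_sols_root:
  assumes "V \<in> S" "\<sigma> V = V" "\<And>p. p \<in> S - {V} \<Longrightarrow> \<sigma> p \<in> S - {V}"
    and b: "\<beta> \<in> carrier G" "\<beta> [^] l = z"
  shows "card {g \<in> sols G z l \<sigma> S. g V = \<beta>} = card (sols G z l \<sigma> (S - {V}))"
proof -
  have S: "(\<sigma> ^^ i) p \<in> S - {V}" if "p \<in> S - {V}" for i p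
    using that assms(3) by (induction i) auto
  have e: "hp G (g(V := \<beta>)) \<sigma> l p = hp G g \<sigma> l p" if "p \<in> S - {V}" for g p
    by (rule hp_cong) (use S[OF that] in auto)
  have "bij_betw (\<lambda>g. restrict g (S - {V})) {g \<in> sols G z l \<sigma> S. g V = \<beta>} (sols G z l \<sigma> (S - {V}))"
  proof (rule bij_betw_byWitness[where f' = "\<lambda>g. g(V := \<beta>)"])
    show "\<forall>g\<in>{g \<in> sols G z l \<sigma> S. g V = \<beta>}. (restrict g (S - {V}))(V := \<beta>) = g"
      by (auto simp: sols_def fun_eq_iff restrict_def PiE_def extensional_def)
    show "\<forall>g\<in>sols G z l \<sigma> (S - {V}). restrict (g(V := \<beta>)) (S - {V}) = g"
      by (auto simp: sols_def fun_eq_iff restrict_def PiE_def extensional_def)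
    show "(\<lambda>g. restrict g (S - {V})) ` {g \<in> sols G z l \<sigma> S. g V = \<beta>} \<subseteq> sols G z l \<sigma> (S - {V})"
    proof clarify
      fix g assume g: "g \<in> sols G z l \<sigma> S" "\<beta> = g V"
      have "hp G (restrict g (S - {V})) \<sigma> l p = hp G g \<sigma> l p" if "p \<in> S - {V}" for p
        by (rule hp_cong) (use S[OF that] in auto)
      then show "restrict g (S - {V}) \<in> sols G z l \<sigma> (S - {V})"
        using g by (auto simp: sols_def PiE_def Pi_def)
    qed
    show "(\<lambda>g. g(V := \<beta>)) ` sols G z l \<sigma> (S - {V}) \<subseteq> {g \<in> sols G z l \<sigma> S. g V = \<beta>}"
    proof clarify
      fix g assume g: "g \<in> sols G z l \<sigma> (S - {V})"
      have "hp G (g(V := \<beta>)) \<sigma> l V = z" using hp_const[of \<sigma> V "g(V := \<beta>)" l] assms(2) b by simp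
      moreover have "hp G (g(V := \<beta>)) \<sigma> l p = z" if "p \<in> S - {V}" for p
        unfolding e[OF that] using g that by (simp add: sols_def)
      moreover have "g(V := \<beta>) \<in> S \<rightarrow>\<^sub>E carrier G"
        using g b(1) assms(1) by (auto simp: sols_def PiE_def Pi_def extensional_def)
      ultimately show "g(V := \<beta>) \<in> sols G z l \<sigma> S \<and> (g(V := \<beta>)) V = \<beta>"
        unfolding sols_def by auto
    qed
  qed
  then show ?thesis by (rule bij_betw_same_card)
qed

text \<open>The number of \<open>l\<close>-th roots of \<open>z\<close>.\<close>

definition roots :: "nat \<Rightarrow> nat" where
  "roots l = card {\<alpha> \<in> carrier G. \<alpha> [^] l = z}"

text \<open>The labellings are counted in two ways: by their holonomy, and by the cycles of the two generators. The
last part is the same count with the value at \<open>x\<close> prescribed.\<close>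

lemma gauge_count:
  assumes q: "Factorial_Ring.prime q"
  shows "card (orb W) = fixc gen_x W + 2 * ((card (orb W) - fixc gen_x W) div 2)"
    "card (orb W) = fixc gen_y W + q * ((card (orb W) - fixc gen_y W) div q)"
    "card (coc q G z W) * card (carrier G) ^ (card (orb W) - 1)
      = roots 2 ^ fixc gen_x W * roots q ^ fixc gen_y W *
        card (carrier G) ^ ((card (orb W) - fixc gen_x W) div 2 + (q - 1) * ((card (orb W) - fixc gen_y W) div q))"
    "[gen_x] \<in> W \<Longrightarrow> \<beta> \<in> carrier G \<Longrightarrow> \<beta> [^] (2::nat) = z \<Longrightarrow>
      card {\<psi> \<in> coc q G z W. \<psi> [gen_x] = \<beta>} * card (carrier G) ^ (card (orb W) - 1)
      = roots 2 ^ (fixc gen_x W - 1) * roots q ^ fixc gen_y W *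
        card (carrier G) ^ ((card (orb W) - fixc gen_x W) div 2 + (q - 1) * ((card (orb W) - fixc gen_y W) div q))"
proof -
  let ?N = "card (orb W)" and ?a = "fixc gen_x W" and ?b = "fixc gen_y W"
  have 2: "Factorial_Ring.prime (2::nat)" by (rule two_is_prime_nat)
  have ordx: "(del gen_x ^^ 2) V = V" if "V \<in> orb W" for V using M.order[OF that, of gen_x] by simp
  have ordy: "(del gen_y ^^ q) V = V" if "V \<in> orb W" for V using M.order[OF that, of gen_y] by simp
  obtain i where i: "?N = ?a + 2 * i" "card (sols G z 2 (del gen_x) (orb W)) = roots 2 ^ ?a * card (carrier G) ^ i"
    using card_sols[of 2 "orb W" "del gen_x", OF 2 finW M.closed ordx] unfolding fixc_def roots_def by auto
  obtain j where j: "?N = ?b + q * j"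
    "card (sols G z q (del gen_y) (orb W)) = roots q ^ ?b * card (carrier G) ^ ((q - 1) * j)"
    using card_sols[of q "orb W" "del gen_y", OF q finW M.closed ordy] unfolding fixc_def roots_def by auto
  have i': "(?N - ?a) div 2 = i" using i(1) by simp
  have j': "(?N - ?b) div q = j" using j(1) q0 by simp
  show "?N = ?a + 2 * ((?N - ?a) div 2)" using i(1) i' by simp
  show "?N = ?b + q * ((?N - ?b) div q)" using j(1) j' by simp
  have "card (coc q G z W) * card (carrier G) ^ (?N - 1) = card (lifts q G z W)"
    using card_lifts_coc[of "\<lambda>_. True"] by simp
  also have "\<dots> = card (sols G z 2 (del gen_x) (orb W)) * card (sols G z q (del gen_y) (orb W))"
    using card_lifts_prod[of "\<lambda>_. True"] by simp
  finally show "card (coc q G z W) * card (carrier G) ^ (?N - 1)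
      = roots 2 ^ ?a * roots q ^ ?b * card (carrier G) ^ ((?N - ?a) div 2 + (q - 1) * ((?N - ?b) div q))"
    unfolding i(2) j(2) i' j' by (simp add: power_add)
  assume r: "[gen_x] \<in> W" and b: "\<beta> \<in> carrier G" "\<beta> [^] (2::nat) = z"
  have fx: "del gen_x W = W" using r unfolding mem_W by simp
  let ?S = "orb W - {W}"
  have clo: "del gen_x p \<in> ?S" if "p \<in> ?S" for p
    using that M.closed[of p gen_x] M.step_inj[of p W gen_x] orb_self[of W] fx by auto
  have fS: "finite ?S" using finW by simp
  have ord: "(del gen_x ^^ 2) V = V" if "V \<in> ?S" for V using that ordx by blast
  obtain i2 where i2: "card ?S = card {p \<in> ?S. del gen_x p = p} + 2 * i2"
    "card (sols G z 2 (del gen_x) ?S) = roots 2 ^ card {p \<in> ?S. del gen_x p = p} * card (carrier G) ^ i2"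
    using card_sols[of 2 ?S "del gen_x", OF 2 fS clo ord] unfolding roots_def by auto
  have "{p \<in> ?S. del gen_x p = p} = {p \<in> orb W. del gen_x p = p} - {W}" by blast
  then have c1: "card {p \<in> ?S. del gen_x p = p} = ?a - 1"
    unfolding fixc_def using fx orb_self[of W] finW by (simp add: card_Diff_singleton)
  have a1: "?a \<ge> 1"
    unfolding fixc_def using fx orb_self[of W] finW by (auto simp: Suc_le_eq card_gt_0_iff)
  have "card ?S = ?N - 1" using finW orb_self by (simp add: card_Diff_singleton)
  then have i3: "i2 = i" using i2(1) i(1) c1 a1 by simp
  have hx: "holW f [gen_x] = f gen_x W" if "f \<in> lifts q G z W" for f
    using r liftsD(1)[OF that] orb_self[of W] by (simp add: holW_def)
  have "card {\<psi> \<in> coc q G z W. \<psi> [gen_x] = \<beta>} * card (carrier G) ^ (?N - 1)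
      = card {f \<in> lifts q G z W. holW f [gen_x] = \<beta>}"
    using card_lifts_coc[of "\<lambda>\<psi>. \<psi> [gen_x] = \<beta>"] by simp
  also have "{f \<in> lifts q G z W. holW f [gen_x] = \<beta>} = {f \<in> lifts q G z W. f gen_x W = \<beta>}"
    using hx by auto
  also have "card \<dots> = card {g \<in> sols G z 2 (del gen_x) (orb W). g W = \<beta>} * card (sols G z q (del gen_y) (orb W))"
    by (rule card_lifts_prod)
  also have "card {g \<in> sols G z 2 (del gen_x) (orb W). g W = \<beta>} = card (sols G z 2 (del gen_x) ?S)"
    using card_sols_root[of W "orb W" "del gen_x" \<beta> 2] orb_self fx clo b by blast
  finally show "card {\<psi> \<in> coc q G z W. \<psi> [gen_x] = \<beta>} * card (carrier G) ^ (?N - 1)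
      = roots 2 ^ (?a - 1) * roots q ^ ?b * card (carrier G) ^ ((?N - ?a) div 2 + (q - 1) * ((?N - ?b) div q))"
    unfolding i2(2) j(2) i' j' c1 i3 by (simp add: power_add)
qed

end

text \<open>The free rank of \<open>W\<close>. By the Kurosh theorem \<open>W\<close> is a free product of \<open>fixc gen_x W\<close> groups of order 2,
of \<open>fixc gen_y W\<close> groups of order \<open>q\<close>, and of a free group of this rank. The theorem itself is not needed: the number
is defined as the exponent that is left in \<open>gauge_count\<close>.\<close>

definition rk :: "nat \<Rightarrow> xy list set \<Rightarrow> nat" where
  "rk q W = (card (orb W) - fixc gen_x W) div 2 + (q - 1) * ((card (orb W) - fixc gen_y W) div q)
     - (card (orb W) - 1)"

text \<open>The subtraction in \<open>rk\<close> is never truncated. For a label group of order coprime to \<open>2 q\<close> and trivial \<open>z\<close>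
all root numbers are 1, and since the trivial homomorphism exists, the powers in \<open>gauge_count\<close> can be compared.\<close>

lemma rank_nonneg:
  assumes q: "Factorial_Ring.prime q" and W: "wsub q W" "finite (orb W)"
  shows "card (orb W) - 1 \<le> (card (orb W) - fixc gen_x W) div 2 + (q - 1) * ((card (orb W) - fixc gen_y W) div q)"
    (is "?l \<le> ?e")
proof -
  \<comment> \<open>The order \<open>2 q + 1\<close> is coprime to \<open>2 q\<close>.\<close>
  let ?G = "integer_mod_group (Suc (2 * q))"
  interpret G: group ?G by (rule group_integer_mod_group)
  have car: "carrier ?G = {0..<int (Suc (2 * q))}" by (simp add: carrier_integer_mod_group)
  have cc: "card (carrier ?G) = Suc (2 * q)" unfolding car by simp
  interpret wcover ?G "\<one>\<^bsub>?G\<^esub>" q W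
    by unfold_locales (use W prime_gt_0_nat[OF q] in \<open>simp_all add: car\<close>)
  have ord: "a [^]\<^bsub>?G\<^esub> Suc (2 * q) = \<one>\<^bsub>?G\<^esub>" if "a \<in> carrier ?G" for a
  proof -
    have "order ?G = Suc (2 * q)" unfolding order_def car by simp
    then show ?thesis using G.pow_order_eq_1[OF that] by (simp only:)
  qed
  have triv: "a = \<one>\<^bsub>?G\<^esub>" if "a \<in> carrier ?G" "a [^]\<^bsub>?G\<^esub> (2 * q) = \<one>\<^bsub>?G\<^esub>" for a
    using ord[OF that(1)] unfolding G.nat_pow_Suc that(2) G.l_one[OF that(1)] .
  have "{a \<in> carrier ?G. a [^]\<^bsub>?G\<^esub> l = \<one>\<^bsub>?G\<^esub>} = {\<one>\<^bsub>?G\<^esub>}" if l: "l dvd 2 * q" for l :: nat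
  proof (intro equalityI subsetI)
    fix a assume a: "a \<in> {a \<in> carrier ?G. a [^]\<^bsub>?G\<^esub> l = \<one>\<^bsub>?G\<^esub>}"
    obtain k where k: "2 * q = l * k" using l by blast
    have a': "a \<in> carrier ?G" "a [^]\<^bsub>?G\<^esub> l = \<one>\<^bsub>?G\<^esub>" using a by blast+
    have "a [^]\<^bsub>?G\<^esub> (2 * q) = \<one>\<^bsub>?G\<^esub>"
      using G.nat_pow_pow[OF a'(1), of l k] unfolding a'(2) G.nat_pow_one k[symmetric] by (rule HOL.sym)
    then show "a \<in> {\<one>\<^bsub>?G\<^esub>}" using triv a by blast
  qed auto
  then have r: "roots l = 1" if "l dvd 2 * q" for l using that unfolding roots_def by simp
  have "(\<lambda>w\<in>W. \<one>\<^bsub>?G\<^esub>) \<in> coc q ?G \<one>\<^bsub>?G\<^esub> W"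
    unfolding coc_def
  proof (intro CollectI conjI ballI allI impI)
    show "(\<lambda>w\<in>W. \<one>\<^bsub>?G\<^esub>) \<in> W \<rightarrow>\<^sub>E carrier ?G" by (intro restrict_PiE_iff[THEN iffD2] ballI G.one_closed)
  next
    fix u v assume "u \<in> W" "v \<in> W"
    then show "(\<lambda>w\<in>W. \<one>\<^bsub>?G\<^esub>) (u @ v) = (\<lambda>w\<in>W. \<one>\<^bsub>?G\<^esub>) u \<otimes>\<^bsub>?G\<^esub> (\<lambda>w\<in>W. \<one>\<^bsub>?G\<^esub>) v"
      by (simp only: restrict_apply' W_app G.l_one G.one_closed)
  next
    fix s u v assume "u @ v \<in> W"
    then show "(\<lambda>w\<in>W. \<one>\<^bsub>?G\<^esub>) (u @ replicate (ordr q s) s @ v) = \<one>\<^bsub>?G\<^esub> \<otimes>\<^bsub>?G\<^esub> (\<lambda>w\<in>W. \<one>\<^bsub>?G\<^esub>) (u @ v)"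
      by (simp only: restrict_apply' W_rel G.l_one G.one_closed)
  qed
  then have "1 \<le> card (coc q ?G \<one>\<^bsub>?G\<^esub> W)" using finite_coc by (auto simp: Suc_le_eq card_gt_0_iff)
  then have "Suc (2 * q) ^ ?l \<le> card (coc q ?G \<one>\<^bsub>?G\<^esub> W) * Suc (2 * q) ^ ?l" by simp
  also have "\<dots> = Suc (2 * q) ^ ?e" using gauge_count(3)[OF q]
    unfolding r[OF dvd_triv_left] r[OF dvd_triv_right] cc power_one mult_1 .
  finally show ?thesis using q0 by (simp add: power_le_imp_le_exp)
qed

lemma nat_cancel_middle: "(a::nat) * c = b * (c * d) \<Longrightarrow> c > 0 \<Longrightarrow> a = b * d"
  by (simp add: mult.left_commute[of b])

context wcover begin

text \<open>This is the number of homomorphisms from a free product of the Kurosh type, twisted by \<open>z\<close>.\<close>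

lemma card_coc:
  assumes q: "Factorial_Ring.prime q"
  shows "card (coc q G z W) = roots 2 ^ fixc gen_x W * roots q ^ fixc gen_y W * card (carrier G) ^ rk q W"
    "[gen_x] \<in> W \<Longrightarrow> \<beta> \<in> carrier G \<Longrightarrow> \<beta> [^] (2::nat) = z \<Longrightarrow> card {\<psi> \<in> coc q G z W. \<psi> [gen_x] = \<beta>}
       = roots 2 ^ (fixc gen_x W - 1) * roots q ^ fixc gen_y W * card (carrier G) ^ rk q W"
proof -
  let ?e = "(card (orb W) - fixc gen_x W) div 2 + (q - 1) * ((card (orb W) - fixc gen_y W) div q)"
  have e: "?e = (card (orb W) - 1) + rk q W" unfolding rk_def using rank_nonneg[OF q wW finW] by simp
  have c0: "card (carrier G) ^ (card (orb W) - 1) > 0" using fin one_closed by (auto simp: card_gt_0_iff)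
  show "card (coc q G z W) = roots 2 ^ fixc gen_x W * roots q ^ fixc gen_y W * card (carrier G) ^ rk q W"
    using gauge_count(3)[OF q] c0 unfolding e power_add by (rule nat_cancel_middle)
  assume "[gen_x] \<in> W" "\<beta> \<in> carrier G" "\<beta> [^] (2::nat) = z"
  note eq = gauge_count(4)[OF q this]
  show "card {\<psi> \<in> coc q G z W. \<psi> [gen_x] = \<beta>}
       = roots 2 ^ (fixc gen_x W - 1) * roots q ^ fixc gen_y W * card (carrier G) ^ rk q W"
    using eq c0 unfolding e power_add by (rule nat_cancel_middle)
qed

text \<open>The Euler characteristic of \<open>W\<close>, cleared of denominators.\<close>

lemma rk_int:
  assumes q: "Factorial_Ring.prime q"
  shows "2 * int q * int (rk q W) = (int q - 2) * int (card (orb W)) + 2 * int q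
    - int q * int (fixc gen_x W) - 2 * (int q - 1) * int (fixc gen_y W)"
proof -
  let ?N = "card (orb W)"
  define i where "i = (?N - fixc gen_x W) div 2"
  define j where "j = (?N - fixc gen_y W) div q"
  have a: "?N = fixc gen_x W + 2 * i" and b: "?N = fixc gen_y W + q * j"
    unfolding i_def j_def by (rule gauge_count(1)[OF q], rule gauge_count(2)[OF q])
  have N: "?N \<ge> 1" using finW orb_self[of W] by (auto simp: Suc_le_eq card_gt_0_iff)
  have r: "rk q W + (?N - 1) = i + (q - 1) * j"
    unfolding rk_def i_def j_def using rank_nonneg[OF q wW finW] by simp
  have R: "int (rk q W) = int i + (int q - 1) * int j - int ?N + 1"
    using arg_cong[OF r, of int] N q0 by (simp add: of_nat_diff)
  have A: "int (fixc gen_x W) = int ?N - 2 * int i" using arg_cong[OF a, of int] by simp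
  have B: "int (fixc gen_y W) = int ?N - int q * int j" using arg_cong[OF b, of int] by simp
  show ?thesis unfolding R A B by (simp add: algebra_simps)
qed

end

section \<open>Parity under two-groups and the exchange of base points\<close>

lemma involution_card:
  fixes f :: "'p \<Rightarrow> 'p"
  assumes "finite S" "\<And>p. p \<in> S \<Longrightarrow> f p \<in> S" "\<And>p. p \<in> S \<Longrightarrow> f (f p) = p"
  shows "\<exists>k. card S = card {p \<in> S. f p = p} + 2 * k"
proof -
  interpret G: group "integer_mod_group 1" by (rule group_integer_mod_group)
  interpret central_group "integer_mod_group 1" "0 :: int"
    by unfold_locales (simp_all add: carrier_integer_mod_group)
  have "(f ^^ 2) p = p" if "p \<in> S" for p using assms(3)[OF that] by (simp add: numeral_2_eq_2)
  \<comment> \<open>With the trivial group as labels only the statement on cycles remains.\<close>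
  from card_sols[of 2 S f, OF two_is_prime_nat assms(1,2) this] show ?thesis by blast
qed

text \<open>A cyclic 2-group acting on a finite set has, modulo 2, as many fixed points as the set has elements.\<close>

lemma two_power_orbit_parity:
  fixes f :: "'p \<Rightarrow> 'p"
  assumes "finite S" "\<And>p. p \<in> S \<Longrightarrow> f p \<in> S" "\<And>p. p \<in> S \<Longrightarrow> (f ^^ (2 ^ k)) p = p"
  shows "odd (card S) \<longleftrightarrow> odd (card {p \<in> S. f p = p})"
  using assms
proof (induction k arbitrary: f)
  case 0
  then have "{p \<in> S. f p = p} = S" by auto
  then show ?case by simp
next
  case (Suc k)
  let ?g = "f ^^ 2" and ?S = "{p \<in> S. (f ^^ 2) p = p}"
  have g: "?g p = f (f p)" for p by (simp add: numeral_2_eq_2)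
  have gS: "?g p \<in> S" if "p \<in> S" for p unfolding g using Suc.prems(2) that by blast
  have gk: "(?g ^^ (2 ^ k)) p = p" if "p \<in> S" for p
    using Suc.prems(3)[OF that] by (simp add: funpow_mult)
  have 1: "odd (card S) \<longleftrightarrow> odd (card ?S)" by (rule Suc.IH[OF Suc.prems(1) gS gk])
  have "\<exists>j. card ?S = card {p \<in> ?S. f p = p} + 2 * j"
  proof (rule involution_card)
    show "finite ?S" using Suc.prems(1) by simp
    fix p assume p: "p \<in> ?S"
    then show "f (f p) = p" by (simp add: g)
    show "f p \<in> ?S" using p Suc.prems(2) by (simp add: g)
  qed
  moreover have "{p \<in> ?S. f p = p} = {p \<in> S. f p = p}" by (auto simp: g)
  ultimately show ?case using 1 by auto
qed

lemma (in group) coprime_root_trivial: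
  assumes "a \<in> carrier G" "finite (carrier G)" "coprime l (order G)" "a [^] (l::nat) = \<one>"
  shows "a = \<one>"
proof -
  have "ord a dvd l" using pow_eq_id assms(1,4) by blast
  moreover have "ord a dvd order G" using ord_dvd_group_order assms(1) by blast
  ultimately have "ord a = 1" using assms(3) by (metis coprime_common_divisor_nat)
  then show ?thesis using ord_eq_1 assms(1) by blast
qed

context wcover begin

text \<open>The covering of the coset graph with fibre the label group that belongs to the labelling \<open>f\<close>: a letter acts
on the cosets as before and multiplies the fibre coordinate by the label.\<close>

definition ext :: "(xy \<Rightarrow> xy list set \<Rightarrow> 'a) \<Rightarrow> xy \<Rightarrow> xy list set \<times> 'a \<Rightarrow> xy list set \<times> 'a" where
  "ext f s p = (del s (fst p), snd p \<otimes> f s (fst p))"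

lemma fold_ext:
  assumes c: "\<forall>s. \<forall>V\<in>orb W. f s V \<in> carrier G"
  shows "V \<in> orb W \<Longrightarrow> b \<in> carrier G \<Longrightarrow> fold (ext f) w (V, b) = (fold del w V, b \<otimes> hol G f V w)"
proof (induction w arbitrary: V b)
  case (Cons s w)
  have fs: "f s V \<in> carrier G" "del s V \<in> orb W" using c Cons.prems M.closed by blast+
  show ?case using Cons.IH[of "del s V" "b \<otimes> f s V"] fs Cons.prems hol_closed[OF c fs(2)]
    by (simp add: ext_def m_assoc)
qed simp

lemma ext_order:
  assumes f: "f \<in> lifts q G z W" and z1: "z = \<one>" and V: "V \<in> orb W" and b: "b \<in> carrier G"
  shows "(ext f s ^^ ordr q s) (V, b) = (V, b)"
proof -
  have "fold (ext f) (replicate (ordr q s) s) (V, b) = (V, b)"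
    unfolding fold_ext[OF liftsD(1)[OF f] V b] M.fold_rel[OF V] liftsD(2)[OF f V]
    using b by (simp only: z1 r_one)
  then show ?thesis by simp
qed

lemma lift_fixed_trivial:
  assumes f: "f \<in> lifts q G z W" and z1: "z = \<one>" and V: "V \<in> orb W" "del gen_y V = V"
    and cop: "coprime q (order G)"
  shows "f gen_y V = \<one>"
proof (rule coprime_root_trivial[OF _ fin cop])
  show c: "f gen_y V \<in> carrier G" using liftsD(1)[OF f] V(1) by blast
  have "hol G f V (replicate q gen_y) = f gen_y V [^] q"
    unfolding hol_replicate by (rule hp_const) (use V(2) c in auto)
  then show "f gen_y V [^] q = \<one>" using liftsD(2)[OF f V(1), of gen_y] z1 by simp
qed

end

text \<open>The conjugate of \<open>W\<close> by \<open>x\<close>, as the stabiliser of the coset to which \<open>x\<close> moves the trivial one.\<close>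

definition cj :: "xy list set \<Rightarrow> xy list set" where
  "cj W = stab del (del gen_x W)"

context pmodel begin

lemma xx: "p \<in> D \<Longrightarrow> \<delta> gen_x (\<delta> gen_x p) = p"
  using order[of p gen_x] by (simp add: numeral_2_eq_2)

lemma move_base: "pmodel q D \<delta> (\<delta> gen_x e)"
proof (intro pmodel.intro)
  fix p assume "p \<in> D"
  then obtain w where "fold \<delta> w e = p" using reach by blast
  then have "fold \<delta> (gen_x # w) (\<delta> gen_x e) = p" by (simp add: xx eD)
  then show "\<exists>w. fold \<delta> w (\<delta> gen_x e) = p" by blast
qed (rule qpos finD closed eD order | assumption)+

lemma stab_move_base: "stab \<delta> (\<delta> gen_x e) = cj (stab \<delta> e)"
  unfolding cj_def by (rule pmodel_iso_stab[OF move_base res_inj])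
    (simp_all add: res_step res_e)

end

lemma cj_props:
  assumes W: "W \<in> subs q N" and q: "q > 0"
  shows "cj W \<in> subs q N" "cj (cj W) = W" "fixc s (cj W) = fixc s W"
    "w \<in> cj W \<longleftrightarrow> gen_x # w @ [gen_x] \<in> W" "[gen_x] \<in> W \<Longrightarrow> cj W = W"
proof -
  interpret pmodel q "orb W" del W using W q by (rule subs_pmodel)
  have st: "stab del W = W" by (rule subs_stab[OF W])
  interpret b: pmodel q "orb W" del "del gen_x W" by (rule move_base)
  show "cj W \<in> subs q N" using b.stab_in_subs subs_card[OF W] by (simp add: cj_def)
  show "fixc s (cj W) = fixc s W" unfolding cj_def b.fixc_stab unfolding fixc_def ..
  have "cj (cj W) = stab del (del gen_x (del gen_x W))"
    unfolding b.stab_move_base by (simp only: cj_def)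
  also have "\<dots> = W" unfolding xx[OF eD] by (rule st)
  finally show "cj (cj W) = W" .
  have mem: "w \<in> W \<longleftrightarrow> fold del w W = W" for w using W by (intro mem_wsub_iff[of q]) (simp add: subs_def)
  show "w \<in> cj W \<longleftrightarrow> gen_x # w @ [gen_x] \<in> W"
  proof -
    have "gen_x # w @ [gen_x] \<in> W \<longleftrightarrow> del gen_x (fold del w (del gen_x W)) = W" unfolding mem by simp
    also have "\<dots> \<longleftrightarrow> fold del w (del gen_x W) = del gen_x W"
      using xx[OF eD] xx[OF fold_closed[OF closed[OF eD, of gen_x], of w]] by metis
    finally show ?thesis by (simp add: cj_def stab_def)
  qed
  assume "[gen_x] \<in> W"
  then have "del gen_x W = W" unfolding mem by simp
  then show "cj W = W" unfolding cj_def using st by simp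
qed

abbreviation Z2 :: "int monoid" where "Z2 \<equiv> integer_mod_group 2"

lemma Z2_simps: "carrier Z2 = {0, 1}" "\<one>\<^bsub>Z2\<^esub> = 0" "a \<otimes>\<^bsub>Z2\<^esub> b = (a + b) mod 2"
  by (auto simp: carrier_integer_mod_group)

lemma wcover_Z2: "L \<in> subs q M \<Longrightarrow> q > 0 \<Longrightarrow> wcover Z2 0 q L"
proof -
  assume L: "L \<in> subs q M" and q: "q > 0"
  interpret G: group Z2 by (rule group_integer_mod_group)
  show ?thesis
    by unfold_locales (use L q in \<open>auto simp: Z2_simps subs_def\<close>)
qed

text \<open>The subgroups \<open>L\<close> of index \<open>M\<close> that contain \<open>x\<close>, with a homomorphism to \<open>\<int>/2\<close> that is nontrivial at \<open>x\<close>.\<close>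

definition Z2_pairs :: "nat \<Rightarrow> nat \<Rightarrow> (xy list set \<times> (xy list \<Rightarrow> int)) set" where
  "Z2_pairs q M = {(L, \<psi>). L \<in> subs q M \<and> [gen_x] \<in> L \<and> \<psi> \<in> coc q Z2 0 L \<and> \<psi> [gen_x] = 1}"

text \<open>The kernel of the homomorphism in such a pair.\<close>

definition ker2 :: "xy list set \<times> (xy list \<Rightarrow> int) \<Rightarrow> xy list set" where
  "ker2 = (\<lambda>(L, \<psi>). {w \<in> L. \<psi> w = 0})"

text \<open>The coset graph of the kernel is the double cover \<open>ext f\<close> of that of \<open>L\<close>, where \<open>f\<close> is a labelling with
holonomy \<open>\<psi>\<close>. The cosets fixed by \<open>y\<close> lift to two fixed ones because \<open>q\<close> is odd; the trivial coset is fixed by \<open>x\<close>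
but its lifts are not.\<close>

lemma ker2_props:
  assumes p: "(L, \<psi>) \<in> Z2_pairs q M" and q: "Factorial_Ring.prime q" "odd q"
  shows "ker2 (L, \<psi>) \<in> subs q (2 * M)" "[gen_x] \<notin> ker2 (L, \<psi>)" "cj (ker2 (L, \<psi>)) = ker2 (L, \<psi>)"
    "fixc gen_y (ker2 (L, \<psi>)) = 2 * fixc gen_y L" "fixc gen_x (ker2 (L, \<psi>)) + 2 \<le> 2 * fixc gen_x L"
    "L = {w. w \<in> ker2 (L, \<psi>) \<or> gen_x # w \<in> ker2 (L, \<psi>)}"
proof -
  have L: "L \<in> subs q M" "[gen_x] \<in> L" and \<psi>: "\<psi> \<in> coc q Z2 0 L" "\<psi> [gen_x] = 1"
    using p by (simp_all add: Z2_pairs_def)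
  have q0: "q > 0" using q(2) by (cases q) auto
  interpret wcover Z2 0 q L by (rule wcover_Z2[OF L(1) q0])
  have "order Z2 = 2" by (simp add: order_def Z2_simps)
  then have cop: "coprime q (order Z2)" using q(2) by simp
  obtain f where f: "f \<in> lifts q Z2 0 L" "holW f = \<psi>"
    using gauge_lift[OF \<psi>(1), of "restrict (\<lambda>_. 0) (orb L - {L})"] by (auto simp: Z2_simps)
  note fc = liftsD(1)[OF f(1)]
  have hol: "hol Z2 f L w = \<psi> w" if "w \<in> L" for w using f(2) that by (auto simp: holW_def)
  let ?D = "orb L \<times> carrier Z2"
  have eD: "(L, 0) \<in> ?D" using orb_self by (simp add: Z2_simps)
  have fold: "fold (ext f) w (V, b) = (fold del w V, b \<otimes>\<^bsub>Z2\<^esub> hol Z2 f V w)" if "(V, b) \<in> ?D" for w V b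
    using fold_ext[OF fc] that by blast
  have "f gen_x L \<in> {0, 1}" using fc[THEN spec, THEN bspec, OF orb_self] by (simp only: Z2_simps)
  then have fL: "f gen_x L = 1" using hol[OF L(2)] \<psi>(2) by (auto simp: Z2_simps)
  interpret K: pmodel q ?D "ext f" "(L, 0)"
  proof (intro pmodel.intro)
    show "finite ?D" using finW fin by blast
    fix p s assume "p \<in> ?D"
    then obtain V b where p: "p = (V, b)" "V \<in> orb L" "b \<in> carrier Z2" by blast
    have "f s V \<in> carrier Z2" using fc p(2) by blast
    from M.closed[OF p(2), of s] m_closed[OF p(3) this]
    show "ext f s p \<in> ?D" unfolding p(1) ext_def fst_conv snd_conv by (rule SigmaI)
    show "(ext f s ^^ ordr q s) p = p" unfolding p(1) by (rule ext_order[OF f(1) _ p(2,3)]) simp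
    let ?h = "hol Z2 f L (tr V)"
    have hc: "?h \<in> carrier Z2" by (rule hol_closed[OF fc orb_self])
    have m: "fold (ext f) (tr V) (L, 0) = (V, ?h)"
      using fold[OF eD] fold_tr[OF p(2)] hc by (auto simp: Z2_simps)
    have "ext f gen_x (L, 0) = (L, 1)" using fL L(2) by (simp add: ext_def mem_W Z2_simps)
    moreover have "fold (ext f) (tr V) (L, 1) = (V, 1 \<otimes>\<^bsub>Z2\<^esub> ?h)"
      using fold[of L 1 "tr V"] fold_tr[OF p(2)] orb_self[of L] by (auto simp: Z2_simps)
    ultimately have m1: "fold (ext f) (gen_x # tr V) (L, 0) = (V, 1 \<otimes>\<^bsub>Z2\<^esub> ?h)" by simp
    show "\<exists>w. fold (ext f) w (L, 0) = p"
    proof (cases "?h = b")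
      case True
      then show ?thesis using m p(1) by blast
    next
      case False
      then have "1 \<otimes>\<^bsub>Z2\<^esub> ?h = b" using hc p(3) by (auto simp: Z2_simps)
      then show ?thesis using m1 p(1) by blast
    qed
  qed (use q0 eD in auto)
  have st: "stab (ext f) (L, 0) = ker2 (L, \<psi>)"
  proof (intro equalityI subsetI)
    fix w assume "w \<in> stab (ext f) (L, 0)"
    then have w: "fold del w L = L" "0 \<otimes>\<^bsub>Z2\<^esub> hol Z2 f L w = 0" using fold[OF eD] by (auto simp: stab_def)
    then have "w \<in> L" by (simp only: mem_W)
    then show "w \<in> ker2 (L, \<psi>)" using w(2) hol[of w] cocD(1)[OF \<psi>(1), of w] by (auto simp: ker2_def Z2_simps)
  next
    fix w assume "w \<in> ker2 (L, \<psi>)"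
    then have w: "w \<in> L" "\<psi> w = 0" by (auto simp: ker2_def)
    then have "fold del w L = L" by (simp only: mem_W)
    then show "w \<in> stab (ext f) (L, 0)" using fold[OF eD] w hol[OF w(1)] by (simp add: stab_def)
  qed
  have D: "card ?D = 2 * M" using subs_card[OF L(1)] by (simp add: card_cartesian_product Z2_simps)
  show sub: "ker2 (L, \<psi>) \<in> subs q (2 * M)" using K.stab_in_subs unfolding st D .
  show "[gen_x] \<notin> ker2 (L, \<psi>)" using \<psi>(2) by (simp add: ker2_def)
  have "{p \<in> ?D. ext f gen_y p = p} = {V \<in> orb L. del gen_y V = V} \<times> carrier Z2"
    using lift_fixed_trivial[OF f(1) _ _ _ cop] by (auto simp: ext_def Z2_simps)
  note fy = this
  have c2: "card (carrier Z2) = 2" by (simp add: Z2_simps)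
  show "fixc gen_y (ker2 (L, \<psi>)) = 2 * fixc gen_y L"
    unfolding st[symmetric] K.fixc_stab fy card_cartesian_product c2 fixc_def[of gen_y L]
    by (rule mult.commute)
  have "{p \<in> ?D. ext f gen_x p = p} \<subseteq> ({V \<in> orb L. del gen_x V = V} - {L}) \<times> carrier Z2"
  proof
    fix p assume p: "p \<in> {p \<in> ?D. ext f gen_x p = p}"
    obtain V b where Vb: "p = (V, b)" by (cases p)
    have *: "V \<in> orb L" "b \<in> carrier Z2" "del gen_x V = V" "b \<otimes>\<^bsub>Z2\<^esub> f gen_x V = b"
      using p unfolding Vb by (simp_all add: ext_def)
    have "V \<noteq> L"
    proof
      assume "V = L"
      then have "(b + 1) mod 2 = b" using *(4) fL by (simp only: Z2_simps)
      then show False using *(2) by (auto simp: Z2_simps)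
    qed
    then show "p \<in> ({V \<in> orb L. del gen_x V = V} - {L}) \<times> carrier Z2"
      using * unfolding Vb by blast
  qed
  then have "card {p \<in> ?D. ext f gen_x p = p} \<le> card (({V \<in> orb L. del gen_x V = V} - {L}) \<times> carrier Z2)"
    by (rule card_mono[rotated]) (use finW in \<open>simp add: Z2_simps\<close>)
  moreover have Lf: "L \<in> {V \<in> orb L. del gen_x V = V}" using L(2) orb_self by (simp add: mem_W)
  then have "card ({V \<in> orb L. del gen_x V = V} - {L}) + 1 = fixc gen_x L"
    using finW card.remove[OF _ Lf] by (simp add: fixc_def)
  ultimately show "fixc gen_x (ker2 (L, \<psi>)) + 2 \<le> 2 * fixc gen_x L"
    unfolding st[symmetric] K.fixc_stab card_cartesian_product c2 by linarith
  have xw: "gen_x # w \<in> L \<longleftrightarrow> w \<in> L" for w using W_app[OF L(2), of w] by simp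
  have wx: "w @ [gen_x] \<in> L \<longleftrightarrow> w \<in> L" for w using W_app[of w "[gen_x]"] L(2) W_rel[of w gen_x "[]"]
    W_app[of "w @ [gen_x]" "[gen_x]"] by (auto simp: numeral_2_eq_2)
  have psix: "\<psi> (gen_x # w) = (1 + \<psi> w) mod 2" if "w \<in> L" for w
    using cocD(2)[OF \<psi>(1) L(2) that] \<psi>(2) by (simp add: Z2_simps)
  have psiw: "\<psi> (w @ [gen_x]) = (\<psi> w + 1) mod 2" if "w \<in> L" for w
    using cocD(2)[OF \<psi>(1) that L(2)] \<psi>(2) by (simp add: Z2_simps)
  have val: "\<psi> w = 0 \<or> \<psi> w = 1" if "w \<in> L" for w using cocD(1)[OF \<psi>(1) that] by (simp add: Z2_simps)
  show "cj (ker2 (L, \<psi>)) = ker2 (L, \<psi>)"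
  proof (rule Set.set_eqI)
    fix w
    have "\<psi> (gen_x # w @ [gen_x]) = \<psi> w" if "w \<in> L"
      using psix[of "w @ [gen_x]"] psiw[OF that] wx[of w] that val[OF that] by auto
    then show "w \<in> cj (ker2 (L, \<psi>)) \<longleftrightarrow> w \<in> ker2 (L, \<psi>)"
      unfolding cj_props(4)[OF sub q0] using xw wx by (auto simp: ker2_def)
  qed
  show "L = {w. w \<in> ker2 (L, \<psi>) \<or> gen_x # w \<in> ker2 (L, \<psi>)}"
  proof (rule Set.set_eqI)
    fix w show "w \<in> L \<longleftrightarrow> w \<in> {w. w \<in> ker2 (L, \<psi>) \<or> gen_x # w \<in> ker2 (L, \<psi>)}"
      using xw[of w] psix[of w] val[of w] by (auto simp: ker2_def)
  qed
qed

lemma ker2_inj: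
  assumes q: "Factorial_Ring.prime q" "odd q"
  shows "inj_on ker2 (Z2_pairs q M)"
proof (rule inj_onI)
  fix a a' assume a: "a \<in> Z2_pairs q M" "a' \<in> Z2_pairs q M" and e: "ker2 a = ker2 a'"
  obtain L \<psi> L' \<psi>' where aa: "a = (L, \<psi>)" "a' = (L', \<psi>')" by (cases a, cases a')
  have LL: "L = L'" using ker2_props(6)[OF a(1)[unfolded aa(1)] q] ker2_props(6)[OF a(2)[unfolded aa(2)] q] e
    unfolding aa by simp
  have c: "\<psi> \<in> coc q Z2 0 L" "\<psi>' \<in> coc q Z2 0 L" using a unfolding aa LL by (auto simp: Z2_pairs_def)
  have "\<psi> = \<psi>'"
  proof (rule extensionalityI[of _ L])
    fix w assume w: "w \<in> L"
    have v: "\<psi> w \<in> {0, 1}" "\<psi>' w \<in> {0, 1}" using c w by (auto simp: coc_def Z2_simps)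
    have "w \<in> ker2 a \<longleftrightarrow> w \<in> ker2 a'" using e by simp
    then have "\<psi> w = 0 \<longleftrightarrow> \<psi>' w = 0" using w unfolding aa LL by (simp add: ker2_def)
    then show "\<psi> w = \<psi>' w" using v by auto
  qed (use c in \<open>auto simp: coc_def PiE_def\<close>)
  then show "a = a'" unfolding aa LL by simp
qed

text \<open>A subgroup that is normalised by \<open>x\<close> but does not contain \<open>x\<close> has index 2 in \<open>L = W \<union> x W\<close>.\<close>

lemma ker2_surj:
  assumes W: "W \<in> subs q N" and x: "[gen_x] \<notin> W" and c: "cj W = W" and q: "Factorial_Ring.prime q" "odd q"
  shows "\<exists>M. N = 2 * M \<and> W \<in> ker2 ` Z2_pairs q M"
proof -
  have q0: "q > 0" using q(2) by (cases q) auto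
  have wW: "wsub q W" "finite (orb W)" using W by (auto simp: subs_def)
  note app = wsubD(2)[OF wW(1)] and rel = wsubD(3)[OF wW(1)]
  have conj: "gen_x # u @ [gen_x] \<in> W \<longleftrightarrow> u \<in> W" for u using cj_props(4)[OF W q0, of u] c by simp
  have xx: "u @ gen_x # gen_x # v \<in> W \<longleftrightarrow> u @ v \<in> W" for u v
    using rel[of u gen_x v] by (simp add: numeral_2_eq_2)
  have xx0: "gen_x # gen_x # v \<in> W \<longleftrightarrow> v \<in> W" for v using xx[of "[]" v] by simp
  have xu: "gen_x # u @ v \<in> W \<longleftrightarrow> gen_x # v \<in> W" if "u \<in> W" for u v
  proof -
    have "gen_x # u @ v \<in> W \<longleftrightarrow> (gen_x # u @ [gen_x]) @ (gen_x # v) \<in> W"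
      using xx[of "gen_x # u" v] by simp
    also have "\<dots> \<longleftrightarrow> gen_x # v \<in> W" using app conj that by blast
    finally show ?thesis .
  qed
  define L where "L = {w. w \<in> W \<or> gen_x # w \<in> W}"
  define \<psi> :: "xy list \<Rightarrow> int" where "\<psi> = (\<lambda>w\<in>L. if w \<in> W then 0 else 1)"
  have sL: "u @ v \<in> W \<longleftrightarrow> gen_x # v \<in> W" if "gen_x # u \<in> W" for u v
    using xx0[of "u @ v"] xu[OF that, of v] by simp
  have sL': "gen_x # u @ v \<in> W \<longleftrightarrow> v \<in> W" if "gen_x # u \<in> W" for u v
    using app[OF that, of v] by simp
  have wL: "wsub q L"
    unfolding wsub_def
  proof (intro conjI ballI allI)
    show "[] \<in> L" using wsubD(1)[OF wW(1)] by (simp add: L_def)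
    fix u v assume u: "u \<in> L"
    show "u @ v \<in> L \<longleftrightarrow> v \<in> L"
    proof (cases "u \<in> W")
      case True
      then show ?thesis using app[OF True] xu[OF True] by (simp add: L_def)
    next
      case False
      then have "gen_x # u \<in> W" using u by (simp add: L_def)
      from sL[OF this] sL'[OF this] show ?thesis unfolding L_def by auto
    qed
  next
    fix s u v
    show "u @ replicate (ordr q s) s @ v \<in> L \<longleftrightarrow> u @ v \<in> L"
      using rel[of u s v] rel[of "gen_x # u" s v] by (simp add: L_def)
  qed
  have "orb L \<subseteq> (\<lambda>(A, B). A \<union> B) ` (orb W \<times> orb W)"
  proof
    fix V assume "V \<in> orb L"
    then obtain w where "V = fold del w L" by (auto simp: orb_def)
    then have "V = fold del w W \<union> fold del (gen_x # w) W" unfolding fold_del L_def by auto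
    then show "V \<in> (\<lambda>(A, B). A \<union> B) ` (orb W \<times> orb W)" unfolding orb_def by blast
  qed
  then have fL: "finite (orb L)" by (rule finite_subset) (intro finite_imageI finite_cartesian_product wW)
  have xL: "[gen_x] \<in> L" using xx0[of "[]"] wsubD(1)[OF wW(1)] by (simp add: L_def)
  have Lapp: "u \<in> L \<Longrightarrow> v \<in> L \<Longrightarrow> u @ v \<in> L" for u v using wsubD(2)[OF wL] by blast
  have "\<psi> \<in> coc q Z2 0 L"
    unfolding coc_def
  proof (intro CollectI conjI ballI allI impI)
    show "\<psi> \<in> L \<rightarrow>\<^sub>E carrier Z2" unfolding \<psi>_def by (auto simp: Z2_simps)
  next
    fix u v assume u: "u \<in> L" and v: "v \<in> L"
    show "\<psi> (u @ v) = \<psi> u \<otimes>\<^bsub>Z2\<^esub> \<psi> v"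
    proof (cases "u \<in> W")
      case True
      then show ?thesis using app[OF True, of v] u v Lapp[OF u v] by (simp add: \<psi>_def Z2_simps)
    next
      case False
      then have xu: "gen_x # u \<in> W" using u by (simp add: L_def)
      have "v \<in> W \<Longrightarrow> gen_x # v \<notin> W"
      proof
        assume "v \<in> W" "gen_x # v \<in> W"
        then have "gen_x # v @ [gen_x] \<in> W" using conj by blast
        then have "[gen_x] \<in> W" using app[OF \<open>gen_x # v \<in> W\<close>, of "[gen_x]"] by simp
        then show False using x by blast
      qed
      then have "u @ v \<in> W \<longleftrightarrow> v \<notin> W" using sL[OF xu, of v] v unfolding L_def by blast
      then show ?thesis using False u v Lapp[OF u v] by (simp add: \<psi>_def Z2_simps)
    qed
  next
    fix s u v assume uv: "u @ v \<in> L"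
    then have "u @ replicate (ordr q s) s @ v \<in> L" using wsubD(3)[OF wL] by blast
    then show "\<psi> (u @ replicate (ordr q s) s @ v) = 0 \<otimes>\<^bsub>Z2\<^esub> \<psi> (u @ v)"
      using rel[of u s v] uv by (simp add: \<psi>_def Z2_simps)
  qed
  then have p: "(L, \<psi>) \<in> Z2_pairs q (card (orb L))"
    using wL fL xL x by (simp add: Z2_pairs_def subs_def \<psi>_def)
  have k: "W = ker2 (L, \<psi>)" by (auto simp: ker2_def \<psi>_def L_def)
  have "W \<in> subs q (2 * card (orb L))" unfolding k using ker2_props(1)[OF p q] .
  then have "N = 2 * card (orb L)" using W by (simp add: subs_def)
  then show ?thesis using p k by blast
qed

text \<open>The parity of a number of subgroups, computed from the fixed points of conjugation by \<open>x\<close>.\<close>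

lemma conj_parity:
  assumes q: "Factorial_Ring.prime q" "odd q"
  shows "odd (card {W \<in> subs q N. P (fixc gen_x W) (fixc gen_y W)}) \<longleftrightarrow>
    odd (card {W \<in> subs q N. [gen_x] \<in> W \<and> P (fixc gen_x W) (fixc gen_y W)} +
      (if even N then card {a \<in> Z2_pairs q (N div 2). P (fixc gen_x (ker2 a)) (fixc gen_y (ker2 a))} else 0))"
proof -
  have q0: "q > 0" using q(2) by (cases q) auto
  let ?P = "\<lambda>W. P (fixc gen_x W) (fixc gen_y W)"
  let ?S = "{W \<in> subs q N. ?P W}"
  let ?A = "{W \<in> subs q N. [gen_x] \<in> W \<and> ?P W}"
  let ?B = "{W \<in> subs q N. [gen_x] \<notin> W \<and> cj W = W \<and> ?P W}"
  have fS: "finite ?S" using finite_subs[OF q0] by simp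
  have "odd (card ?S) \<longleftrightarrow> odd (card {W \<in> ?S. cj W = W})"
    by (rule two_power_orbit_parity[where k = 1, OF fS]) (use cj_props[OF _ q0] in \<open>auto simp: numeral_2_eq_2\<close>)
  also have "{W \<in> ?S. cj W = W} = ?A \<union> ?B" using cj_props(5)[OF _ q0] by blast
  also have "card (?A \<union> ?B) = card ?A + card ?B"
    by (rule card_Un_disjoint) (use finite_subs[OF q0] in auto)
  also have "card ?B = (if even N then card {a \<in> Z2_pairs q (N div 2). ?P (ker2 a)} else 0)"
  proof (cases "even N")
    case True
    let ?Z = "{a \<in> Z2_pairs q (N div 2). ?P (ker2 a)}"
    have N: "2 * (N div 2) = N" using True by simp
    have BZ: "?B = ker2 ` ?Z"
    proof (intro equalityI subsetI)
      fix W assume W: "W \<in> ?B"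
      then obtain M where M: "N = 2 * M" "W \<in> ker2 ` Z2_pairs q M" using ker2_surj[of W q N] q by blast
      then have "N div 2 = M" by simp
      then show "W \<in> ker2 ` ?Z" using M(2) W by auto
    next
      fix W assume "W \<in> ker2 ` ?Z"
      then obtain L \<psi> where a: "(L, \<psi>) \<in> Z2_pairs q (N div 2)" "W = ker2 (L, \<psi>)" "?P W" by auto
      then show "W \<in> ?B" using ker2_props(1-3)[OF a(1) q] N by simp
    qed
    have I: "inj_on ker2 ?Z" using ker2_inj[OF q] by (rule inj_on_subset) blast
    have "card ?B = card ?Z" unfolding BZ by (rule card_image[OF I])
    then show ?thesis by (simp only: True if_True)
  next
    case False
    have "?B = {}"
    proof (rule ccontr)
      assume "?B \<noteq> {}"
      then obtain W where "W \<in> ?B" by blast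
      then obtain M where "N = 2 * M" using ker2_surj[of W q N] q by blast
      then show False using False by simp
    qed
    then have "card ?B = 0" by (simp only: card.empty)
    then show ?thesis by (simp only: False if_False)
  qed
  finally show ?thesis .
qed

section \<open>Twisting the orbit of the base point\<close>

text \<open>The orbit of the base point under \<open>y\<close>.\<close>

definition yorb :: "(xy \<Rightarrow> 'a \<Rightarrow> 'a) \<Rightarrow> 'a \<Rightarrow> 'a set" where
  "yorb \<delta> e = range (\<lambda>i. (\<delta> gen_y ^^ i) e)"

text \<open>The action in which \<open>y\<close> is replaced by its \<open>k\<close>-th power on the \<open>y\<close>-orbit of the base point and is unchanged
elsewhere.\<close>

definition twd :: "nat \<Rightarrow> (xy \<Rightarrow> 'a \<Rightarrow> 'a) \<Rightarrow> 'a \<Rightarrow> xy \<Rightarrow> 'a \<Rightarrow> 'a" where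
  "twd k \<delta> e s p = (if s = gen_y \<and> p \<in> yorb \<delta> e then (\<delta> gen_y ^^ k) p else \<delta> s p)"

lemma twd_on: "p \<in> yorb \<delta> e \<Longrightarrow> twd k \<delta> e gen_y p = (\<delta> gen_y ^^ k) p"
  by (simp add: twd_def)

lemma twd_off: "\<not> (s = gen_y \<and> p \<in> yorb \<delta> e) \<Longrightarrow> twd k \<delta> e s p = \<delta> s p"
  by (auto simp: twd_def)

text \<open>The subgroup obtained from \<open>W\<close> by this twist. For \<open>k\<close> prime to \<open>q\<close> the twist preserves the orbits of \<open>y\<close>,
so the twisted action is again transitive, and the twists form an action of the unit group of \<open>\<int>/q\<close>
(\<open>stab_twd_twd\<close>, \<open>tw_mod\<close>, \<open>tw_1\<close>).\<close>

definition tw :: "nat \<Rightarrow> xy list set \<Rightarrow> xy list set" where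
  "tw k W = stab (twd k del W) W"

context pmodel begin

lemma yy: "p \<in> D \<Longrightarrow> (\<delta> gen_y ^^ q) p = p"
  using order[of p gen_y] by simp

lemma y_mod: "p \<in> D \<Longrightarrow> (\<delta> gen_y ^^ (i mod q)) p = (\<delta> gen_y ^^ i) p"
  by (rule funpow_mod_eq[OF yy])

lemma yorb_pow: "p \<in> yorb \<delta> e \<Longrightarrow> (\<delta> gen_y ^^ k) p \<in> yorb \<delta> e"
  unfolding yorb_def by (auto simp: funpow_add_apply)

lemma yorb_step: "p \<in> D \<Longrightarrow> \<delta> gen_y p \<in> yorb \<delta> e \<longleftrightarrow> p \<in> yorb \<delta> e"
proof
  assume p: "p \<in> D" "\<delta> gen_y p \<in> yorb \<delta> e"
  have "(\<delta> gen_y ^^ (q - 1)) (\<delta> gen_y p) = p" using funpow_pred[OF p(1), of gen_y] by simp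
  then show "p \<in> yorb \<delta> e" using yorb_pow[OF p(2), of "q - 1"] by simp
next
  assume "p \<in> yorb \<delta> e"
  then show "\<delta> gen_y p \<in> yorb \<delta> e" using yorb_pow[of p 1] by simp
qed

lemma twd_pow_orb: "p \<in> yorb \<delta> e \<Longrightarrow> (twd k \<delta> e gen_y ^^ i) p = (\<delta> gen_y ^^ (k * i)) p"
proof (induction i)
  case (Suc i)
  have "(\<delta> gen_y ^^ (k * i)) p \<in> yorb \<delta> e" by (rule yorb_pow[OF Suc.prems])
  then have "(twd k \<delta> e gen_y ^^ Suc i) p = (\<delta> gen_y ^^ k) ((\<delta> gen_y ^^ (k * i)) p)"
    using Suc.IH[OF Suc.prems] by (simp add: twd_on)
  then show ?case by (simp only: funpow_add_apply mult_Suc_right)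
qed simp

lemma twd_pow_off: "p \<in> D \<Longrightarrow> p \<notin> yorb \<delta> e \<Longrightarrow>
    (twd k \<delta> e gen_y ^^ i) p = (\<delta> gen_y ^^ i) p \<and> (\<delta> gen_y ^^ i) p \<notin> yorb \<delta> e"
proof (induction i)
  case (Suc i)
  have "(\<delta> gen_y ^^ i) p \<in> D" by (rule funpow_closed[OF Suc.prems(1)])
  then show ?case using Suc.IH[OF Suc.prems] yorb_step by (simp add: twd_off)
qed simp

lemma twd_x: "twd k \<delta> e gen_x = \<delta> gen_x"
  by (simp add: twd_def fun_eq_iff)

lemma coprime_inverse:
  assumes "coprime k q" obtains k' where "\<And>i. (k * k' * i) mod q = i mod q"
proof (cases "q = 1")
  case False
  obtain a b where ab: "k * a = q * b + 1"
    using coprime_bezout_strong[OF assms False] by blast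
  have "(k * a * i) mod q = i mod q" for i
  proof -
    have "(q * b + 1) * i = i + q * (b * i)" by (simp add: algebra_simps)
    then show ?thesis unfolding ab by (simp only: mod_mult_self2)
  qed
  then show ?thesis by (rule that)
qed (rule that[of 0], simp)

lemma twd_pmodel:
  assumes k: "coprime k q"
  shows "pmodel q D (twd k \<delta> e) e"
proof (intro pmodel.intro)
  fix p s assume p: "p \<in> D"
  show "twd k \<delta> e s p \<in> D" using closed[OF p] funpow_closed[OF p] by (simp add: twd_def)
  show "(twd k \<delta> e s ^^ ordr q s) p = p"
  proof (cases s)
    case gen_x
    then show ?thesis using order[OF p, of gen_x] by (simp add: twd_x)
  next
    case gen_y
    show ?thesis
    proof (cases "p \<in> yorb \<delta> e")
      case True
      have "(\<delta> gen_y ^^ (k * q)) p = p" using y_mod[OF p, of "k * q"] by simp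
      then show ?thesis using gen_y twd_pow_orb[OF True, where k = k and i = q] by simp
    next
      case False
      then show ?thesis using gen_y twd_pow_off[OF p False, where k = k and i = q] yy[OF p] by simp
    qed
  qed
next
  obtain k' where k': "\<And>i. (k * k' * i) mod q = i mod q" using coprime_inverse[OF k] by blast
  have "\<exists>v. fold (twd k \<delta> e) v e = fold \<delta> w e" for w
  proof (induction w rule: rev_induct)
    case Nil
    show ?case by (rule exI[of _ "[]"]) simp
  next
    case (snoc s w)
    then obtain v where v: "fold (twd k \<delta> e) v e = fold \<delta> w e" by blast
    have p: "fold \<delta> w e \<in> D" by (rule fold_closed[OF eD])
    show ?case
    proof (cases "s = gen_y \<and> fold \<delta> w e \<in> yorb \<delta> e")
      case True
      have "(twd k \<delta> e gen_y ^^ k') (fold \<delta> w e) = (\<delta> gen_y ^^ (k * k')) (fold \<delta> w e)"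
        using True by (intro twd_pow_orb) blast
      also have "\<dots> = \<delta> gen_y (fold \<delta> w e)" using y_mod[OF p, of "k * k'"] y_mod[OF p, of 1] k'[of 1] by simp
      finally have "fold (twd k \<delta> e) (v @ replicate k' gen_y) e = fold \<delta> (w @ [s]) e"
        using v True by simp
      then show ?thesis by blast
    next
      case False
      then have "fold (twd k \<delta> e) (v @ [s]) e = fold \<delta> (w @ [s]) e" using v twd_off[OF False] by simp
      then show ?thesis by blast
    qed
  qed
  then show "\<And>p. p \<in> D \<Longrightarrow> \<exists>w. fold (twd k \<delta> e) w e = p" using reach by metis
qed (rule qpos finD eD)+

lemma res_yorb: "p \<in> D \<Longrightarrow> res p \<in> yorb del (stab \<delta> e) \<longleftrightarrow> p \<in> yorb \<delta> e"
proof -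
  assume p: "p \<in> D"
  have r: "res ((\<delta> gen_y ^^ i) e) = (del gen_y ^^ i) (stab \<delta> e)" for i
    by (induction i) (simp_all add: res_e res_step)
  show ?thesis
  proof
    assume "res p \<in> yorb del (stab \<delta> e)"
    then obtain i where "res p = res ((\<delta> gen_y ^^ i) e)" unfolding yorb_def r by blast
    then have "p = (\<delta> gen_y ^^ i) e" by (rule inj_onD[OF res_inj _ p funpow_closed[OF eD]])
    then show "p \<in> yorb \<delta> e" unfolding yorb_def by blast
  next
    assume "p \<in> yorb \<delta> e"
    then show "res p \<in> yorb del (stab \<delta> e)" unfolding yorb_def r[symmetric] by auto
  qed
qed

lemma stab_twd: assumes k: "coprime k q" shows "stab (twd k \<delta> e) e = tw k (stab \<delta> e)"
  unfolding tw_def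
proof (rule pmodel_iso_stab[OF twd_pmodel[OF k] res_inj res_e])
  fix s p assume p: "p \<in> D"
  have "res ((\<delta> gen_y ^^ i) p) = (del gen_y ^^ i) (res p)" for i
    by (induction i) (simp_all add: res_step)
  then show "res (twd k \<delta> e s p) = twd k del (stab \<delta> e) s (res p)"
    using res_yorb[OF p] res_step by (simp add: twd_def)
qed

lemma twd_yorb: assumes k: "coprime k q" shows "yorb (twd k \<delta> e) e = yorb \<delta> e"
proof -
  have e: "e \<in> yorb \<delta> e" unfolding yorb_def by (rule range_eqI[of _ _ 0]) simp
  obtain k' where k': "\<And>i. (k * k' * i) mod q = i mod q" using coprime_inverse[OF k] by blast
  have "(\<delta> gen_y ^^ i) e = (\<delta> gen_y ^^ (k * (k' * i))) e" for i
    using y_mod[OF eD, of i] y_mod[OF eD, of "k * (k' * i)"] k'[of i] by (simp add: mult.assoc)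
  then show ?thesis unfolding yorb_def twd_pow_orb[OF e] by (auto simp: image_iff)
qed

lemma stab_twd_twd:
  assumes k: "coprime k q" and l: "coprime l q"
  shows "tw l (tw k (stab \<delta> e)) = tw (k * l) (stab \<delta> e)"
proof -
  interpret k: pmodel q D "twd k \<delta> e" e by (rule twd_pmodel[OF k])
  have kl: "coprime (k * l) q" using k l by simp
  have "tw l (tw k (stab \<delta> e)) = stab (twd l (twd k \<delta> e) e) e"
    unfolding k.stab_twd[OF l] stab_twd[OF k] ..
  also have "\<dots> = stab (twd (k * l) \<delta> e) e"
  proof (rule pmodel_iso_stab[where \<phi> = "\<lambda>p. p", OF k.twd_pmodel[OF l]])
    fix s p assume p: "p \<in> D"
    show "twd l (twd k \<delta> e) e s p = twd (k * l) \<delta> e s p"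
    proof (cases "s = gen_y \<and> p \<in> yorb \<delta> e")
      case True
      then show ?thesis using twd_pow_orb[where p = p and k = k and i = l] by (simp add: twd_def[of l] twd_def[of "k * l"] twd_yorb[OF k])
    next
      case False
      then show ?thesis by (auto simp: twd_def[of l] twd_def[of "k * l"] twd_def[of k] twd_yorb[OF k])
    qed
  qed auto
  finally show ?thesis unfolding stab_twd[OF kl] .
qed

lemma tw_mod:
  assumes k: "coprime k q" and m: "k mod q = l mod q"
  shows "tw k (stab \<delta> e) = tw l (stab \<delta> e)"
proof -
  have l: "coprime l q" using k m qpos coprime_mod_left_iff[of q k] coprime_mod_left_iff[of q l] by simp
  have "stab (twd k \<delta> e) e = stab (twd l \<delta> e) e"
  proof (rule pmodel_iso_stab[where \<phi> = "\<lambda>p. p", OF twd_pmodel[OF k]])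
    fix s p assume p: "p \<in> D"
    show "twd k \<delta> e s p = twd l \<delta> e s p"
      using y_mod[OF p, of k] y_mod[OF p, of l] m by (simp add: twd_def)
  qed auto
  then show ?thesis unfolding stab_twd[OF k] stab_twd[OF l] .
qed

lemma tw_1: "tw 1 (stab \<delta> e) = stab \<delta> e"
proof -
  have "stab (twd 1 \<delta> e) e = stab \<delta> e"
    by (rule pmodel_iso_stab[where \<phi> = "\<lambda>p. p", OF twd_pmodel]) (auto simp: twd_def)
  then show ?thesis using stab_twd[of 1] by simp
qed

lemma tw_fixc:
  assumes k: "coprime k q"
  shows "fixc s (tw k (stab \<delta> e)) = fixc s (stab \<delta> e)"
proof -
  interpret k: pmodel q D "twd k \<delta> e" e by (rule twd_pmodel[OF k])
  obtain k' where k': "\<And>i. (k * k' * i) mod q = i mod q" using coprime_inverse[OF k] by blast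
  have "twd k \<delta> e s p = p \<longleftrightarrow> \<delta> s p = p" if p: "p \<in> D" for p
  proof (cases "s = gen_y \<and> p \<in> yorb \<delta> e")
    case True
    have "\<delta> gen_y p = p" if "(\<delta> gen_y ^^ k) p = p"
    proof -
      have "(\<delta> gen_y ^^ (k * k')) p = p" using that by (induction k') (simp_all add: funpow_add_apply[symmetric])
      then show ?thesis using y_mod[OF p, of "k * k'"] y_mod[OF p, of 1] k'[of 1] by simp
    qed
    moreover have "(\<delta> gen_y ^^ k) p = p" if "\<delta> gen_y p = p" using that by (induction k) simp_all
    ultimately show ?thesis using True by (auto simp: twd_def)
  next
    case False
    then show ?thesis by (auto simp: twd_def)
  qed
  then have "{p \<in> D. twd k \<delta> e s p = p} = {p \<in> D. \<delta> s p = p}" by blast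
  then show ?thesis unfolding stab_twd[OF k, symmetric] k.fixc_stab fixc_stab by (rule arg_cong)
qed

end

text \<open>The generator \<open>y\<close> moves the trivial coset, and \<open>x\<close> fixes the trivial coset (\<open>c = 1\<close>) or moves it to
another coset which is fixed by \<open>y\<close> (\<open>c = 2\<close>). So \<open>c\<close> counts the points of the \<open>x\<close>-orbit of the base point, and
the rest of the coset graph is attached to this orbit only through the nontrivial points of one \<open>y\<close>-cycle.\<close>

definition rooted :: "nat \<Rightarrow> xy list set \<Rightarrow> bool" where
  "rooted c W \<longleftrightarrow> [gen_y] \<notin> W \<and>
     (if c = 1 then [gen_x] \<in> W else [gen_x] \<notin> W \<and> [gen_x, gen_y, gen_x] \<in> W)"

context pmodel begin

lemma rooted_iff: "rooted c (stab \<delta> e) \<longleftrightarrow> \<delta> gen_y e \<noteq> e \<and>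
    (if c = 1 then \<delta> gen_x e = e else \<delta> gen_x e \<noteq> e \<and> \<delta> gen_y (\<delta> gen_x e) = \<delta> gen_x e)"
proof -
  have "\<delta> gen_x (\<delta> gen_y (\<delta> gen_x e)) = e \<longleftrightarrow> \<delta> gen_y (\<delta> gen_x e) = \<delta> gen_x e"
    using xx[OF eD] xx[OF closed[OF closed[OF eD]], of gen_y gen_x] by metis
  then show ?thesis by (simp add: rooted_def stab_def)
qed

lemma e_yorb: "e \<in> yorb \<delta> e"
  unfolding yorb_def by (rule range_eqI[of _ _ 0]) simp

lemma yorb_y_fixed:
  assumes "\<delta> gen_y e \<noteq> e" "p \<in> yorb \<delta> e" shows "\<delta> gen_y p \<noteq> p"
proof
  assume f: "\<delta> gen_y p = p"
  obtain i where i: "p = (\<delta> gen_y ^^ i) e" using assms(2) unfolding yorb_def by blast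
  have "fold \<delta> (replicate i gen_y) (\<delta> gen_y e) = fold \<delta> (replicate i gen_y) e"
    using f unfolding i by (simp add: funpow_swap1)
  then show False using fold_inj[OF closed[OF eD] eD] assms(1) by blast
qed

lemma rooted_tw:
  assumes k: "coprime k q" and r: "rooted c (stab \<delta> e)"
  shows "rooted c (tw k (stab \<delta> e))"
proof -
  interpret k: pmodel q D "twd k \<delta> e" e by (rule twd_pmodel[OF k])
  note r' = r[unfolded rooted_iff]
  have ye: "\<delta> gen_y e \<noteq> e" using r' by blast
  obtain k' where k': "\<And>i. (k * k' * i) mod q = i mod q" using coprime_inverse[OF k] by blast
  have a: "twd k \<delta> e gen_y e \<noteq> e"
  proof
    assume "twd k \<delta> e gen_y e = e"
    then have "(twd k \<delta> e gen_y ^^ k') e = e" by (induction k') simp_all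
    then have "(\<delta> gen_y ^^ (k * k')) e = e" using twd_pow_orb[OF e_yorb] by simp
    then have "\<delta> gen_y e = e" using y_mod[OF eD, of "k * k'"] y_mod[OF eD, of 1] k'[of 1] by simp
    then show False using ye by blast
  qed
  have b: "twd k \<delta> e gen_y (\<delta> gen_x e) = \<delta> gen_x e" if "\<delta> gen_y (\<delta> gen_x e) = \<delta> gen_x e"
    using yorb_y_fixed[OF ye, of "\<delta> gen_x e"] that by (auto simp: twd_def)
  show ?thesis
    unfolding stab_twd[OF k, symmetric] k.rooted_iff twd_x using a b r' by (auto split: if_splits)
qed

end

section \<open>Subgroups fixed by all twists\<close>

text \<open>The unit group of \<open>\<int>/q\<close> for a prime \<open>q\<close>, on the representatives \<open>1, \<dots>, q - 1\<close>.\<close>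

definition Uq :: "nat \<Rightarrow> nat monoid" where
  "Uq q = \<lparr>carrier = {1..<q}, monoid.mult = (\<lambda>a b. a * b mod q), one = 1\<rparr>"

lemma Uq_simps [simp]: "carrier (Uq q) = {1..<q}" "a \<otimes>\<^bsub>Uq q\<^esub> b = a * b mod q" "\<one>\<^bsub>Uq q\<^esub> = 1"
  by (simp_all add: Uq_def)

lemma unit_coprime:
  fixes i q :: nat
  assumes "Factorial_Ring.prime q" "i \<in> {1..<q}" shows "coprime i q"
proof -
  have "\<not> q dvd i" using assms(2) by (intro nat_dvd_not_less) auto
  then have "coprime q i" by (rule prime_imp_coprime[OF assms(1)])
  then show ?thesis by (simp only: coprime_commute)
qed

lemma mult_mod_unit:
  fixes a b q :: nat
  assumes "Factorial_Ring.prime q" "a \<in> {1..<q}" "b \<in> {1..<q}" shows "a * b mod q \<in> {1..<q}"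
proof -
  have "coprime (a * b) q" using unit_coprime[OF assms(1)] assms(2,3) by simp
  then have "\<not> q dvd a * b" using prime_gt_1_nat[OF assms(1)]
    coprime_common_divisor_nat[of "a * b" q q] by auto
  then show ?thesis using prime_gt_0_nat[OF assms(1)] by (auto simp: dvd_eq_mod_eq_0)
qed

lemma group_Uq: assumes q: "Factorial_Ring.prime q" shows "group (Uq q)"
proof (rule groupI)
  fix a assume a: "a \<in> carrier (Uq q)"
  have q1: "q \<noteq> 1" using q by auto
  obtain b c where b: "a * b = q * c + 1"
    using coprime_bezout_strong[OF unit_coprime[OF q, of a] q1] a by auto
  have ab: "(b mod q) * a mod q = 1"
  proof -
    have "(b mod q) * a mod q = (q * c + 1) mod q" unfolding b[symmetric] mod_mult_left_eq mult.commute[of a] ..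
    also have "\<dots> = (1 + q * c) mod q" by (simp only: add.commute)
    also have "\<dots> = 1" unfolding mod_mult_self2 using prime_gt_1_nat[OF q] by simp
    finally show ?thesis .
  qed
  then have "b mod q \<noteq> 0" by (metis mod_0 mult_0 zero_neq_one)
  then have "b mod q \<in> carrier (Uq q)" using prime_gt_0_nat[OF q] by simp
  then show "\<exists>y\<in>carrier (Uq q). y \<otimes>\<^bsub>Uq q\<^esub> a = \<one>\<^bsub>Uq q\<^esub>" using ab by auto
next
  fix a b assume "a \<in> carrier (Uq q)" "b \<in> carrier (Uq q)"
  then show "a \<otimes>\<^bsub>Uq q\<^esub> b \<in> carrier (Uq q)" using mult_mod_unit[OF q, of a b] by simp
next
  fix a b c show "a \<otimes>\<^bsub>Uq q\<^esub> b \<otimes>\<^bsub>Uq q\<^esub> c = a \<otimes>\<^bsub>Uq q\<^esub> (b \<otimes>\<^bsub>Uq q\<^esub> c)"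
    by (simp add: mod_mult_left_eq mod_mult_right_eq mult.assoc)
qed (use prime_gt_1_nat[OF q] in auto)

lemma central_Uq: assumes q: "Factorial_Ring.prime q" shows "central_group (Uq q) 1"
proof -
  interpret group "Uq q" by (rule group_Uq[OF q])
  show ?thesis by unfold_locales (use prime_gt_1_nat[OF q] in auto)
qed

lemma coprime_order_Uq: assumes q: "Factorial_Ring.prime q" shows "coprime q (order (Uq q))"
proof -
  have "order (Uq q) = q - 1" by (simp add: order_def)
  then show ?thesis using prime_gt_1_nat[OF q]
    by (metis coprime_commute coprime_diff_one_left_nat less_imp_le_nat less_numeral_extra(1) order_less_trans)
qed

text \<open>The action in which \<open>y\<close> is made to fix every point of the \<open>y\<close>-orbit of the base point. A word thus
leaves this orbit only through \<open>x\<close>.\<close>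

definition dis :: "(xy \<Rightarrow> 'a \<Rightarrow> 'a) \<Rightarrow> 'a \<Rightarrow> xy \<Rightarrow> 'a \<Rightarrow> 'a" where
  "dis \<delta> e s p = (if s = gen_y \<and> p \<in> yorb \<delta> e then p else \<delta> s p)"

text \<open>The \<open>i\<close>-th point of the \<open>y\<close>-orbit of the base point.\<close>

definition yp :: "(xy \<Rightarrow> 'a \<Rightarrow> 'a) \<Rightarrow> 'a \<Rightarrow> nat \<Rightarrow> 'a" where
  "yp \<delta> e i = (\<delta> gen_y ^^ i) e"

text \<open>In the disconnected action the word \<open>u\<close> leads from the first point of the \<open>y\<close>-orbit to the \<open>j\<close>-th one.\<close>

definition jump :: "(xy \<Rightarrow> 'a \<Rightarrow> 'a) \<Rightarrow> 'a \<Rightarrow> xy list \<Rightarrow> nat \<Rightarrow> bool" where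
  "jump \<delta> e u j \<longleftrightarrow> fold (dis \<delta> e) u (yp \<delta> e 1) = yp \<delta> e j"

lemma yp_Suc: "\<delta> gen_y (yp \<delta> e i) = yp \<delta> e (Suc i)" by (simp add: yp_def)
lemma yp_0 [simp]: "yp \<delta> e 0 = e" by (simp add: yp_def)
lemma yp_yorb: "yp \<delta> e i \<in> yorb \<delta> e" by (auto simp: yp_def yorb_def)
lemma yp_add: "(\<delta> gen_y ^^ i) (yp \<delta> e j) = yp \<delta> e (i + j)"
  by (simp only: yp_def funpow_add_apply)

context pmodel begin

lemma yp_D: "yp \<delta> e i \<in> D" unfolding yp_def by (rule funpow_closed[OF eD])

lemma yp_mod: "yp \<delta> e (i mod q) = yp \<delta> e i" unfolding yp_def by (rule y_mod[OF eD])

lemma yorb_yp: "p \<in> yorb \<delta> e \<Longrightarrow> \<exists>j<q. p = yp \<delta> e j"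
proof -
  assume "p \<in> yorb \<delta> e"
  then obtain i where "p = yp \<delta> e i" by (auto simp: yorb_def yp_def)
  then have "p = yp \<delta> e (i mod q)" by (simp only: yp_mod)
  then show ?thesis using qpos by (intro exI[of _ "i mod q"]) simp
qed

lemma dis_closed: "p \<in> D \<Longrightarrow> dis \<delta> e s p \<in> D" by (simp add: dis_def closed)

lemma fold_dis_closed: "p \<in> D \<Longrightarrow> fold (dis \<delta> e) u p \<in> D"
  by (induction u arbitrary: p) (simp_all add: dis_closed)

lemma dis_order: assumes p: "p \<in> D" shows "fold (dis \<delta> e) (replicate (ordr q s) s) p = p"
proof -
  have "(dis \<delta> e s ^^ i) p = (if s = gen_y \<and> p \<in> yorb \<delta> e then p else (\<delta> s ^^ i) p) \<and>
    (p \<in> yorb \<delta> e \<or> s \<noteq> gen_y \<or> (\<delta> s ^^ i) p \<notin> yorb \<delta> e)" for i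
  proof (induction i)
    case (Suc i)
    have "(\<delta> s ^^ i) p \<in> D" by (rule funpow_closed[OF p])
    then show ?case using Suc yorb_step by (auto simp: dis_def)
  qed auto
  from this[of "ordr q s"] show ?thesis using order[OF p, of s] by simp
qed

lemma res_yp: "res (yp \<delta> e i) = yp del (stab \<delta> e) i"
  unfolding yp_def by (induction i) (simp_all add: res_e res_step)

lemma res_dis: "p \<in> D \<Longrightarrow> res (dis \<delta> e s p) = dis del (stab \<delta> e) s (res p)"
  by (simp add: dis_def res_yorb res_step)

lemma jump_stab: "jump del (stab \<delta> e) u j \<longleftrightarrow> jump \<delta> e u j"
proof -
  have "p \<in> D \<Longrightarrow> res (fold (dis \<delta> e) u p) = fold (dis del (stab \<delta> e)) u (res p)" for p
    by (induction u arbitrary: p) (simp_all add: res_dis dis_closed)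
  from this[OF yp_D, of 1] have "jump del (stab \<delta> e) u j \<longleftrightarrow> res (fold (dis \<delta> e) u (yp \<delta> e 1)) = res (yp \<delta> e j)"
    unfolding jump_def res_yp by simp
  also have "\<dots> \<longleftrightarrow> jump \<delta> e u j" unfolding jump_def
    by (rule inj_on_eq_iff[OF res_inj fold_dis_closed[OF yp_D] yp_D])
  finally show ?thesis .
qed

end

text \<open>A rooted model that is invariant under all twists. Invariance yields automorphisms \<open>phi i\<close> of the
disconnected action that move the \<open>j\<close>-th point of the \<open>y\<close>-orbit to the \<open>(i j)\<close>-th one. Hence the words leading from the
first point back to the \<open>y\<close>-orbit form a subgroup \<open>LL\<close> containing \<open>y\<close>, and the position of the endpoint is a
homomorphism \<open>psi\<close> from \<open>LL\<close> to the unit group.\<close>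

locale tw_fixed = pmodel +
  fixes c :: nat
  assumes q_prime: "Factorial_Ring.prime q"
    and root: "rooted c (stab \<delta> e)"
    and fixed: "i \<in> {1..<q} \<Longrightarrow> tw i (stab \<delta> e) = stab \<delta> e"
begin

abbreviation "yy_pt \<equiv> yp \<delta> e"
abbreviation "ds \<equiv> dis \<delta> e"

lemma q1: "q > 1" using prime_gt_1_nat[OF q_prime] .

lemma ye: "\<delta> gen_y e \<noteq> e" using root[unfolded rooted_iff] by blast

lemma yp_inj: "i < q \<Longrightarrow> j < q \<Longrightarrow> yy_pt i = yy_pt j \<Longrightarrow> i = j"
  using inj_onD[OF funpow_prime_inj[of q "\<delta> gen_y" e, OF q_prime yy[OF eD] ye], of i j]
  by (simp add: yp_def)

lemma yp_eq_iff: "yy_pt i = yy_pt j \<longleftrightarrow> i mod q = j mod q"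
proof
  assume "yy_pt i = yy_pt j"
  then have "yy_pt (i mod q) = yy_pt (j mod q)" by (simp only: yp_mod)
  then show "i mod q = j mod q" using yp_inj qpos by simp
next
  assume "i mod q = j mod q"
  then show "yy_pt i = yy_pt j" by (metis yp_mod)
qed

lemma phi_ex:
  assumes i: "i \<in> {1..<q}"
  shows "\<exists>\<phi>. bij_betw \<phi> D D \<and> \<phi> e = e \<and> (\<forall>s. \<forall>p\<in>D. \<phi> (\<delta> s p) = twd i \<delta> e s (\<phi> p))"
proof -
  have k: "coprime i q" by (rule unit_coprime[OF q_prime i])
  have "stab \<delta> e = stab (twd i \<delta> e) e" unfolding stab_twd[OF k] fixed[OF i] ..
  from pmodel_same_stab_iso[OF pmodel_axioms twd_pmodel[OF k] this] show ?thesis by metis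
qed

text \<open>The isomorphism from the model to its \<open>i\<close>-th twist; it is unique, as the models are transitive.\<close>

definition phi :: "nat \<Rightarrow> 'a \<Rightarrow> 'a" where
  "phi i = (SOME \<phi>. bij_betw \<phi> D D \<and> \<phi> e = e \<and> (\<forall>s. \<forall>p\<in>D. \<phi> (\<delta> s p) = twd i \<delta> e s (\<phi> p)))"

lemma phi:
  assumes i: "i \<in> {1..<q}"
  shows "bij_betw (phi i) D D" "phi i e = e" "p \<in> D \<Longrightarrow> phi i (\<delta> s p) = twd i \<delta> e s (phi i p)"
  using someI_ex[OF phi_ex[OF i]] unfolding phi_def[symmetric] by blast+

lemma phi_inj: "i \<in> {1..<q} \<Longrightarrow> p \<in> D \<Longrightarrow> p' \<in> D \<Longrightarrow> phi i p = phi i p' \<Longrightarrow> p = p'"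
  using phi(1) bij_betw_imp_inj_on inj_onD by metis

lemma phi_yp: assumes i: "i \<in> {1..<q}" shows "phi i (yy_pt j) = yy_pt (i * j)"
proof (induction j)
  case (Suc j)
  have "phi i (yy_pt (Suc j)) = twd i \<delta> e gen_y (phi i (yy_pt j))"
    using phi(3)[OF i yp_D, of gen_y j] by (simp only: yp_Suc)
  also have "\<dots> = yy_pt (i + i * j)" unfolding Suc.IH twd_on[OF yp_yorb] yp_add ..
  finally show ?case by simp
qed (simp add: phi(2)[OF i])

lemma phi_yorb: assumes i: "i \<in> {1..<q}" and p: "p \<in> D" shows "phi i p \<in> yorb \<delta> e \<longleftrightarrow> p \<in> yorb \<delta> e"
proof
  assume "p \<in> yorb \<delta> e"
  then obtain j where "p = yy_pt j" using yorb_yp by blast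
  then show "phi i p \<in> yorb \<delta> e" using phi_yp[OF i] yp_yorb by simp
next
  assume "phi i p \<in> yorb \<delta> e"
  then obtain j where j: "phi i p = yy_pt j" using yorb_yp by blast
  obtain k' where k': "\<And>j. (i * k' * j) mod q = j mod q" using coprime_inverse[OF unit_coprime[OF q_prime i]] by blast
  have "phi i (yy_pt (k' * j)) = yy_pt j"
    unfolding phi_yp[OF i] yp_eq_iff using k'[of j] by (simp add: mult.assoc)
  then have "p = yy_pt (k' * j)" using phi_inj[OF i p yp_D] j by simp
  then show "p \<in> yorb \<delta> e" using yp_yorb by simp
qed

text \<open>The twist is not visible in the disconnected action.\<close>

lemma phi_dis: assumes i: "i \<in> {1..<q}" and p: "p \<in> D" shows "phi i (ds s p) = ds s (phi i p)"
  using phi(3)[OF i p, of s] phi_yorb[OF i p] by (auto simp: dis_def twd_def)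

lemma phi_fold_dis: "i \<in> {1..<q} \<Longrightarrow> p \<in> D \<Longrightarrow> phi i (fold ds u p) = fold ds u (phi i p)"
  by (induction u arbitrary: p) (simp_all add: phi_dis dis_closed)

lemma fold_dis_yp: assumes i: "i \<in> {1..<q}" shows "fold ds u (yy_pt i) = phi i (fold ds u (yy_pt 1))"
  unfolding phi_fold_dis[OF i yp_D] phi_yp[OF i] by simp

lemma jump_shift:
  assumes i: "i \<in> {1..<q}" and j: "jump \<delta> e u j"
  shows "fold ds u (yy_pt i) = yy_pt (i * j)"
  using j unfolding fold_dis_yp[OF i] jump_def by (simp add: phi_yp[OF i])

lemma jump_unshift:
  assumes i: "i \<in> {1..<q}" and j: "fold ds u (yy_pt i) \<in> yorb \<delta> e"
  shows "\<exists>k<q. jump \<delta> e u k"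
proof -
  have "fold ds u (yy_pt 1) \<in> yorb \<delta> e"
    using j unfolding fold_dis_yp[OF i] phi_yorb[OF i fold_dis_closed[OF yp_D]] .
  from yorb_yp[OF this] show ?thesis unfolding jump_def .
qed

text \<open>The \<open>x\<close>-orbit of the base point cannot be entered from outside in the disconnected action.\<close>

lemma avoid_core:
  assumes p: "p \<in> D" "p \<noteq> e" "p \<noteq> \<delta> gen_x e"
  shows "fold ds u p \<noteq> e \<and> fold ds u p \<noteq> \<delta> gen_x e"
  using p
proof (induction u arbitrary: p)
  case (Cons s u)
  have "ds s p \<noteq> e \<and> ds s p \<noteq> \<delta> gen_x e"
  proof (cases "s = gen_y")
    case False
    then have s: "s = gen_x" by (cases s) auto
    have "\<delta> gen_x p \<noteq> e" using xx[OF Cons.prems(1)] Cons.prems(3) by auto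
    moreover have "\<delta> gen_x p \<noteq> \<delta> gen_x e" using step_inj[OF Cons.prems(1) eD] Cons.prems(2) by blast
    ultimately show ?thesis using s by (simp add: dis_def)
  next
    case True
    show ?thesis
    proof (cases "p \<in> yorb \<delta> e")
      case True
      then show ?thesis using Cons.prems \<open>s = gen_y\<close> by (simp add: dis_def)
    next
      case False
      have a: "\<delta> gen_y p \<noteq> e" using yorb_step[OF Cons.prems(1)] False e_yorb by auto
      have "\<delta> gen_y p \<noteq> \<delta> gen_x e"
      proof
        assume *: "\<delta> gen_y p = \<delta> gen_x e"
        show False
        proof (cases "c = 1")
          case True
          then have "\<delta> gen_x e = e" using root[unfolded rooted_iff] by simp
          then show False using * a by simp
        next
          case False
          then have "\<delta> gen_y (\<delta> gen_x e) = \<delta> gen_x e" using root[unfolded rooted_iff] by simp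
          then have "\<delta> gen_y p = \<delta> gen_y (\<delta> gen_x e)" using * by simp
          then show False using step_inj[OF Cons.prems(1) closed[OF eD]] Cons.prems(3) by blast
        qed
      qed
      then show ?thesis using a False \<open>s = gen_y\<close> by (simp add: dis_def)
    qed
  qed
  then show ?case using Cons.IH[OF dis_closed[OF Cons.prems(1)]] by simp
qed simp

lemma yp_not_core: assumes i: "i \<in> {1..<q}" shows "yy_pt i \<noteq> e" "yy_pt i \<noteq> \<delta> gen_x e"
proof -
  show a: "yy_pt i \<noteq> e" using yp_inj[of i 0] i by auto
  show "yy_pt i \<noteq> \<delta> gen_x e"
  proof
    assume *: "yy_pt i = \<delta> gen_x e"
    have "\<delta> gen_y (yy_pt i) \<noteq> yy_pt i" by (rule yorb_y_fixed[OF ye yp_yorb])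
    then show False using * a root[unfolded rooted_iff] by (auto split: if_splits)
  qed
qed

lemma avoid: assumes i: "i \<in> {1..<q}" shows "fold ds u (yy_pt i) \<noteq> e"
  using avoid_core[OF yp_D yp_not_core[OF i]] by blast

lemma jump_unit: assumes j: "jump \<delta> e u j" "j < q" shows "j \<in> {1..<q}"
proof -
  have "yy_pt j \<noteq> e" using avoid[of 1 u] q1 j(1) by (auto simp: jump_def)
  then have "j \<noteq> 0" by (cases j) auto
  then show ?thesis using j(2) by simp
qed

lemma jump_unique: "jump \<delta> e u j \<Longrightarrow> jump \<delta> e u k \<Longrightarrow> j < q \<Longrightarrow> k < q \<Longrightarrow> j = k"
  unfolding jump_def using yp_inj by simp

text \<open>The words leading from the first point of the \<open>y\<close>-orbit back to this orbit, and the position of the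
endpoint.\<close>

definition LL :: "xy list set" where "LL = {u. \<exists>j<q. jump \<delta> e u j}"
definition psi :: "xy list \<Rightarrow> nat" where "psi = (\<lambda>u\<in>LL. THE j. j < q \<and> jump \<delta> e u j)"

lemma psi: assumes u: "u \<in> LL" shows "psi u \<in> {1..<q}" "jump \<delta> e u (psi u)"
proof -
  have "\<exists>!j. j < q \<and> jump \<delta> e u j" using u jump_unique unfolding LL_def by blast
  from theI'[OF this] have "psi u < q \<and> jump \<delta> e u (psi u)" using u by (simp add: psi_def)
  then show "psi u \<in> {1..<q}" "jump \<delta> e u (psi u)" using jump_unit by blast+
qed

lemma psi_eq: assumes "j < q" "jump \<delta> e u j" shows "u \<in> LL" "psi u = j"
proof -
  show u: "u \<in> LL" using assms by (auto simp: LL_def)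
  show "psi u = j" using jump_unique[OF psi(2)[OF u] assms(2)] psi(1)[OF u] assms(1) by simp
qed

lemma jump_append:
  assumes u: "u \<in> LL" shows "fold ds (u @ v) (yy_pt 1) = phi (psi u) (fold ds v (yy_pt 1))"
  using psi(2)[OF u] fold_dis_yp[OF psi(1)[OF u], of v] by (simp add: jump_def)

lemma LL_iff: "u \<in> LL \<longleftrightarrow> fold ds u (yy_pt 1) \<in> yorb \<delta> e"
  unfolding LL_def jump_def using yorb_yp yp_yorb by auto

lemma LL_wsub: "wsub q LL"
  unfolding wsub_def
proof (intro conjI ballI allI)
  show "[] \<in> LL" unfolding LL_iff using yp_yorb by simp
next
  fix u v assume u: "u \<in> LL"
  show "u @ v \<in> LL \<longleftrightarrow> v \<in> LL"
    unfolding LL_iff jump_append[OF u] by (rule phi_yorb[OF psi(1)[OF u] fold_dis_closed[OF yp_D]])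
next
  fix s u v
  have "fold ds (u @ replicate (ordr q s) s @ v) (yy_pt 1) = fold ds (u @ v) (yy_pt 1)"
    unfolding fold_append comp_apply dis_order[OF fold_dis_closed[OF yp_D]] ..
  then show "u @ replicate (ordr q s) s @ v \<in> LL \<longleftrightarrow> u @ v \<in> LL" unfolding LL_iff by simp
qed

lemma LL_finite: "finite (orb LL)"
proof -
  have "orb LL \<subseteq> (\<lambda>p. {t. fold ds t p \<in> yorb \<delta> e}) ` D"
  proof
    fix V assume "V \<in> orb LL"
    then obtain u where "V = fold del u LL" by (auto simp: orb_def)
    then have "V = {t. fold ds t (fold ds u (yy_pt 1)) \<in> yorb \<delta> e}" by (simp add: fold_del LL_iff)
    then show "V \<in> (\<lambda>p. {t. fold ds t p \<in> yorb \<delta> e}) ` D" using fold_dis_closed[OF yp_D] by blast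
  qed
  then show ?thesis using finD finite_surj by blast
qed

lemma LL_y: "[gen_y] \<in> LL"
  unfolding LL_iff using yp_yorb[of \<delta> e 1] by (simp add: dis_def)

lemma psi_coc: "psi \<in> coc q (Uq q) 1 LL"
  unfolding coc_def
proof (intro CollectI conjI ballI allI impI)
  show "psi \<in> LL \<rightarrow>\<^sub>E carrier (Uq q)" using psi(1) by (auto simp: psi_def PiE_def)
next
  fix u v assume u: "u \<in> LL" and v: "v \<in> LL"
  have "fold ds (u @ v) (yy_pt 1) = yy_pt (psi u * psi v)"
    unfolding jump_append[OF u] using psi(2)[OF v] phi_yp[OF psi(1)[OF u]] by (simp add: jump_def)
  then have "jump \<delta> e (u @ v) (psi u * psi v mod q)" unfolding jump_def yp_mod .
  then show "psi (u @ v) = psi u \<otimes>\<^bsub>Uq q\<^esub> psi v" using psi_eq(2) q1 by simp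
next
  fix s u v assume uv: "u @ v \<in> LL"
  have "jump \<delta> e (u @ replicate (ordr q s) s @ v) (psi (u @ v))"
    using psi(2)[OF uv] unfolding jump_def fold_append comp_apply dis_order[OF fold_dis_closed[OF yp_D]] .
  then have "psi (u @ replicate (ordr q s) s @ v) = psi (u @ v)" using psi_eq(2) psi(1)[OF uv] by simp
  then show "psi (u @ replicate (ordr q s) s @ v) = 1 \<otimes>\<^bsub>Uq q\<^esub> psi (u @ v)" using psi(1)[OF uv] by simp
qed

end

text \<open>A twist-invariant rooted subgroup is determined by its jumps, that is by the pair \<open>(LL, psi)\<close>: every point
outside the \<open>x\<close>-orbit of the base point is reached from a point of the \<open>y\<close>-orbit by a word in the disconnected action,
and the jumps tell when such a word is back on the \<open>y\<close>-orbit.\<close>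

lemma tw_fixed_determined:
  assumes A: "tw_fixed q D \<delta> e c" and B: "tw_fixed q D' \<delta>' e' c"
    and J: "\<And>u j. j \<in> {1..<q} \<Longrightarrow> jump \<delta> e u j \<longleftrightarrow> jump \<delta>' e' u j"
  shows "stab \<delta> e = stab \<delta>' e'"
proof -
  interpret a: tw_fixed q D \<delta> e c by fact
  interpret b: tw_fixed q D' \<delta>' e' c by fact
  \<comment> \<open>Corresponding points of the two models.\<close>
  define R where "R p p' \<longleftrightarrow> (p = e \<and> p' = e') \<or> (c \<noteq> 1 \<and> p = \<delta> gen_x e \<and> p' = \<delta>' gen_x e') \<or>
    (\<exists>i\<in>{1..<q}. \<exists>u. p = fold a.ds u (a.yy_pt i) \<and> p' = fold b.ds u (b.yy_pt i))" for p p'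
  have R_yp: "R (a.yy_pt (i mod q)) (b.yy_pt (i mod q))" for i
  proof (cases "i mod q = 0")
    case False
    then have "i mod q \<in> {1..<q}" using a.qpos by simp
    then show ?thesis unfolding R_def by (intro disjI2 bexI[of _ "i mod q"] exI[of _ "[]"]) simp_all
  qed (simp add: R_def)
  have step: "R (\<delta> s p) (\<delta>' s p')" if R: "R p p'" for s p p'
  proof -
    consider (1) "p = e" "p' = e'" | (2) "c \<noteq> 1" "p = \<delta> gen_x e" "p' = \<delta>' gen_x e'"
      | (3) i u where "i \<in> {1..<q}" "p = fold a.ds u (a.yy_pt i)" "p' = fold b.ds u (b.yy_pt i)"
      using R unfolding R_def by blast
    then show ?thesis
    proof cases
      case 1
      show ?thesis
      proof (cases s)
        case gen_x
        then show ?thesis using 1 a.root[unfolded a.rooted_iff] b.root[unfolded b.rooted_iff]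
          by (auto simp: R_def)
      next
        case gen_y
        have "R (a.yy_pt (1 mod q)) (b.yy_pt (1 mod q))" by (rule R_yp)
        then show ?thesis using 1 gen_y a.q1 by (simp add: yp_def)
      qed
    next
      case 2
      show ?thesis
      proof (cases s)
        case gen_x
        then show ?thesis using 2 a.xx[OF a.eD] b.xx[OF b.eD] by (simp add: R_def)
      next
        case gen_y
        then show ?thesis using 2 a.root[unfolded a.rooted_iff] b.root[unfolded b.rooted_iff]
          by (simp add: R_def)
      qed
    next
      case 3
      have off: "R (\<delta> s p) (\<delta>' s p')" if "a.ds s p = \<delta> s p" "b.ds s p' = \<delta>' s p'"
      proof -
        have "\<delta> s p = fold a.ds (u @ [s]) (a.yy_pt i)" "\<delta>' s p' = fold b.ds (u @ [s]) (b.yy_pt i)"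
          using that 3 by simp_all
        then show ?thesis unfolding R_def using 3(1) by blast
      qed
      show ?thesis
      proof (cases "s = gen_y")
        case False
        then show ?thesis by (intro off) (simp_all add: dis_def)
      next
        case True
        have iff: "p \<in> yorb \<delta> e \<longleftrightarrow> (\<exists>k\<in>{1..<q}. jump \<delta> e u k)"
          using 3 a.jump_unshift a.jump_shift a.jump_unit yp_yorb by metis
        have iff': "p' \<in> yorb \<delta>' e' \<longleftrightarrow> (\<exists>k\<in>{1..<q}. jump \<delta>' e' u k)"
          using 3 b.jump_unshift b.jump_shift b.jump_unit yp_yorb by metis
        show ?thesis
        proof (cases "\<exists>k\<in>{1..<q}. jump \<delta> e u k")
          case True
          then obtain k where k: "k \<in> {1..<q}" "jump \<delta> e u k" by blast
          have "p = a.yy_pt (i * k)" using a.jump_shift[OF 3(1) k(2)] 3(2) by simp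
          then have p1: "\<delta> gen_y p = a.yy_pt (Suc (i * k) mod q)" by (simp only: yp_Suc a.yp_mod)
          have "p' = b.yy_pt (i * k)" using b.jump_shift[OF 3(1)] J[OF k(1)] k(2) 3(3) by simp
          then have p2: "\<delta>' gen_y p' = b.yy_pt (Suc (i * k) mod q)" by (simp only: yp_Suc b.yp_mod)
          show ?thesis unfolding \<open>s = gen_y\<close> p1 p2 by (rule R_yp)
        next
          case False
          then have "\<not> (\<exists>k\<in>{1..<q}. jump \<delta>' e' u k)" using J by blast
          then show ?thesis using False iff iff' by (intro off) (simp_all add: dis_def)
        qed
      qed
    qed
  qed
  have all: "R (fold \<delta> w e) (fold \<delta>' w e')" for w
    by (induction w rule: rev_induct) (simp_all add: step, simp add: R_def)
  have end_iff: "p = e \<longleftrightarrow> p' = e'" if R: "R p p'" for p p'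
  proof -
    have "\<delta> gen_x e \<noteq> e" "\<delta>' gen_x e' \<noteq> e'" if "c \<noteq> 1"
      using that a.root[unfolded a.rooted_iff] b.root[unfolded b.rooted_iff] by auto
    then show ?thesis using R a.avoid b.avoid unfolding R_def by metis
  qed
  show ?thesis using end_iff[OF all] unfolding stab_def by auto
qed

section \<open>Gluing a twist-invariant subgroup from a cocycle\<close>

text \<open>The points of the \<open>x\<close>-orbit of the base point are \<open>Inl i\<close> with \<open>i < c\<close>; the other points form the
covering \<open>orb L \<times> {1..<q}\<close> given by the labelling \<open>f\<close> in the unit group. The fibre over the trivial coset of \<open>L\<close>, which
\<open>y\<close> fixes, is joined with the base point \<open>Inl 0\<close> to a single \<open>y\<close>-cycle of length \<open>q\<close>.\<close>

definition gl :: "nat \<Rightarrow> nat \<Rightarrow> xy list set \<Rightarrow> (xy \<Rightarrow> xy list set \<Rightarrow> nat) \<Rightarrow> xy \<Rightarrow>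
    nat + xy list set \<times> nat \<Rightarrow> nat + xy list set \<times> nat" where
  "gl q c L f s p = (case p of
      Inl i \<Rightarrow> (case s of gen_x \<Rightarrow> Inl (c - 1 - i) | gen_y \<Rightarrow> if i = 0 then Inr (L, 1) else Inl i)
    | Inr (V, b) \<Rightarrow> if s = gen_y \<and> V = L then (if Suc b = q then Inl 0 else Inr (L, Suc b))
        else Inr (del s V, b * f s V mod q))"

text \<open>A subgroup \<open>L\<close> containing \<open>y\<close> with a labelling in the unit group, that is with a homomorphism to it. The
labelling is trivial on loops at \<open>y\<close>, since \<open>q\<close> is prime to \<open>q - 1\<close>.\<close>

locale glue = wcover "Uq q" 1 q L for q L +
  fixes c :: nat and f :: "xy \<Rightarrow> xy list set \<Rightarrow> nat"
  assumes qp: "Factorial_Ring.prime q" and yL: "[gen_y] \<in> L" and c12: "c = 1 \<or> c = 2"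
    and f: "f \<in> lifts q (Uq q) 1 L"
begin

abbreviation "g \<equiv> gl q c L f"
text \<open>The points of the glued model.\<close>

definition "DD = Inl ` {..<c} \<union> Inr ` (orb L \<times> {1..<q})"
abbreviation "base \<equiv> (Inl 0 :: nat + xy list set \<times> nat)"

lemma ext_app: "ext f s (V, b) = (del s V, b * f s V mod q)"
  by (simp add: ext_def)

lemma gl_simps:
  "g gen_x (Inl i) = Inl (c - 1 - i)" "g gen_y (Inl i) = (if i = 0 then Inr (L, 1) else Inl i)"
  "g gen_x (Inr (V, b)) = Inr (del gen_x V, b * f gen_x V mod q)"
  "g gen_y (Inr (V, b)) = (if V = L then (if Suc b = q then Inl 0 else Inr (L, Suc b))
     else Inr (del gen_y V, b * f gen_y V mod q))"
  by (simp_all add: gl_def)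

lemma q1: "q > 1" using prime_gt_1_nat[OF qp] .

lemma fc: "V \<in> orb L \<Longrightarrow> f s V \<in> {1..<q}" using liftsD(1)[OF f] by simp

lemma delL: "del gen_y L = L" using yL unfolding mem_W by simp

lemma fy1: "V \<in> orb L \<Longrightarrow> del gen_y V = V \<Longrightarrow> f gen_y V = 1"
  using lift_fixed_trivial[OF f _ _ _ coprime_order_Uq[OF qp]] by simp

lemma g_Inr: "\<not> (s = gen_y \<and> V = L) \<Longrightarrow> g s (Inr (V, b)) = Inr (ext f s (V, b))"
  by (cases s) (auto simp: gl_simps ext_app)

text \<open>The \<open>y\<close>-orbit of the base point in the glued model: position \<open>j\<close> is the unit \<open>j\<close> over the trivial coset.\<close>

lemma yp_base: "j < q \<Longrightarrow> yp g base j = (if j = 0 then base else Inr (L, j))"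
proof (induction j)
  case (Suc j)
  then show ?case unfolding yp_Suc[symmetric] by (auto simp: gl_simps)
qed simp

lemma yp_base_q: "yp g base q = base"
proof -
  obtain j where j: "q = Suc j" using q1 by (cases q) auto
  have "yp g base j = Inr (L, j)" using yp_base[of j] q1 j by auto
  then have "yp g base (Suc j) = g gen_y (Inr (L, j))" by (simp only: yp_Suc[symmetric])
  also have "\<dots> = base" unfolding gl_simps(4) using j[symmetric] by (simp only: if_True simp_thms)
  finally have "yp g base (Suc j) = base" .
  then show ?thesis by (simp only: j[symmetric])
qed

lemma yp_base_mod: "yp g base (i mod q) = yp g base i"
  unfolding yp_def by (rule funpow_mod_eq) (rule yp_base_q[unfolded yp_def])

lemma yorb_g: "yorb g base = insert base (Inr ` ({L} \<times> {1..<q}))"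
proof (intro equalityI subsetI)
  fix p assume "p \<in> yorb g base"
  then obtain i where "p = yp g base i" by (auto simp: yorb_def yp_def)
  then have "p = yp g base (i mod q)" by (simp only: yp_base_mod)
  then show "p \<in> insert base (Inr ` ({L} \<times> {1..<q}))" using yp_base[of "i mod q"] q1 by auto
next
  fix p assume "p \<in> insert base (Inr ` ({L} \<times> {1..<q}))"
  then consider "p = base" | b where "p = Inr (L, b)" "b \<in> {1..<q}" by auto
  then have "\<exists>j<q. p = yp g base j"
  proof cases
    case 1
    then show ?thesis using q1 by (intro exI[of _ 0]) simp
  next
    case 2
    then show ?thesis using yp_base[of b] by (intro exI[of _ b]) simp
  qed
  then show "p \<in> yorb g base" using yp_yorb by auto
qed

lemma delV: "V \<in> orb L \<Longrightarrow> del gen_y V = L \<longleftrightarrow> V = L"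
  using M.step_inj[OF _ orb_self, of V gen_y] delL by auto

lemma y_off: "V \<in> orb L \<Longrightarrow> V \<noteq> L \<Longrightarrow> b \<in> {1..<q} \<Longrightarrow>
    (g gen_y ^^ n) (Inr (V, b)) = Inr ((ext f gen_y ^^ n) (V, b)) \<and>
    fst ((ext f gen_y ^^ n) (V, b)) \<in> orb L - {L}"
proof (induction n)
  case (Suc n)
  then obtain V' b' where e: "(ext f gen_y ^^ n) (V, b) = (V', b')" "V' \<in> orb L" "V' \<noteq> L"
    by (cases "(ext f gen_y ^^ n) (V, b)") auto
  have "(g gen_y ^^ Suc n) (Inr (V, b)) = g gen_y (Inr (V', b'))" using Suc e by simp
  also have "\<dots> = Inr (ext f gen_y (V', b'))" by (rule g_Inr) (use e in simp)
  finally show ?case using e M.closed[OF e(2), of gen_y] delV[OF e(2)] by (simp add: ext_app)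
qed simp

lemma x_pow: "(g gen_x ^^ n) (Inr p) = Inr ((ext f gen_x ^^ n) p)"
proof -
  have "g gen_x (Inr p') = Inr (ext f gen_x p')" for p' by (cases p') (simp add: gl_simps ext_app)
  then show ?thesis by (induction n) simp_all
qed

lemma ext_D: "V \<in> orb L \<Longrightarrow> b \<in> {1..<q} \<Longrightarrow> ext f s (V, b) \<in> orb L \<times> {1..<q}"
  using M.closed[of V s] mult_mod_unit[OF qp, of b "f s V"] fc[of V s] by (simp add: ext_app)

lemma DD_cases:
  assumes "p \<in> DD"
  obtains (1) i where "p = Inl i" "i < c" | (2) b where "p = Inr (L, b)" "b \<in> {1..<q}"
    | (3) V b where "p = Inr (V, b)" "V \<in> orb L" "V \<noteq> L" "b \<in> {1..<q}"
proof (cases p)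
  case (Inl i)
  then show ?thesis using assms that(1) by (auto simp: DD_def)
next
  case (Inr vb)
  then obtain V b where p: "p = Inr (V, b)" "V \<in> orb L" "b \<in> {1..<q}"
    using assms by (cases vb) (auto simp: DD_def)
  show ?thesis
  proof (cases "V = L")
    case True
    then show ?thesis using p that(2) by blast
  next
    case False
    then show ?thesis using p that(3) by blast
  qed
qed

sublocale K: pmodel q DD g base
proof (intro pmodel.intro)
  show "finite DD" unfolding DD_def using finW by simp
  show "base \<in> DD" unfolding DD_def using c12 by auto
next
  fix p s assume p: "p \<in> DD"
  from p show "g s p \<in> DD"
  proof (cases rule: DD_cases)
    case (1 i)
    then show ?thesis using c12 q1 orb_self[of L] by (cases s) (auto simp: gl_simps DD_def)
  next
    case (2 b)
    show ?thesis
    proof (cases "s = gen_y")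
      case True
      then show ?thesis using 2 c12 orb_self[of L] by (auto simp: gl_simps DD_def)
    next
      case False
      then have "g s p = Inr (ext f s (L, b))" using 2 g_Inr by simp
      then show ?thesis using ext_D[OF orb_self 2(2)] by (simp add: DD_def)
    qed
  next
    case (3 V b)
    then have "g s p = Inr (ext f s (V, b))" using g_Inr by simp
    then show ?thesis using ext_D[OF 3(2,4)] by (simp add: DD_def)
  qed
  show "(g s ^^ ordr q s) p = p"
  proof (cases s)
    case gen_x
    from p show ?thesis
    proof (cases rule: DD_cases)
      case (1 i)
      then show ?thesis using gen_x c12 by (auto simp: gl_simps numeral_2_eq_2)
    next
      case (2 b)
      then show ?thesis using gen_x x_pow ext_order[OF f _ orb_self, of b gen_x] by simp
    next
      case (3 V b)
      then show ?thesis using gen_x x_pow ext_order[OF f _ 3(2), of b gen_x] by simp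
    qed
  next
    case gen_y
    have onorb: "(g gen_y ^^ q) (yp g base j) = yp g base j" for j
      unfolding yp_add using yp_base_mod[of "q + j"] yp_base_mod[of j] by (metis mod_add_self1)
    from p show ?thesis
    proof (cases rule: DD_cases)
      case (1 i)
      show ?thesis
      proof (cases "i = 0")
        case True
        then show ?thesis using 1 onorb[of 0] gen_y by simp
      next
        case False
        then have "g gen_y (Inl i) = Inl i" by (simp add: gl_simps)
        then have "(g gen_y ^^ n) (Inl i) = Inl i" for n by (induction n) simp_all
        then show ?thesis using 1 gen_y by simp
      qed
    next
      case (2 b)
      then show ?thesis using onorb[of b] yp_base[of b] gen_y by simp
    next
      case (3 V b)
      then show ?thesis using gen_y y_off[OF 3(2,3,4), of q] ext_order[OF f _ 3(2), of b gen_y] by simp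
    qed
  qed
next
  have oreach: "\<exists>w. fold g w base = yp g base j" for j
    by (rule exI[of _ "replicate j gen_y"]) (simp add: yp_def)
  have Lreach: "\<exists>w. fold g w base = Inr (L, b)" if "b \<in> {1..<q}" for b
    using oreach[of b] yp_base[of b] that by simp
  have "\<forall>b\<in>{1..<q}. \<exists>w. fold g w base = Inr (fold del u L, b)" for u
  proof (induction u rule: rev_induct)
    case (snoc s u)
    let ?V = "fold del u L"
    have V: "?V \<in> orb L" by (rule M.fold_closed[OF orb_self])
    show ?case
    proof
      fix b assume b: "b \<in> {1..<q}"
      show "\<exists>w. fold g w base = Inr (fold del (u @ [s]) L, b)"
      proof (cases "s = gen_y \<and> ?V = L")
        case True
        then show ?thesis using Lreach[OF b] delL by simp
      next
        case False
        have fin': "f s ?V \<in> carrier (Uq q)" using fc[OF V] by simp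
        let ?b = "b \<otimes>\<^bsub>Uq q\<^esub> inv\<^bsub>Uq q\<^esub> (f s ?V)"
        have bc: "b \<in> carrier (Uq q)" using b by simp
        have b': "?b \<in> carrier (Uq q)" by (rule m_closed[OF bc inv_closed[OF fin']])
        have e: "?b \<otimes>\<^bsub>Uq q\<^esub> f s ?V = b"
          unfolding m_assoc[OF bc inv_closed[OF fin'] fin'] l_inv[OF fin'] by (rule r_one[OF bc])
        obtain w where w: "fold g w base = Inr (?V, ?b)"
          using snoc[THEN bspec, OF b'[unfolded Uq_simps(1)]] by blast
        have "fold g (w @ [s]) base = Inr (ext f s (?V, ?b))"
          using w g_Inr[OF False] by simp
        also have "\<dots> = Inr (fold del (u @ [s]) L, b)" using e by (simp only: ext_def fst_conv snd_conv fold_append comp_apply fold_simps)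
        finally show ?thesis by blast
      qed
    qed
  qed (use Lreach in simp)
  then have Ireach: "\<exists>w. fold g w base = Inr (V, b)" if "V \<in> orb L" "b \<in> {1..<q}" for V b
    using M.reach[OF that(1)] that(2) by blast
  fix p assume "p \<in> DD"
  then consider (1) "p = base" | (2) "c = 2" "p = Inl 1" | (3) V b where "p = Inr (V, b)" "V \<in> orb L" "b \<in> {1..<q}"
    unfolding DD_def using c12 by (auto simp: less_2_cases_iff)
  then show "\<exists>w. fold g w base = p"
  proof cases
    case 1
    then show ?thesis by (intro exI[of _ "[]"]) simp
  next
    case 2
    then show ?thesis using gl_simps(1)[of 0] by (intro exI[of _ "[gen_x]"]) simp
  next
    case 3
    then show ?thesis using Ireach by simp
  qed
qed (use q1 in simp)

text \<open>The glued subgroup.\<close>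

definition KK :: "xy list set" where "KK = stab g base"

lemma KK_card: "KK \<in> subs q (c + (q - 1) * card (orb L))"
proof -
  have "card DD = c + card (orb L) * (q - 1)"
    unfolding DD_def by (subst card_Un_disjoint) (use finW in \<open>auto simp: card_image card_cartesian_product\<close>)
  then show ?thesis unfolding KK_def using K.stab_in_subs by (simp add: mult.commute)
qed

lemma KK_rooted: "rooted c KK"
  unfolding KK_def K.rooted_iff using c12 by (auto simp: gl_def)

lemma KK_fix_y: "fixc gen_y KK + q = c + (q - 1) * fixc gen_y L"
proof -
  let ?F = "{V \<in> orb L. del gen_y V = V}"
  have LF: "L \<in> ?F" using orb_self delL by simp
  have fF: "finite ?F" using finW by simp
  have cF: "card (?F - {L}) + 1 = fixc gen_y L" unfolding fixc_def using card.remove[OF fF LF] by simp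
  have "{p \<in> DD. g gen_y p = p} = Inl ` {1..<c} \<union> Inr ` ((?F - {L}) \<times> {1..<q})"
  proof (intro equalityI subsetI)
    fix p assume p: "p \<in> {p \<in> DD. g gen_y p = p}"
    then have "p \<in> DD" by simp
    then show "p \<in> Inl ` {1..<c} \<union> Inr ` ((?F - {L}) \<times> {1..<q})"
    proof (cases rule: DD_cases)
      case (1 i)
      then have "i \<noteq> 0" using p by (intro notI) (simp add: gl_simps)
      then show ?thesis using 1 by auto
    next
      case (2 b)
      then show ?thesis using p by (auto simp: gl_simps split: if_splits)
    next
      case (3 V b)
      then show ?thesis using p by (auto simp: gl_simps)
    qed
  next
    fix p assume "p \<in> Inl ` {1..<c} \<union> Inr ` ((?F - {L}) \<times> {1..<q})"
    then consider (1) i where "p = Inl i" "i \<in> {1..<c}"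
      | (3) V b where "p = Inr (V, b)" "V \<in> orb L" "del gen_y V = V" "V \<noteq> L" "b \<in> {1..<q}"
      by blast
    then show "p \<in> {p \<in> DD. g gen_y p = p}"
    proof cases
      case 1
      then show ?thesis by (auto simp: gl_simps DD_def)
    next
      case 3
      then show ?thesis using fy1[OF 3(2,3)] by (simp add: gl_simps DD_def)
    qed
  qed
  then have "fixc gen_y KK = card (Inl ` {1..<c} \<union> Inr ` ((?F - {L}) \<times> {1..<q}) :: (nat + xy list set \<times> nat) set)"
    unfolding KK_def K.fixc_stab by simp
  also have "\<dots> = (c - 1) + card (?F - {L}) * (q - 1)"
    by (subst card_Un_disjoint) (use fF in \<open>auto simp: card_image card_cartesian_product\<close>)
  finally have "fixc gen_y KK = (c - 1) + card (?F - {L}) * (q - 1)" .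
  moreover have "(q - 1) * fixc gen_y L = card (?F - {L}) * (q - 1) + (q - 1)"
    unfolding cF[symmetric] by (simp add: algebra_simps)
  ultimately show ?thesis using c12 q1 by auto
qed

lemma KK_fix_x: "\<exists>k \<le> (q - 1) * fixc gen_x L. fixc gen_x KK = (if c = 1 then 1 else 0) + k"
proof -
  let ?F = "{V \<in> orb L. del gen_x V = V}"
  let ?E = "{p \<in> Inr ` (orb L \<times> {1..<q}). g gen_x p = p}"
  have "?E \<subseteq> Inr ` (?F \<times> {1..<q})" by (auto simp: gl_simps)
  then have "card ?E \<le> card (Inr ` (?F \<times> {1..<q}) :: (nat + xy list set \<times> nat) set)"
    by (rule card_mono[rotated]) (use finW in simp)
  also have "\<dots> = (q - 1) * fixc gen_x L"
    by (simp add: card_image card_cartesian_product fixc_def)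
  finally have le: "card ?E \<le> (q - 1) * fixc gen_x L" .
  have "{p \<in> DD. g gen_x p = p} = (if c = 1 then {base} else {}) \<union> ?E"
    unfolding DD_def using c12 by (auto simp: gl_def less_2_cases_iff)
  then have "fixc gen_x KK = card ((if c = 1 then {base} else {}) \<union> ?E)"
    unfolding KK_def K.fixc_stab by simp
  also have "\<dots> = card (if c = 1 then {base} else {}) + card ?E"
    by (rule card_Un_disjoint) (use finW in auto)
  finally show ?thesis using le by (intro exI[of _ "card ?E"]) auto
qed

text \<open>Multiplication of the fibre coordinate by \<open>i\<close> is an isomorphism from the glued model to its \<open>i\<close>-th twist.\<close>

lemma KK_tw: assumes i: "i \<in> {1..<q}" shows "tw i KK = KK"
proof -
  have k: "coprime i q" by (rule unit_coprime[OF qp i])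
  define \<phi> :: "nat + xy list set \<times> nat \<Rightarrow> nat + xy list set \<times> nat"
    where "\<phi> p = (case p of Inl j \<Rightarrow> Inl j | Inr (V, b) \<Rightarrow> Inr (V, i * b mod q))" for p
  have inj: "inj_on \<phi> DD"
  proof (rule inj_onI)
    fix p p' assume p: "p \<in> DD" "p' \<in> DD" "\<phi> p = \<phi> p'"
    have can: "b = b'" if "i * b mod q = i * b' mod q" "b \<in> {1..<q}" "b' \<in> {1..<q}" for b b'
      using l_cancel[of i b b'] i that by simp
    show "p = p'"
    proof (cases p)
      case (Inl j)
      then show ?thesis using p(3) by (simp add: \<phi>_def split: sum.splits prod.splits)
    next
      case (Inr vb)
      obtain V b where vb: "vb = (V, b)" by (cases vb)
      obtain V' b' where p': "p' = Inr (V', b')"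
        using p(3) unfolding Inr by (cases p') (auto simp: \<phi>_def split: prod.splits)
      have e: "V = V'" "i * b mod q = i * b' mod q" using p(3) unfolding Inr vb p' by (simp_all add: \<phi>_def)
      have "b \<in> {1..<q}" "b' \<in> {1..<q}" using p(1,2) unfolding Inr vb p' by (auto simp: DD_def)
      then have "b = b'" by (rule can[OF e(2)])
      then show ?thesis unfolding Inr vb p' e(1) by (rule arg_cong)
    qed
  qed
  have \<phi>yp_base: "\<phi> (yp g base j) = yp g base (i * j)" for j
  proof -
    have "\<phi> (yp g base (j mod q)) = yp g base (i * (j mod q) mod q)"
    proof (cases "j mod q = 0")
      case True
      then show ?thesis by (simp add: \<phi>_def)
    next
      case False
      then have u: "j mod q \<in> {1..<q}" using q1 by simp
      have "i * (j mod q) mod q \<in> {1..<q}" by (rule mult_mod_unit[OF qp i u])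
      then show ?thesis using yp_base[of "j mod q"] yp_base[of "i * (j mod q) mod q"] u by (simp add: \<phi>_def)
    qed
    then show ?thesis by (simp only: yp_base_mod mod_mult_right_eq)
  qed
  have "stab g base = stab (twd i g base) base"
  proof (rule pmodel_iso_stab[OF K.pmodel_axioms inj])
    show "\<phi> base = base" by (simp add: \<phi>_def)
    fix s p assume p: "p \<in> DD"
    show "\<phi> (g s p) = twd i g base s (\<phi> p)"
    proof (cases "s = gen_y \<and> p \<in> yorb g base")
      case True
      then obtain j where j: "p = yp g base j" using K.yorb_yp by blast
      have "\<phi> (g s p) = yp g base (i + i * j)" using True unfolding j by (simp add: yp_Suc \<phi>yp_base)
      also have "\<dots> = twd i g base s (\<phi> p)" using True unfolding j by (simp add: \<phi>yp_base twd_on[OF yp_yorb] yp_add)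
      finally show ?thesis .
    next
      case False
      from p consider (1) j where "p = Inl j" "j < c" | (2) V b where "p = Inr (V, b)" "V \<in> orb L" "b \<in> {1..<q}"
        unfolding DD_def by auto
      then show ?thesis
      proof cases
        case 1
        have "\<phi> p = p" "\<phi> (g s p) = g s p" using 1 False by (cases s; auto simp: \<phi>_def gl_simps yorb_g)+
        then show ?thesis using twd_off[OF False] by simp
      next
        case 2
        have nsV: "\<not> (s = gen_y \<and> V = L)" using 2 False by (auto simp: yorb_g)
        then have off: "\<not> (s = gen_y \<and> \<phi> p \<in> yorb g base)" using 2 by (auto simp: yorb_g \<phi>_def)
        have "g s p = Inr (del s V, b * f s V mod q)" using g_Inr[OF nsV] 2 by (simp add: ext_app)
        moreover have "g s (\<phi> p) = Inr (del s V, (i * b mod q) * f s V mod q)"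
          using g_Inr[OF nsV] 2 by (simp add: ext_app \<phi>_def)
        ultimately show ?thesis unfolding twd_off[OF off]
          by (simp add: \<phi>_def mod_mult_left_eq mod_mult_right_eq mult.assoc)
      qed
    qed
  qed
  then show ?thesis unfolding KK_def K.stab_twd[OF k] by simp
qed

lemma KK_tw_fixed: "tw_fixed q DD g base c"
  by (intro tw_fixed.intro K.pmodel_axioms tw_fixed_axioms.intro qp)
    (use KK_rooted KK_tw in \<open>simp_all add: KK_def\<close>)

text \<open>The pair \<open>(LL, psi)\<close> of the glued model is the pair from which it was glued.\<close>

lemma KK_jump: "j \<in> {1..<q} \<Longrightarrow> jump g base u j \<longleftrightarrow> u \<in> L \<and> holW f u = j"
proof -
  assume j: "j \<in> {1..<q}"
  have d: "dis g base s (Inr (V, b)) = Inr (ext f s (V, b))" if "V \<in> orb L" "b \<in> {1..<q}" for s V b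
  proof (cases "s = gen_y \<and> V = L")
    case True
    then show ?thesis using that fy1[OF orb_self delL] delL by (simp add: dis_def yorb_g ext_app)
  next
    case False
    then show ?thesis using g_Inr[OF False] by (auto simp: dis_def yorb_g)
  qed
  have fd: "V \<in> orb L \<Longrightarrow> b \<in> {1..<q} \<Longrightarrow> fold (dis g base) u (Inr (V, b)) = Inr (fold (ext f) u (V, b))" for V b
  proof (induction u arbitrary: V b)
    case (Cons s u)
    obtain V' b' where e: "ext f s (V, b) = (V', b')" by (cases "ext f s (V, b)")
    then have "V' \<in> orb L" "b' \<in> {1..<q}" using ext_D[OF Cons.prems, of s] by auto
    then show ?case using Cons.IH d[OF Cons.prems] e by simp
  qed simp
  have c1: "1 \<in> {1..<q}" using q1 by simp
  have "yp g base 1 = Inr (L, 1)" using yp_base[of 1] q1 by simp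
  then have "fold (dis g base) u (yp g base 1) = Inr (fold del u L, 1 \<otimes>\<^bsub>Uq q\<^esub> hol (Uq q) f L u)"
    using fd[OF orb_self c1] fold_ext[OF liftsD(1)[OF f] orb_self, of 1 u] c1 by simp
  moreover have h: "hol (Uq q) f L u \<in> carrier (Uq q)" by (rule hol_closed[OF liftsD(1)[OF f] orb_self])
  ultimately have "fold (dis g base) u (yp g base 1) = Inr (fold del u L, hol (Uq q) f L u)" by simp
  then show ?thesis using yp_base[of j] j unfolding jump_def by (auto simp: mem_W holW_def)
qed

end

section \<open>Parity of rooted subgroups\<close>

text \<open>The subgroups \<open>L\<close> of index \<open>M\<close> that contain \<open>y\<close>, with a homomorphism to the unit group of \<open>\<int>/q\<close>.\<close>

definition U_pairs :: "nat \<Rightarrow> nat \<Rightarrow> (xy list set \<times> (xy list \<Rightarrow> nat)) set" where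
  "U_pairs q M = {(L, \<psi>). L \<in> subs q M \<and> [gen_y] \<in> L \<and> \<psi> \<in> coc q (Uq q) 1 L}"

text \<open>The subgroup glued from such a pair, with some labelling whose holonomy is the given homomorphism. The
choice does not matter, by \<open>tw_fixed_determined\<close>.\<close>

definition glued :: "nat \<Rightarrow> nat \<Rightarrow> xy list set \<times> (xy list \<Rightarrow> nat) \<Rightarrow> xy list set" where
  "glued q c = (\<lambda>(L, \<psi>). stab (gl q c L (SOME f. f \<in> lifts q (Uq q) 1 L \<and> restrict (hol (Uq q) f L) L = \<psi>)) (Inl 0))"

lemma wcover_Uq:
  assumes "Factorial_Ring.prime q" "L \<in> subs q M" shows "wcover (Uq q) 1 q L"
proof -
  interpret central_group "Uq q" 1 by (rule central_Uq[OF assms(1)])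
  show ?thesis by unfold_locales (use assms prime_gt_0_nat in \<open>auto simp: subs_def\<close>)
qed

lemma glue_exists:
  assumes q: "Factorial_Ring.prime q" and c: "c = 1 \<or> c = 2" and p: "(L, \<psi>) \<in> U_pairs q M"
  shows "\<exists>f. glue q L c f \<and> restrict (hol (Uq q) f L) L = \<psi> \<and> glued q c (L, \<psi>) = glue.KK q L c f"
proof -
  have L: "L \<in> subs q M" "[gen_y] \<in> L" "\<psi> \<in> coc q (Uq q) 1 L" using p by (auto simp: U_pairs_def)
  interpret wcover "Uq q" 1 q L by (rule wcover_Uq[OF q L(1)])
  let ?P = "\<lambda>f. f \<in> lifts q (Uq q) 1 L \<and> restrict (hol (Uq q) f L) L = \<psi>"
  have "restrict (\<lambda>_. 1) (orb L - {L}) \<in> orb L - {L} \<rightarrow>\<^sub>E carrier (Uq q)"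
    using prime_gt_1_nat[OF q] by simp
  from gauge_lift[OF L(3) this] have "\<exists>f. ?P f" unfolding holW_def by blast
  then have P: "?P (SOME f. ?P f)" by (rule someI_ex)
  then have g: "glue q L c (SOME f. ?P f)"
    by (intro glue.intro wcover_axioms glue_axioms.intro q L(2) c) blast
  have "glued q c (L, \<psi>) = glue.KK q L c (SOME f. ?P f)"
    unfolding glue.KK_def[OF g] glued_def prod.case ..
  then show ?thesis using g P by blast
qed

lemma glued_props:
  assumes q: "Factorial_Ring.prime q" and c: "c = 1 \<or> c = 2" and p: "(L, \<psi>) \<in> U_pairs q M"
  shows "glued q c (L, \<psi>) \<in> subs q (c + (q - 1) * M)" "rooted c (glued q c (L, \<psi>))"
    "i \<in> {1..<q} \<Longrightarrow> tw i (glued q c (L, \<psi>)) = glued q c (L, \<psi>)"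
    "fixc gen_y (glued q c (L, \<psi>)) + q = c + (q - 1) * fixc gen_y L"
    "\<exists>k \<le> (q - 1) * fixc gen_x L. fixc gen_x (glued q c (L, \<psi>)) = (if c = 1 then 1 else 0) + k"
    "j \<in> {1..<q} \<Longrightarrow> jump del (glued q c (L, \<psi>)) u j \<longleftrightarrow> u \<in> L \<and> \<psi> u = j"
proof -
  obtain f where fq: "glue q L c f" "restrict (hol (Uq q) f L) L = \<psi>" "glued q c (L, \<psi>) = glue.KK q L c f"
    using glue_exists[OF assms] by blast
  interpret glue q L c f by (rule fq(1))
  have M: "card (orb L) = M" using p subs_card by (auto simp: U_pairs_def)
  show "glued q c (L, \<psi>) \<in> subs q (c + (q - 1) * M)" using KK_card unfolding fq(3) M .
  show "rooted c (glued q c (L, \<psi>))" unfolding fq(3) by (rule KK_rooted)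
  show "i \<in> {1..<q} \<Longrightarrow> tw i (glued q c (L, \<psi>)) = glued q c (L, \<psi>)" unfolding fq(3) by (rule KK_tw)
  show "fixc gen_y (glued q c (L, \<psi>)) + q = c + (q - 1) * fixc gen_y L" unfolding fq(3) by (rule KK_fix_y)
  show "\<exists>k \<le> (q - 1) * fixc gen_x L. fixc gen_x (glued q c (L, \<psi>)) = (if c = 1 then 1 else 0) + k"
    unfolding fq(3) by (rule KK_fix_x)
  show "j \<in> {1..<q} \<Longrightarrow> jump del (glued q c (L, \<psi>)) u j \<longleftrightarrow> u \<in> L \<and> \<psi> u = j"
    unfolding fq(3) KK_def K.jump_stab using KK_jump[of j u] unfolding holW_def fq(2) .
qed

lemma glued_inj:
  assumes q: "Factorial_Ring.prime q" and c: "c = 1 \<or> c = 2"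
  shows "inj_on (glued q c) (U_pairs q M)"
proof (rule inj_onI)
  fix a a' assume a: "a \<in> U_pairs q M" "a' \<in> U_pairs q M" and e: "glued q c a = glued q c a'"
  obtain L \<psi> L' \<psi>' where aa: "a = (L, \<psi>)" "a' = (L', \<psi>')" by (cases a, cases a')
  have J: "u \<in> L \<and> \<psi> u = j \<longleftrightarrow> u \<in> L' \<and> \<psi>' u = j" if "j \<in> {1..<q}" for u j
    using glued_props(6)[OF q c a(1)[unfolded aa] that, of u] glued_props(6)[OF q c a(2)[unfolded aa] that, of u] e
    unfolding aa by simp
  have cc: "\<psi> \<in> L \<rightarrow>\<^sub>E {1..<q}" "\<psi>' \<in> L' \<rightarrow>\<^sub>E {1..<q}"
    using a unfolding aa by (auto simp: U_pairs_def coc_def)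
  have "u \<in> L \<longleftrightarrow> u \<in> L'" for u
  proof
    assume u: "u \<in> L"
    then have "\<psi> u \<in> {1..<q}" using cc(1) by blast
    from J[OF this] show "u \<in> L'" using u by blast
  next
    assume u: "u \<in> L'"
    then have "\<psi>' u \<in> {1..<q}" using cc(2) by blast
    from J[OF this] show "u \<in> L" using u by blast
  qed
  then have LL: "L' = L" by blast
  have "\<psi> = \<psi>'"
  proof (rule extensionalityI[of _ L])
    fix u assume u: "u \<in> L"
    then have "\<psi> u \<in> {1..<q}" using cc(1) by blast
    from J[OF this, of u] show "\<psi> u = \<psi>' u" using u by simp
  qed (use cc LL in \<open>auto simp: PiE_def\<close>)
  then show "a = a'" unfolding aa LL by simp
qed

lemma glued_surj:
  assumes q: "Factorial_Ring.prime q" and c: "c = 1 \<or> c = 2"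
    and W: "W \<in> subs q N" "rooted c W" "\<And>i. i \<in> {1..<q} \<Longrightarrow> tw i W = W"
  shows "\<exists>M. N = c + (q - 1) * M \<and> W \<in> glued q c ` U_pairs q M"
proof -
  have q0: "q > 0" using prime_gt_0_nat[OF q] .
  have st: "stab del W = W" by (rule subs_stab[OF W(1)])
  interpret tw_fixed q "orb W" del W c
    by (intro tw_fixed.intro subs_pmodel[OF W(1) q0] tw_fixed_axioms.intro q) (use W(2,3) st in simp_all)
  have p: "(LL, psi) \<in> U_pairs q (card (orb LL))"
    using LL_wsub LL_finite LL_y psi_coc by (simp add: U_pairs_def subs_def)
  obtain f where f: "glue q LL c f" "glued q c (LL, psi) = glue.KK q LL c f"
    using glue_exists[OF q c p] by blast
  interpret g: glue q LL c f by (rule f(1))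
  have "stab (gl q c LL f) (Inl 0) = stab del W"
  proof (rule tw_fixed_determined[OF g.KK_tw_fixed tw_fixed_axioms])
    fix u j assume j: "j \<in> {1..<q}"
    have "jump (gl q c LL f) (Inl 0) u j \<longleftrightarrow> u \<in> LL \<and> psi u = j"
      using glued_props(6)[OF q c p j, of u] unfolding f(2) g.KK_def g.K.jump_stab .
    also have "\<dots> \<longleftrightarrow> jump del W u j" using psi(2) psi_eq j by auto
    finally show "jump (gl q c LL f) (Inl 0) u j \<longleftrightarrow> jump del W u j" .
  qed
  then have e: "glued q c (LL, psi) = W" unfolding f(2) g.KK_def st .
  have "W \<in> subs q (c + (q - 1) * card (orb LL))" using glued_props(1)[OF q c p] unfolding e .
  then have "N = c + (q - 1) * card (orb LL)" using W(1) by (simp add: subs_def)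
  then show ?thesis using p e by blast
qed

lemma tw_subs:
  assumes W: "W \<in> subs q N" and q: "q > 0" and k: "coprime k q"
  shows "tw k W \<in> subs q N" "fixc s (tw k W) = fixc s W" "rooted c W \<Longrightarrow> rooted c (tw k W)"
    "coprime l q \<Longrightarrow> tw l (tw k W) = tw (k * l) W" "k mod q = l mod q \<Longrightarrow> tw k W = tw l W" "tw 1 W = W"
proof -
  interpret pmodel q "orb W" del W using W q by (rule subs_pmodel)
  have st: "stab del W = W" by (rule subs_stab[OF W])
  interpret k: pmodel q "orb W" "twd k del W" W by (rule twd_pmodel[OF k])
  show "tw k W \<in> subs q N" using k.stab_in_subs subs_card[OF W] by (simp add: tw_def)
  show "fixc s (tw k W) = fixc s W" using tw_fixc[OF k] unfolding st .
  show "rooted c W \<Longrightarrow> rooted c (tw k W)" using rooted_tw[OF k] unfolding st .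
  show "coprime l q \<Longrightarrow> tw l (tw k W) = tw (k * l) W" using stab_twd_twd[OF k] unfolding st .
  show "k mod q = l mod q \<Longrightarrow> tw k W = tw l W" using tw_mod[OF k] unfolding st .
  show "tw 1 W = W" using tw_1 unfolding st .
qed

text \<open>For a Fermat prime the unit group is a cyclic 2-group, so the parity of a number of rooted subgroups is that
of the number of twist-invariant ones, which are the glued ones.\<close>

lemma twist_parity:
  assumes q: "Factorial_Ring.prime q" "q - 1 = 2 ^ k" and c: "c = 1 \<or> c = 2"
  shows "odd (card {W \<in> subs q N. rooted c W \<and> P (fixc gen_x W) (fixc gen_y W)}) \<longleftrightarrow>
    (\<exists>M. N = c + (q - 1) * M \<and>
      odd (card {a \<in> U_pairs q M. P (fixc gen_x (glued q c a)) (fixc gen_y (glued q c a))}))"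
proof -
  have q0: "q > 0" and q1: "q > 1" using prime_gt_0_nat[OF q(1)] prime_gt_1_nat[OF q(1)] .
  let ?P = "\<lambda>W. P (fixc gen_x W) (fixc gen_y W)"
  let ?S = "{W \<in> subs q N. rooted c W \<and> ?P W}"
  \<comment> \<open>A primitive root modulo \<open>q\<close>: the twist by \<open>g\<close> generates the action.\<close>
  obtain g where g: "g \<in> {1..q - 1}" "{1..q - 1} = {g ^ i mod q |i. i \<in> UNIV}"
    using residue_prime_mult_group_has_gen[OF q(1)] by blast
  have gu: "g \<in> {1..<q}" using g(1) q1 by auto
  have cg: "coprime g q" by (rule unit_coprime[OF q(1) gu])
  have cgn: "coprime (g ^ n) q" for n using cg by simp
  have pow: "(tw g ^^ n) W = tw (g ^ n) W" if W: "W \<in> subs q N" for n W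
  proof (induction n)
    case 0
    show ?case using tw_subs(6)[OF W q0 cg] by simp
  next
    case (Suc n)
    then show ?case using tw_subs(4)[OF W q0 cgn cg, of n] by (simp add: mult.commute)
  qed
  have "\<not> q dvd g" using gu by (intro nat_dvd_not_less) auto
  then have "[g ^ (q - 1) = 1] (mod q)" by (rule fermat_theorem[OF q(1)])
  then have g1: "g ^ (2 ^ k) mod q = 1 mod q" unfolding q(2) cong_def .
  have fS: "finite ?S" using finite_subs[OF q0] by simp
  have "odd (card ?S) \<longleftrightarrow> odd (card {W \<in> ?S. tw g W = W})"
  proof (rule two_power_orbit_parity[where k = k, OF fS])
    fix W assume W: "W \<in> ?S"
    then have W1: "W \<in> subs q N" by simp
    show "tw g W \<in> ?S" using W tw_subs(1,2,3)[OF W1 q0 cg] by simp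
    show "(tw g ^^ 2 ^ k) W = W"
      unfolding pow[OF W1] using tw_subs(5)[OF W1 q0 cgn g1] tw_subs(6)[OF W1 q0 cg] by simp
  qed
  also have "{W \<in> ?S. tw g W = W} = {W \<in> ?S. \<forall>i\<in>{1..<q}. tw i W = W}"
  proof (intro equalityI subsetI)
    fix W assume W: "W \<in> {W \<in> ?S. tw g W = W}"
    then have W1: "W \<in> subs q N" and fx: "tw g W = W" by simp_all
    have "tw i W = W" if i: "i \<in> {1..<q}" for i
    proof -
      have "i \<in> {1..q - 1}" using i by auto
      then obtain n where n: "i = g ^ n mod q" unfolding g(2) by blast
      have "tw (g ^ n) W = W" unfolding pow[OF W1, symmetric] using fx by (induction n) simp_all
      moreover have "tw (g ^ n) W = tw i W" by (rule tw_subs(5)[OF W1 q0 cgn]) (simp add: n)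
      ultimately show ?thesis by simp
    qed
    then show "W \<in> {W \<in> ?S. \<forall>i\<in>{1..<q}. tw i W = W}" using W by blast
  next
    fix W assume "W \<in> {W \<in> ?S. \<forall>i\<in>{1..<q}. tw i W = W}"
    then show "W \<in> {W \<in> ?S. tw g W = W}" using gu by blast
  qed
  finally have 1: "odd (card ?S) \<longleftrightarrow> odd (card {W \<in> ?S. \<forall>i\<in>{1..<q}. tw i W = W})" .
  let ?F = "{W \<in> ?S. \<forall>i\<in>{1..<q}. tw i W = W}"
  show ?thesis
  proof (cases "\<exists>M. N = c + (q - 1) * M")
    case True
    then obtain M where M: "N = c + (q - 1) * M" by blast
    let ?U = "{a \<in> U_pairs q M. ?P (glued q c a)}"
    have uniq: "M' = M" if "N = c + (q - 1) * M'" for M' using M that q1 by simp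
    have FU: "?F = glued q c ` ?U"
    proof (intro equalityI subsetI)
      fix W assume W: "W \<in> ?F"
      then obtain M' where M': "N = c + (q - 1) * M'" "W \<in> glued q c ` U_pairs q M'"
        using glued_surj[OF q(1) c, of W N] by blast
      then show "W \<in> glued q c ` ?U" using W uniq[OF M'(1)] by blast
    next
      fix W assume "W \<in> glued q c ` ?U"
      then obtain L \<psi> where a: "(L, \<psi>) \<in> U_pairs q M" "W = glued q c (L, \<psi>)" "?P W" by auto
      then show "W \<in> ?F" using glued_props(1-3)[OF q(1) c a(1)] unfolding M by blast
    qed
    have I: "inj_on (glued q c) ?U" using glued_inj[OF q(1) c] by (rule inj_on_subset) blast
    have cFU: "card ?F = card ?U" unfolding FU by (rule card_image[OF I])
    have "(\<exists>M'. N = c + (q - 1) * M' \<and> Q M') \<longleftrightarrow> Q M" for Q using M uniq by blast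
    then show ?thesis unfolding 1 cFU by (rule HOL.sym)
  next
    case False
    have "?F = {}"
    proof (rule ccontr)
      assume "?F \<noteq> {}"
      then obtain W where "W \<in> ?F" by blast
      then show False using glued_surj[OF q(1) c, of W N] False by blast
    qed
    then have cF0: "card ?F = 0" by (simp only: card.empty)
    show ?thesis unfolding 1 cF0 using False by blast
  qed
qed

lemma odd_sum_card:
  assumes "finite A"
  shows "odd (\<Sum>a\<in>A. f a :: nat) \<longleftrightarrow> odd (card {a \<in> A. odd (f a)})"
  using assms
proof (induction A rule: finite_induct)
  case (insert a A)
  have "{b \<in> insert a A. odd (f b)} = (if odd (f a) then insert a {b \<in> A. odd (f b)} else {b \<in> A. odd (f b)})"
    by auto
  then show ?case using insert by auto
qed simp

text \<open>The unit group has even order, two square roots of 1 and one \<open>q\<close>-th root of 1, so the number of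
homomorphisms is odd only if neither factors of order 2 nor free factors occur.\<close>

lemma card_coc_Uq:
  assumes q: "Factorial_Ring.prime q" "odd q" and L: "L \<in> subs q M"
  shows "odd (card (coc q (Uq q) 1 L)) \<longleftrightarrow> fixc gen_x L = 0 \<and> rk q L = 0"
    "finite (coc q (Uq q) 1 L)"
proof -
  interpret wcover "Uq q" 1 q L by (rule wcover_Uq[OF q(1) L])
  have q1: "q > 1" using prime_gt_1_nat[OF q(1)] .
  show "finite (coc q (Uq q) 1 L)" by (rule finite_coc)
  have "{a \<in> carrier (Uq q). a [^]\<^bsub>Uq q\<^esub> q = 1} = {1}"
    using coprime_root_trivial[OF _ fin coprime_order_Uq[OF q(1)]] one_closed nat_pow_one[of q] by auto
  then have rq: "roots q = 1" unfolding roots_def by simp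
  have sq: "a [^]\<^bsub>Uq q\<^esub> (2::nat) = a * a mod q" for a
    by (simp add: numeral_2_eq_2 mod_mult_left_eq)
  \<comment> \<open>The square roots of 1 come in pairs \<open>a\<close>, \<open>q - a\<close>.\<close>
  have ex: "\<exists>k. card {a \<in> carrier (Uq q). a [^]\<^bsub>Uq q\<^esub> (2::nat) = 1}
      = card {a \<in> {a \<in> carrier (Uq q). a [^]\<^bsub>Uq q\<^esub> (2::nat) = 1}. q - a = a} + 2 * k"
  proof (rule involution_card)
    show "finite {a \<in> carrier (Uq q). a [^]\<^bsub>Uq q\<^esub> (2::nat) = 1}" by simp
    fix a assume a: "a \<in> {a \<in> carrier (Uq q). a [^]\<^bsub>Uq q\<^esub> (2::nat) = 1}"
    then have a1: "1 \<le> a" "a < q" "a * a mod q = 1" by (simp_all add: sq)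
    show "q - (q - a) = a" using a1 by simp
    have "int ((q - a) * (q - a)) = int (a * a) + int q * (int q - 2 * int a)"
    proof -
      have "int (q - a) = int q - int a" using a1 by simp
      then show ?thesis unfolding of_nat_mult by (simp add: algebra_simps)
    qed
    then have "int ((q - a) * (q - a)) mod int q = int (a * a) mod int q" by (simp only: mod_mult_self2)
    then have "(q - a) * (q - a) mod q = 1" using a1(3) by (metis of_nat_mod of_nat_eq_iff of_nat_1)
    then show "q - a \<in> {a \<in> carrier (Uq q). a [^]\<^bsub>Uq q\<^esub> (2::nat) = 1}"
      using a1 by (auto simp: sq)
  qed
  have emp: "{a \<in> {a \<in> carrier (Uq q). a [^]\<^bsub>Uq q\<^esub> (2::nat) = 1}. q - a = a} = {}"
  proof -
    have "q - a \<noteq> a" if "a < q" for a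
    proof
      assume "q - a = a"
      then have "q = 2 * a" using that by simp
      then show False using q(2) by simp
    qed
    then show ?thesis by auto
  qed
  obtain k where k: "card {a \<in> carrier (Uq q). a [^]\<^bsub>Uq q\<^esub> (2::nat) = 1}
      = card {a \<in> {a \<in> carrier (Uq q). a [^]\<^bsub>Uq q\<^esub> (2::nat) = 1}. q - a = a} + 2 * k"
    using ex by blast
  have r2: "even (roots 2)" unfolding roots_def k emp by simp
  have "even (card (carrier (Uq q)))" using q(2) q1 by simp
  then show "odd (card (coc q (Uq q) 1 L)) \<longleftrightarrow> fixc gen_x L = 0 \<and> rk q L = 0"
    unfolding card_coc(1)[OF q(1)] rq using r2 by auto
qed

lemma card_coc_Z2:
  assumes q: "Factorial_Ring.prime q" "odd q" and L: "L \<in> subs q M" "[gen_x] \<in> L"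
  shows "odd (card {\<psi> \<in> coc q Z2 0 L. \<psi> [gen_x] = 1}) \<longleftrightarrow> fixc gen_x L = 1 \<and> rk q L = 0"
    "finite (coc q Z2 0 L)" "fixc gen_x L \<ge> 1"
proof -
  have q0: "q > 0" using prime_gt_0_nat[OF q(1)] .
  interpret wcover Z2 0 q L by (rule wcover_Z2[OF L(1) q0])
  show "finite (coc q Z2 0 L)" by (rule finite_coc)
  have "order Z2 = 2" by (simp add: order_def Z2_simps)
  then have cop: "coprime q (order Z2)" using q(2) by simp
  have "{a \<in> carrier Z2. a [^]\<^bsub>Z2\<^esub> q = 0} = {0}"
    using coprime_root_trivial[OF _ fin cop] one_closed nat_pow_one[of q] by auto
  then have rq: "roots q = 1" unfolding roots_def by simp
  have sq: "a [^]\<^bsub>Z2\<^esub> (2::nat) = 0" if "a \<in> carrier Z2" for a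
    using that by (auto simp: numeral_2_eq_2 Z2_simps)
  have "{a \<in> carrier Z2. a [^]\<^bsub>Z2\<^esub> (2::nat) = 0} = carrier Z2" using sq by blast
  then have r2: "roots 2 = 2" unfolding roots_def by (simp add: Z2_simps)
  have c2: "card (carrier Z2) = 2" by (simp add: Z2_simps)
  have one: "1 \<in> carrier Z2" by (simp add: Z2_simps)
  have "L \<in> {V \<in> orb L. del gen_x V = V}" using L(2) orb_self by (simp add: mem_W)
  then show a1: "fixc gen_x L \<ge> 1" unfolding fixc_def using finW by (auto simp: Suc_le_eq card_gt_0_iff)
  show "odd (card {\<psi> \<in> coc q Z2 0 L. \<psi> [gen_x] = 1}) \<longleftrightarrow> fixc gen_x L = 1 \<and> rk q L = 0"
    unfolding card_coc(2)[OF q(1) L(2) one sq[OF one]] rq r2 c2 using a1 by auto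
qed

lemma U_pairs_parity:
  assumes q: "Factorial_Ring.prime q" "odd q"
  shows "odd (card {a \<in> U_pairs q M. R (fst a)}) \<longleftrightarrow>
    odd (card {L \<in> subs q M. [gen_y] \<in> L \<and> fixc gen_x L = 0 \<and> rk q L = 0 \<and> R L})"
proof -
  let ?A = "{L \<in> subs q M. [gen_y] \<in> L \<and> R L}"
  have fA: "finite ?A" using finite_subs[of q M] prime_gt_0_nat[OF q(1)] by simp
  have fC: "\<forall>L\<in>?A. finite (coc q (Uq q) 1 L)" using card_coc_Uq(2)[OF q] by blast
  have "{a \<in> U_pairs q M. R (fst a)} = Sigma ?A (\<lambda>L. coc q (Uq q) 1 L)" by (auto simp: U_pairs_def)
  then have "card {a \<in> U_pairs q M. R (fst a)} = (\<Sum>L\<in>?A. card (coc q (Uq q) 1 L))"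
    by (simp only: card_SigmaI[OF fA fC])
  then have "odd (card {a \<in> U_pairs q M. R (fst a)}) \<longleftrightarrow> odd (card {L \<in> ?A. odd (card (coc q (Uq q) 1 L))})"
    by (simp only: odd_sum_card[OF fA])
  also have "{L \<in> ?A. odd (card (coc q (Uq q) 1 L))}
      = {L \<in> subs q M. [gen_y] \<in> L \<and> fixc gen_x L = 0 \<and> rk q L = 0 \<and> R L}"
    using card_coc_Uq(1)[OF q] by blast
  finally show ?thesis .
qed

lemma Z2_pairs_parity:
  assumes q: "Factorial_Ring.prime q" "odd q"
  shows "odd (card {a \<in> Z2_pairs q M. R (fst a)}) \<longleftrightarrow>
    odd (card {L \<in> subs q M. [gen_x] \<in> L \<and> fixc gen_x L = 1 \<and> rk q L = 0 \<and> R L})"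
proof -
  let ?A = "{L \<in> subs q M. [gen_x] \<in> L \<and> R L}"
  let ?C = "\<lambda>L. {\<psi> \<in> coc q Z2 0 L. \<psi> [gen_x] = 1}"
  have fA: "finite ?A" using finite_subs[of q M] prime_gt_0_nat[OF q(1)] by simp
  have fC: "\<forall>L\<in>?A. finite (?C L)" using card_coc_Z2(2)[OF q, of _ M] by simp
  have "{a \<in> Z2_pairs q M. R (fst a)} = Sigma ?A ?C" by (auto simp: Z2_pairs_def)
  then have "card {a \<in> Z2_pairs q M. R (fst a)} = (\<Sum>L\<in>?A. card (?C L))"
    by (simp only: card_SigmaI[OF fA fC])
  then have "odd (card {a \<in> Z2_pairs q M. R (fst a)}) \<longleftrightarrow> odd (card {L \<in> ?A. odd (card (?C L))})"
    by (simp only: odd_sum_card[OF fA])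
  also have "{L \<in> ?A. odd (card (?C L))}
      = {L \<in> subs q M. [gen_x] \<in> L \<and> fixc gen_x L = 1 \<and> rk q L = 0 \<and> R L}"
    using card_coc_Z2(1)[OF q] by blast
  finally show ?thesis .
qed

section \<open>Indices with an odd number of subgroups\<close>

text \<open>The free rank as a function of the index and of the numbers of cosets fixed by the two generators.\<close>

definition rkf :: "nat \<Rightarrow> nat \<Rightarrow> nat \<Rightarrow> nat \<Rightarrow> nat" where
  "rkf q N a b = (N - a) div 2 + (q - 1) * ((N - b) div q) - (N - 1)"

lemma rk_rkf: "W \<in> subs q N \<Longrightarrow> rk q W = rkf q N (fixc gen_x W) (fixc gen_y W)"
  by (simp add: rk_def rkf_def subs_card)

lemma rk_subs:
  assumes q: "Factorial_Ring.prime q" and W: "W \<in> subs q N"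
  shows "2 * int q * int (rk q W) = (int q - 2) * int N + 2 * int q
    - int q * int (fixc gen_x W) - 2 * (int q - 1) * int (fixc gen_y W)"
proof -
  interpret wcover Z2 0 q W by (rule wcover_Z2[OF W prime_gt_0_nat[OF q]])
  show ?thesis using rk_int[OF q] unfolding subs_card[OF W] .
qed

lemma glued_rank_identity:
  fixes Q :: int
  assumes A: "2 * Q * g = (Q - 2) * (c + (Q - 1) * M) + 2 * Q - Q * (2 - c + k) - 2 * (Q - 1) * (c + (Q - 1) * b - Q)"
    and B: "2 * Q * r = (Q - 2) * M + 2 * Q - Q * a - 2 * (Q - 1) * b"
  shows "Q * (2 * g) = Q * ((Q - 1) * (2 * r + a) - k)"
proof -
  have "Q * (2 * g) - Q * ((Q - 1) * (2 * r + a) - k)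
    = (2 * Q * g - ((Q - 2) * (c + (Q - 1) * M) + 2 * Q - Q * (2 - c + k) - 2 * (Q - 1) * (c + (Q - 1) * b - Q)))
      - (Q - 1) * (2 * Q * r - ((Q - 2) * M + 2 * Q - Q * a - 2 * (Q - 1) * b))"
    by (simp add: algebra_simps)
  then show ?thesis unfolding A B by simp
qed

lemma ker2_rank_identity:
  fixes Q :: int
  assumes A: "2 * Q * g = (Q - 2) * (2 * M) + 2 * Q - Q * x - 2 * (Q - 1) * (2 * b)"
    and B: "2 * Q * r = (Q - 2) * M + 2 * Q - Q * a - 2 * (Q - 1) * b"
  shows "Q * (2 * g) = Q * (4 * r - 2 - x + 2 * a)"
proof -
  have "Q * (2 * g) - Q * (4 * r - 2 - x + 2 * a)
    = (2 * Q * g - ((Q - 2) * (2 * M) + 2 * Q - Q * x - 2 * (Q - 1) * (2 * b)))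
      - 2 * (2 * Q * r - ((Q - 2) * M + 2 * Q - Q * a - 2 * (Q - 1) * b))"
    by (simp add: algebra_simps)
  then show ?thesis unfolding A B by simp
qed

text \<open>A glued subgroup has free rank 0 and no coset fixed by \<open>x\<close> other than, for \<open>c = 1\<close>, the trivial one, if and
only if \<open>L\<close> is of the type \<open>a = r = 0\<close>, that is, a free product of groups of order \<open>q\<close>.\<close>

lemma glued_type:
  assumes q: "Factorial_Ring.prime q" and c: "c = 1 \<or> c = 2" and p: "(L, \<psi>) \<in> U_pairs q M"
  shows "fixc gen_x (glued q c (L, \<psi>)) = (if c = 1 then 1 else 0) \<and> rk q (glued q c (L, \<psi>)) = 0
    \<longleftrightarrow> fixc gen_x L = 0 \<and> rk q L = 0"
proof -
  let ?G = "glued q c (L, \<psi>)"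
  have q1: "q > 1" by (rule prime_gt_1_nat[OF q])
  have L: "L \<in> subs q M" using p by (simp add: U_pairs_def)
  obtain k where k: "k \<le> (q - 1) * fixc gen_x L" "fixc gen_x ?G = (if c = 1 then 1 else 0) + k"
    using glued_props(5)[OF q c p] by blast
  have a: "int (fixc gen_x ?G) = 2 - int c + int k" using k(2) c by auto
  have "int (fixc gen_y ?G) + int q = int c + (int q - 1) * int (fixc gen_y L)"
    using arg_cong[OF glued_props(4)[OF q c p], of int] q1 by (simp add: of_nat_diff)
  then have b: "int (fixc gen_y ?G) = int c + (int q - 1) * int (fixc gen_y L) - int q" by simp
  have N: "int (c + (q - 1) * M) = int c + (int q - 1) * int M" using q1 by (simp add: of_nat_diff)
  have "int q * (2 * int (rk q ?G)) = int q * ((int q - 1) * (2 * int (rk q L) + int (fixc gen_x L)) - int k)"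
    using rk_subs[OF q glued_props(1)[OF q c p], unfolded a b N] rk_subs[OF q L] by (rule glued_rank_identity)
  then have e: "2 * int (rk q ?G) = (int q - 1) * (2 * int (rk q L) + int (fixc gen_x L)) - int k"
    using q1 by simp
  show ?thesis
  proof
    assume "fixc gen_x L = 0 \<and> rk q L = 0"
    then show "fixc gen_x ?G = (if c = 1 then 1 else 0) \<and> rk q ?G = 0" using e k by simp
  next
    assume *: "fixc gen_x ?G = (if c = 1 then 1 else 0) \<and> rk q ?G = 0"
    then have "k = 0" using k(2) by simp
    then have "(int q - 1) * (2 * int (rk q L) + int (fixc gen_x L)) = 0" using e * by simp
    then show "fixc gen_x L = 0 \<and> rk q L = 0" using q1 by auto
  qed
qed

lemma ker2_type:
  assumes q: "Factorial_Ring.prime q" "odd q" and p: "(L, \<psi>) \<in> Z2_pairs q M"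
  shows "fixc gen_x (ker2 (L, \<psi>)) = 0 \<and> rk q (ker2 (L, \<psi>)) = 0 \<longleftrightarrow> fixc gen_x L = 1 \<and> rk q L = 0"
proof -
  let ?G = "ker2 (L, \<psi>)"
  have q1: "q > 1" by (rule prime_gt_1_nat[OF q(1)])
  have L: "L \<in> subs q M" using p by (simp add: Z2_pairs_def)
  note G = ker2_props[OF p q]
  have b: "int (fixc gen_y ?G) = 2 * int (fixc gen_y L)" using G(4) by simp
  have N: "int (2 * M) = 2 * int M" by simp
  have "int q * (2 * int (rk q ?G)) = int q * (4 * int (rk q L) - 2 - int (fixc gen_x ?G) + 2 * int (fixc gen_x L))"
    using rk_subs[OF q(1) G(1), unfolded b N] rk_subs[OF q(1) L] by (rule ker2_rank_identity)
  then have e: "2 * int (rk q ?G) = 4 * int (rk q L) - 2 - int (fixc gen_x ?G) + 2 * int (fixc gen_x L)"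
    using q1 by simp
  show ?thesis using e G(5) by presburger
qed

text \<open>The normal subgroup of index 2 that contains \<open>y\<close>: the words with an even number of letters \<open>x\<close>.\<close>

definition even_words :: "xy list set" where
  "even_words = stab (\<lambda>s b. if s = gen_x then \<not> b else b) False"

lemma even_words_pmodel: assumes "q > 0" shows "pmodel q UNIV (\<lambda>s b. if s = gen_x then \<not> b else b) False"
proof (intro pmodel.intro)
  fix p :: bool and s
  have "((\<lambda>b. b) ^^ n) p = p" for n by (induction n) simp_all
  then show "((\<lambda>b. if s = gen_x then \<not> b else b) ^^ ordr q s) p = p"
    by (cases s) (simp_all add: numeral_2_eq_2)
  show "\<exists>w. fold (\<lambda>s b. if s = gen_x then \<not> b else b) w False = p"
    by (cases p) (auto intro: exI[of _ "[gen_x]"] exI[of _ "[]"])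
qed (use assms in auto)

lemma even_words_props:
  assumes q: "Factorial_Ring.prime q"
  shows "even_words \<in> subs q 2" "[gen_y] \<in> even_words" "[gen_x, gen_y, gen_x] \<in> even_words"
    "fixc gen_x even_words = 0" "rk q even_words = 0"
proof -
  have q0: "q > 0" by (rule prime_gt_0_nat[OF q])
  interpret pmodel q UNIV "\<lambda>s b. if s = gen_x then \<not> b else b" False by (rule even_words_pmodel[OF q0])
  show s: "even_words \<in> subs q 2" using stab_in_subs by (simp add: even_words_def card_UNIV_bool)
  show "[gen_y] \<in> even_words" "[gen_x, gen_y, gen_x] \<in> even_words" by (simp_all add: even_words_def stab_def)
  show x: "fixc gen_x even_words = 0" unfolding even_words_def fixc_stab by simp
  have "fixc gen_y even_words = 2" unfolding even_words_def fixc_stab by (simp add: card_UNIV_bool)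
  then have "2 * int q * int (rk q even_words) = 0" using rk_subs[OF q s] x by (simp add: algebra_simps)
  then show "rk q even_words = 0" using q0 by simp
qed

text \<open>The two degenerate cases of the recursion, in which \<open>y\<close> fixes the trivial coset, are \<open>even_words\<close> and the
full group (\<open>UNIV_unique\<close>).\<close>

lemma even_words_unique:
  assumes W: "W \<in> subs q N" and q: "q > 0" and y: "[gen_y] \<in> W" "[gen_x, gen_y, gen_x] \<in> W" and x: "[gen_x] \<notin> W"
  shows "W = even_words"
proof -
  interpret pmodel q "orb W" del W using W q by (rule subs_pmodel)
  have st: "stab del W = W" by (rule subs_stab[OF W])
  have mem: "w \<in> W \<longleftrightarrow> fold del w W = W" for w using W by (intro mem_wsub_iff[of q]) (simp add: subs_def)
  let ?X = "del gen_x W"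
  have yW: "del gen_y W = W" using y(1) unfolding mem by simp
  have "del gen_x (del gen_y ?X) = W" using y(2) unfolding mem by simp
  then have yX: "del gen_y ?X = ?X" using xx[OF closed[OF closed[OF eD]], of gen_y gen_x] by simp
  have XW: "?X \<noteq> W" using x unfolding mem by simp
  have "fold del w W = W \<or> fold del w W = ?X" for w
  proof (induction w rule: rev_induct)
    case (snoc s w)
    then show ?case using yW yX xx[OF eD] by (cases s) auto
  qed simp
  then have orbW: "p = W \<or> p = ?X" if "p \<in> orb W" for p using that unfolding orb_def by blast
  define \<phi> where "\<phi> p \<longleftrightarrow> p \<noteq> W" for p :: "xy list set"
  have "stab del W = stab (\<lambda>s b. if s = gen_x then \<not> b else b) False"
  proof (rule pmodel_iso_stab[OF pmodel_axioms])
    show "inj_on \<phi> (orb W)" using orbW by (intro inj_onI) (metis \<phi>_def)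
    show "\<phi> W = False" by (simp add: \<phi>_def)
    fix s p assume "p \<in> orb W"
    then consider "p = W" | "p = ?X" using orbW by blast
    then show "\<phi> (del s p) = (if s = gen_x then \<not> \<phi> p else \<phi> p)"
    proof cases
      case 1
      then show ?thesis using XW yW by (cases s) (simp_all add: \<phi>_def)
    next
      case 2
      then show ?thesis using XW yX xx[OF eD] by (cases s) (simp_all add: \<phi>_def)
    qed
  qed
  then show ?thesis unfolding st even_words_def .
qed

lemma UNIV_props:
  assumes q: "Factorial_Ring.prime q"
  shows "UNIV \<in> subs q 1" "fixc s UNIV = 1" "rk q UNIV = 0"
proof -
  have o: "orb UNIV = {UNIV}" by (auto simp: orb_def fold_del)
  show s: "UNIV \<in> subs q 1" by (simp add: subs_def wsub_def o)
  have f: "fixc s UNIV = 1" for s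
  proof -
    have "{V \<in> orb UNIV. del s V = V} = {UNIV}" unfolding o by (auto simp: del_def)
    then show ?thesis by (simp add: fixc_def)
  qed
  then show "fixc s UNIV = 1" .
  have "2 * int q * int (rk q UNIV) = 0" using rk_subs[OF q s] by (simp add: f algebra_simps)
  then show "rk q UNIV = 0" using prime_gt_0_nat[OF q] by simp
qed

lemma UNIV_unique:
  assumes W: "W \<in> subs q N" and q: "q > 0" and xy: "[gen_x] \<in> W" "[gen_y] \<in> W"
  shows "W = UNIV"
proof -
  have "wsub q W" using W by (simp add: subs_def)
  note w = wsubD(1,2)[OF this]
  have "u \<in> W" for u
  proof (induction u)
    case (Cons s u)
    have "[s] \<in> W" using xy by (cases s) auto
    from w(2)[OF this, of u] show ?case using Cons by simp
  qed (rule w(1))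
  then show ?thesis by blast
qed

text \<open>The indices \<open>1, 2 q - 1, \<dots>\<close> of the theorem; \<open>lam_closed_form\<close> gives the closed formula, where \<open>lam q s\<close>
belongs to the exponent \<open>s + 1\<close>.\<close>

fun lam :: "nat \<Rightarrow> nat \<Rightarrow> nat" where
  "lam q 0 = 1"
| "lam q (Suc n) = (q - 1) * lam q n + q"

lemma lam_odd: "odd q \<Longrightarrow> odd (lam q n)"
  by (induction n) simp_all

text \<open>The number of subgroups of index \<open>M\<close> that contain \<open>y\<close> and, by their type \<open>a = r = 0\<close>, are free products of
groups of order \<open>q\<close>.\<close>

definition vY :: "nat \<Rightarrow> nat \<Rightarrow> nat" where
  "vY q M = card {L \<in> subs q M. [gen_y] \<in> L \<and> fixc gen_x L = 0 \<and> rk q L = 0}"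

lemma fixc_pos:
  assumes W: "W \<in> subs q N" and s: "[s] \<in> W"
  shows "fixc s W \<ge> 1"
proof -
  have "del s W = W" using mem_wsub_iff[of q W "[s]"] W s by (simp add: subs_def)
  then have "W \<in> {V \<in> orb W. del s V = V}" using orb_self by simp
  then show ?thesis unfolding fixc_def using W by (auto simp: subs_def Suc_le_eq card_gt_0_iff)
qed

text \<open>The twist and the counting of homomorphisms to the unit group combined: a condition \<open>P\<close> on rooted subgroups
becomes a condition \<open>R\<close> on free products of groups of order \<open>q\<close> of smaller index.\<close>

lemma rooted_parity:
  assumes q: "Factorial_Ring.prime q" "odd q" "q - 1 = 2 ^ k" and c: "c = 1 \<or> c = 2"
    and P: "\<And>L \<psi> M. (L, \<psi>) \<in> U_pairs q M \<Longrightarrow> c + (q - 1) * M = N \<Longrightarrow>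
       P (fixc gen_x (glued q c (L, \<psi>))) (fixc gen_y (glued q c (L, \<psi>))) \<longleftrightarrow> R L"
  shows "odd (card {W \<in> subs q N. rooted c W \<and> P (fixc gen_x W) (fixc gen_y W)}) \<longleftrightarrow>
    (\<exists>M. N = c + (q - 1) * M \<and> odd (card {L \<in> subs q M. [gen_y] \<in> L \<and> fixc gen_x L = 0 \<and> rk q L = 0 \<and> R L}))"
proof -
  have *: "{a \<in> U_pairs q M. P (fixc gen_x (glued q c a)) (fixc gen_y (glued q c a))} = {a \<in> U_pairs q M. R (fst a)}"
    if "N = c + (q - 1) * M" for M
    using P[OF _ that[symmetric]] by auto
  have "N = c + (q - 1) * M \<and> odd (card {a \<in> U_pairs q M. P (fixc gen_x (glued q c a)) (fixc gen_y (glued q c a))})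
    \<longleftrightarrow> N = c + (q - 1) * M \<and> odd (card {a \<in> U_pairs q M. R (fst a)})" for M
    by (rule conj_cong[OF HOL.refl]) (simp only: *)
  then show ?thesis
    unfolding twist_parity[OF q(1,3) c] U_pairs_parity[OF q(1,2), symmetric] by (simp only:)
qed

lemma vY_0: "vY q 0 = 0"
proof -
  have "{L \<in> subs q 0. [gen_y] \<in> L \<and> fixc gen_x L = 0 \<and> rk q L = 0} = {}"
    using subs_pos[of _ q 0] by blast
  then show ?thesis unfolding vY_def by (simp only: card.empty)
qed

text \<open>Conjugation by \<open>x\<close> replaces the condition \<open>y \<in> L\<close> by \<open>x y x \<in> L\<close>. The subgroups with the latter property
are rooted with \<open>c = 2\<close>, except \<open>even_words\<close>.\<close>

lemma vY_step:
  assumes q: "Factorial_Ring.prime q" "odd q" "q - 1 = 2 ^ k"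
  shows "odd (vY q N) \<longleftrightarrow> N = 2 \<or> (\<exists>M. N = 2 + (q - 1) * M \<and> odd (vY q M))"
proof -
  have q0: "q > 0" by (rule prime_gt_0_nat[OF q(1)])
  let ?A = "{L \<in> subs q N. [gen_y] \<in> L \<and> fixc gen_x L = 0 \<and> rk q L = 0}"
  let ?B = "{W \<in> subs q N. [gen_x, gen_y, gen_x] \<in> W \<and> fixc gen_x W = 0 \<and> rk q W = 0}"
  let ?C = "{W \<in> subs q N. rooted 2 W \<and> fixc gen_x W = 0 \<and> rkf q N (fixc gen_x W) (fixc gen_y W) = 0}"
  let ?E = "if N = 2 then {even_words} else {}"
  have rkcj: "rk q (cj W) = rk q W" if "W \<in> subs q N" for W
    using rk_rkf[OF that] rk_rkf[OF cj_props(1)[OF that q0]] cj_props(3)[OF that q0] by simp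
  have "bij_betw cj ?A ?B"
  proof (rule bij_betw_byWitness[where f' = cj])
    show "\<forall>W\<in>?A. cj (cj W) = W" "\<forall>W\<in>?B. cj (cj W) = W" using cj_props(2)[OF _ q0] by blast+
    show "cj ` ?A \<subseteq> ?B"
    proof (rule image_subsetI)
      fix W assume "W \<in> ?A"
      then have W: "W \<in> subs q N" "[gen_y] \<in> W" "fixc gen_x W = 0" "rk q W = 0" by simp_all
      have "[gen_x, gen_y, gen_x] \<in> cj W"
        using cj_props(4)[OF cj_props(1)[OF W(1) q0] q0, of "[gen_y]"] W(2) cj_props(2)[OF W(1) q0] by simp
      then show "cj W \<in> ?B" using W cj_props(1,3)[OF W(1) q0] rkcj[OF W(1)] by simp
    qed
    show "cj ` ?B \<subseteq> ?A"
    proof (rule image_subsetI)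
      fix W assume "W \<in> ?B"
      then have W: "W \<in> subs q N" "[gen_x, gen_y, gen_x] \<in> W" "fixc gen_x W = 0" "rk q W = 0" by simp_all
      have "[gen_y] \<in> cj W" using cj_props(4)[OF W(1) q0, of "[gen_y]"] W(2) by simp
      then show "cj W \<in> ?A" using W cj_props(1,3)[OF W(1) q0] rkcj[OF W(1)] by simp
    qed
  qed
  then have 1: "vY q N = card ?B" unfolding vY_def by (rule bij_betw_same_card)
  have nx: "[gen_x] \<notin> W" if "W \<in> subs q N" "fixc gen_x W = 0" for W using fixc_pos[OF that(1), of gen_x] that(2) by auto
  have "?B = ?E \<union> ?C"
  proof (intro equalityI subsetI)
    fix W assume "W \<in> ?B"
    then have W: "W \<in> subs q N" "[gen_x, gen_y, gen_x] \<in> W" "fixc gen_x W = 0" "rk q W = 0" by simp_all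
    show "W \<in> ?E \<union> ?C"
    proof (cases "[gen_y] \<in> W")
      case True
      have e: "W = even_words" by (rule even_words_unique[OF W(1) q0 True W(2) nx[OF W(1,3)]])
      then have "N = 2" using W(1) even_words_props(1)[OF q(1)] by (auto simp: subs_def)
      then show ?thesis using e by simp
    next
      case False
      then show ?thesis using W nx[OF W(1,3)] rk_rkf[OF W(1)] by (simp add: rooted_def)
    qed
  next
    fix W assume "W \<in> ?E \<union> ?C"
    then consider "N = 2" "W = even_words" | "W \<in> ?C" by (auto split: if_splits)
    then show "W \<in> ?B"
    proof cases
      case 1
      then show ?thesis using even_words_props[OF q(1)] by simp
    next
      case 2
      then have W: "W \<in> subs q N" "rooted 2 W" "fixc gen_x W = 0" "rkf q N (fixc gen_x W) (fixc gen_y W) = 0" by blast+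
      then show ?thesis using rk_rkf[OF W(1)] by (simp add: rooted_def)
    qed
  qed
  moreover have "?E \<inter> ?C = {}" using even_words_props(2)[OF q(1)] by (auto simp: rooted_def)
  ultimately have 2: "card ?B = card ?E + card ?C"
    using card_Un_disjoint[of ?E ?C] finite_subs[OF q0, of N] by simp
  have "odd (card {W \<in> subs q N. rooted 2 W \<and> (\<lambda>a b. a = 0 \<and> rkf q N a b = 0) (fixc gen_x W) (fixc gen_y W)}) \<longleftrightarrow>
    (\<exists>M. N = 2 + (q - 1) * M \<and>
       odd (card {L \<in> subs q M. [gen_y] \<in> L \<and> fixc gen_x L = 0 \<and> rk q L = 0 \<and> (fixc gen_x L = 0 \<and> rk q L = 0)}))"
  proof (rule rooted_parity[OF q])
    fix L \<psi> M assume p: "(L, \<psi>) \<in> U_pairs q M" and N: "2 + (q - 1) * M = N"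
    have 2: "2 = (1::nat) \<or> 2 = (2::nat)" by simp
    show "(\<lambda>a b. a = 0 \<and> rkf q N a b = 0) (fixc gen_x (glued q 2 (L, \<psi>))) (fixc gen_y (glued q 2 (L, \<psi>)))
        \<longleftrightarrow> fixc gen_x L = 0 \<and> rk q L = 0"
      using glued_type[OF q(1) 2 p] rk_rkf[OF glued_props(1)[OF q(1) 2 p]] N by simp
  qed simp
  then have 3: "odd (card ?C) \<longleftrightarrow> (\<exists>M. N = 2 + (q - 1) * M \<and> odd (vY q M))"
    unfolding vY_def by (simp add: conj_ac cong: conj_cong)
  have "\<not> (\<exists>M. N = 2 + (q - 1) * M \<and> odd (vY q M))" if "N = 2"
  proof
    assume "\<exists>M. N = 2 + (q - 1) * M \<and> odd (vY q M)"
    then obtain M where M: "N = 2 + (q - 1) * M" "odd (vY q M)" by blast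
    then have "M = 0" using that prime_gt_1_nat[OF q(1)] by simp
    then show False using M(2) vY_0 by simp
  qed
  then show ?thesis unfolding 1 2 using 3 by auto
qed

lemma vY_odd_iff:
  assumes q: "Factorial_Ring.prime q" "odd q" "q - 1 = 2 ^ k"
  shows "odd (vY q N) \<longleftrightarrow> (\<exists>n. N = lam q n + 1)"
proof (induction N rule: less_induct)
  case (less N)
  have q1: "q > 1" by (rule prime_gt_1_nat[OF q(1)])
  have step: "2 + (q - 1) * (lam q n + 1) = lam q (Suc n) + 1" for n
    using q1 by (cases q) simp_all
  show ?case
  proof
    assume "odd (vY q N)"
    then consider "N = 2" | M where "N = 2 + (q - 1) * M" "odd (vY q M)"
      using vY_step[OF q, of N] by blast
    then show "\<exists>n. N = lam q n + 1"
    proof cases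
      case 1
      then show ?thesis by (intro exI[of _ 0]) simp
    next
      case 2
      have "M \<le> (q - 1) * M" using q1 by (cases q) simp_all
      then have "M < N" using 2(1) by linarith
      then obtain n where "M = lam q n + 1" using less.IH 2(2) by blast
      then have "N = lam q (Suc n) + 1" using 2(1) step by simp
      then show ?thesis by blast
    qed
  next
    assume "\<exists>n. N = lam q n + 1"
    then obtain n where n: "N = lam q n + 1" by blast
    show "odd (vY q N)"
    proof (cases n)
      case 0
      then have "N = 2" using n by simp
      then show ?thesis using vY_step[OF q, of N] by blast
    next
      case (Suc n')
      have N: "N = 2 + (q - 1) * (lam q n' + 1)" unfolding step n Suc ..
      have "lam q n' + 1 \<le> (q - 1) * (lam q n' + 1)" using q1 mult_le_mono1[of 1 "q - 1" "lam q n' + 1"] by simp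
      then have "lam q n' + 1 < N" using N by linarith
      then have "odd (vY q (lam q n' + 1))" using less.IH by blast
      then show ?thesis using vY_step[OF q, of N] N by blast
    qed
  qed
qed

lemma lam_iff:
  assumes q: "Factorial_Ring.prime q" "odd q" "q - 1 = 2 ^ k"
  shows "N = 1 \<or> (\<exists>M. N = 1 + (q - 1) * M \<and> odd (vY q M)) \<longleftrightarrow> (\<exists>n. N = lam q n)"
    "N = 1 \<Longrightarrow> \<not> (\<exists>M. N = 1 + (q - 1) * M \<and> odd (vY q M))"
proof -
  have q1: "q > 1" by (rule prime_gt_1_nat[OF q(1)])
  have step: "1 + (q - 1) * (lam q n + 1) = lam q (Suc n)" for n
    using q1 by (cases q) simp_all
  have "(\<exists>M. N = 1 + (q - 1) * M \<and> odd (vY q M)) \<longleftrightarrow> (\<exists>n. N = lam q (Suc n))"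
    unfolding vY_odd_iff[OF q] using step by metis
  moreover have "N = 1 \<or> (\<exists>n. N = lam q (Suc n)) \<longleftrightarrow> (\<exists>n. N = lam q n)"
    by (metis lam.simps(1) not0_implies_Suc)
  ultimately show "N = 1 \<or> (\<exists>M. N = 1 + (q - 1) * M \<and> odd (vY q M)) \<longleftrightarrow> (\<exists>n. N = lam q n)" by blast
  show "\<not> (\<exists>M. N = 1 + (q - 1) * M \<and> odd (vY q M))" if "N = 1"
  proof
    assume "\<exists>M. N = 1 + (q - 1) * M \<and> odd (vY q M)"
    then obtain M where M: "N = 1 + (q - 1) * M" "odd (vY q M)" by blast
    then have "M = 0" using that q1 by simp
    then show False using M(2) vY_0 by simp
  qed
qed

text \<open>The subgroups containing \<open>x\<close> are rooted with \<open>c = 1\<close>, except the full group.\<close>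

lemma split_x:
  assumes q: "Factorial_Ring.prime q"
  shows "card {W \<in> subs q N. [gen_x] \<in> W \<and> P (fixc gen_x W) (fixc gen_y W)} =
    (if N = 1 \<and> P 1 1 then 1 else 0) + card {W \<in> subs q N. rooted 1 W \<and> P (fixc gen_x W) (fixc gen_y W)}"
proof -
  have q0: "q > 0" by (rule prime_gt_0_nat[OF q])
  let ?E = "if N = 1 \<and> P 1 1 then {UNIV :: xy list set} else {}"
  let ?C = "{W \<in> subs q N. rooted 1 W \<and> P (fixc gen_x W) (fixc gen_y W)}"
  have "{W \<in> subs q N. [gen_x] \<in> W \<and> P (fixc gen_x W) (fixc gen_y W)} = ?E \<union> ?C"
  proof (intro equalityI subsetI)
    fix W assume "W \<in> {W \<in> subs q N. [gen_x] \<in> W \<and> P (fixc gen_x W) (fixc gen_y W)}"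
    then have W: "W \<in> subs q N" "[gen_x] \<in> W" "P (fixc gen_x W) (fixc gen_y W)" by simp_all
    show "W \<in> ?E \<union> ?C"
    proof (cases "[gen_y] \<in> W")
      case True
      have e: "W = UNIV" by (rule UNIV_unique[OF W(1) q0 W(2) True])
      then have "N = 1" using W(1) UNIV_props(1)[OF q] by (auto simp: subs_def)
      then show ?thesis using e W(3) UNIV_props(2)[OF q] by simp
    next
      case False
      then show ?thesis using W by (simp add: rooted_def)
    qed
  next
    fix W assume "W \<in> ?E \<union> ?C"
    then consider "N = 1" "P 1 1" "W = UNIV" | "W \<in> ?C" by (auto split: if_splits)
    then show "W \<in> {W \<in> subs q N. [gen_x] \<in> W \<and> P (fixc gen_x W) (fixc gen_y W)}"
    proof cases
      case 1
      then show ?thesis using UNIV_props(1,2)[OF q] by simp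
    next
      case 2
      then show ?thesis by (simp add: rooted_def)
    qed
  qed
  moreover have "?E \<inter> ?C = {}" by (auto simp: rooted_def)
  ultimately show ?thesis using card_Un_disjoint[of ?E ?C] finite_subs[OF q0, of N] by simp
qed

lemma parity_combine:
  fixes a c :: nat
  assumes "a = (if A then 1 else 0) + c" "odd c \<longleftrightarrow> B" "A \<or> B \<longleftrightarrow> C" "A \<Longrightarrow> \<not> B"
  shows "odd a \<longleftrightarrow> C"
  using assms by (cases A) auto

lemma zero_iff_one: "(g::nat) + p = p * b \<Longrightarrow> p > 0 \<Longrightarrow> g = 0 \<longleftrightarrow> b = 1"
  by (cases b) auto

text \<open>The subgroups containing \<open>x\<close>: all of them, those of the type \<open>a = 1\<close>, \<open>r = 0\<close> and those without
cosets fixed by \<open>y\<close>.\<close>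

lemma x_subgroup_parity:
  assumes q: "Factorial_Ring.prime q" "odd q" "q - 1 = 2 ^ k"
  shows "odd (card {W \<in> subs q N. [gen_x] \<in> W}) \<longleftrightarrow> (\<exists>n. N = lam q n)"
    "odd (card {W \<in> subs q N. [gen_x] \<in> W \<and> fixc gen_x W = 1 \<and> rk q W = 0}) \<longleftrightarrow> (\<exists>n. N = lam q n)"
    "even (card {W \<in> subs q N. [gen_x] \<in> W \<and> fixc gen_y W = 0})"
proof -
  have q1: "q > 1" by (rule prime_gt_1_nat[OF q(1)])
  have one: "1 = (1::nat) \<or> 1 = (2::nat)" by simp
  have "odd (card {W \<in> subs q N. rooted 1 W \<and> (\<lambda>a b. True) (fixc gen_x W) (fixc gen_y W)}) \<longleftrightarrow>
    (\<exists>M. N = 1 + (q - 1) * M \<and>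
       odd (card {L \<in> subs q M. [gen_y] \<in> L \<and> fixc gen_x L = 0 \<and> rk q L = 0 \<and> True}))"
    by (rule rooted_parity[OF q one]) simp
  then have r0: "odd (card {W \<in> subs q N. rooted 1 W}) \<longleftrightarrow> (\<exists>M. N = 1 + (q - 1) * M \<and> odd (vY q M))"
    by (simp add: vY_def)
  have s0: "card {W \<in> subs q N. [gen_x] \<in> W} = (if N = 1 then 1 else 0) + card {W \<in> subs q N. rooted 1 W}"
    using split_x[OF q(1), of N "\<lambda>_ _. True"] by simp
  show "odd (card {W \<in> subs q N. [gen_x] \<in> W}) \<longleftrightarrow> (\<exists>n. N = lam q n)"
    by (rule parity_combine[OF s0 r0 lam_iff[OF q]])
  let ?P = "\<lambda>a b. a = 1 \<and> rkf q N a b = 0"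
  have "odd (card {W \<in> subs q N. rooted 1 W \<and> ?P (fixc gen_x W) (fixc gen_y W)}) \<longleftrightarrow>
    (\<exists>M. N = 1 + (q - 1) * M \<and>
       odd (card {L \<in> subs q M. [gen_y] \<in> L \<and> fixc gen_x L = 0 \<and> rk q L = 0 \<and> (fixc gen_x L = 0 \<and> rk q L = 0)}))"
  proof (rule rooted_parity[OF q one])
    fix L \<psi> M assume p: "(L, \<psi>) \<in> U_pairs q M" and N: "1 + (q - 1) * M = N"
    show "?P (fixc gen_x (glued q 1 (L, \<psi>))) (fixc gen_y (glued q 1 (L, \<psi>)))
        \<longleftrightarrow> fixc gen_x L = 0 \<and> rk q L = 0"
      using glued_type[OF q(1) one p] rk_rkf[OF glued_props(1)[OF q(1) one p]] N by simp
  qed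
  then have r1: "odd (card {W \<in> subs q N. rooted 1 W \<and> ?P (fixc gen_x W) (fixc gen_y W)}) \<longleftrightarrow>
      (\<exists>M. N = 1 + (q - 1) * M \<and> odd (vY q M))"
    unfolding vY_def by (simp add: conj_ac cong: conj_cong)
  have P1: "?P 1 1" if "N = 1"
    using rk_rkf[OF UNIV_props(1)[OF q(1)]] UNIV_props(2,3)[OF q(1)] that by simp
  have "{W \<in> subs q N. [gen_x] \<in> W \<and> fixc gen_x W = 1 \<and> rk q W = 0}
      = {W \<in> subs q N. [gen_x] \<in> W \<and> ?P (fixc gen_x W) (fixc gen_y W)}"
    using rk_rkf by auto
  then have s1: "card {W \<in> subs q N. [gen_x] \<in> W \<and> fixc gen_x W = 1 \<and> rk q W = 0}
      = (if N = 1 then 1 else 0) + card {W \<in> subs q N. rooted 1 W \<and> ?P (fixc gen_x W) (fixc gen_y W)}"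
    using split_x[OF q(1), of N ?P] P1 by (cases "N = 1") simp_all
  show "odd (card {W \<in> subs q N. [gen_x] \<in> W \<and> fixc gen_x W = 1 \<and> rk q W = 0}) \<longleftrightarrow> (\<exists>n. N = lam q n)"
    by (rule parity_combine[OF s1 r1 lam_iff[OF q]])
  let ?Q = "\<lambda>a b. b = (0::nat)"
  have "odd (card {W \<in> subs q N. rooted 1 W \<and> ?Q (fixc gen_x W) (fixc gen_y W)}) \<longleftrightarrow>
    (\<exists>M. N = 1 + (q - 1) * M \<and>
       odd (card {L \<in> subs q M. [gen_y] \<in> L \<and> fixc gen_x L = 0 \<and> rk q L = 0 \<and> fixc gen_y L = 1}))"
  proof (rule rooted_parity[OF q one])
    fix L \<psi> M assume p: "(L, \<psi>) \<in> U_pairs q M"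
    have "fixc gen_y (glued q 1 (L, \<psi>)) + (q - 1) = (q - 1) * fixc gen_y L"
      using glued_props(4)[OF q(1) one p] q1 by simp
    then show "?Q (fixc gen_x (glued q 1 (L, \<psi>))) (fixc gen_y (glued q 1 (L, \<psi>))) \<longleftrightarrow> fixc gen_y L = 1"
      by (rule zero_iff_one) (use q1 in simp)
  qed
  note i1 = this
  \<comment> \<open>By \<open>rk_subs\<close> the type \<open>a = r = 0\<close>, \<open>b = 1\<close> would make a positive number vanish.\<close>
  have emp: "{L \<in> subs q M. [gen_y] \<in> L \<and> fixc gen_x L = 0 \<and> rk q L = 0 \<and> fixc gen_y L = 1} = {}" for M
  proof (rule ccontr)
    assume "{L \<in> subs q M. [gen_y] \<in> L \<and> fixc gen_x L = 0 \<and> rk q L = 0 \<and> fixc gen_y L = 1} \<noteq> {}"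
    then obtain L where L: "L \<in> subs q M" "fixc gen_x L = 0" "rk q L = 0" "fixc gen_y L = 1" by blast
    have "(int q - 2) * int M + 2 = 0" using rk_subs[OF q(1) L(1)] L(2-4) by (simp add: algebra_simps)
    moreover have "(int q - 2) * int M \<ge> 0" using q1 by simp
    ultimately show False by linarith
  qed
  have "even (card {W \<in> subs q N. rooted 1 W \<and> fixc gen_y W = 0})" using i1 unfolding emp by simp
  then show "even (card {W \<in> subs q N. [gen_x] \<in> W \<and> fixc gen_y W = 0})"
    using split_x[OF q(1), of N ?Q] by simp
qed

text \<open>The three parities of numbers of subgroups of \<open>C\<^sub>2 * C\<^sub>q\<close> on which the theorem rests.\<close>

theorem subs_parity:
  assumes q: "Factorial_Ring.prime q" "odd q" "q - 1 = 2 ^ k"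
  shows "odd (card (subs q N)) \<longleftrightarrow> (\<exists>n. N = 2 * lam q n) \<or> (\<exists>n. N = lam q n)"
    "odd (card {W \<in> subs q N. fixc gen_x W = 0 \<and> rk q W = 0}) \<longleftrightarrow> (\<exists>n. N = 2 * lam q n)"
    "even (card {W \<in> subs q N. fixc gen_y W = 0})"
proof -
  have q1: "q > 1" by (rule prime_gt_1_nat[OF q(1)])
  have half: "even N \<and> (\<exists>n. N div 2 = lam q n) \<longleftrightarrow> (\<exists>n. N = 2 * lam q n)"
    by (metis dvd_mult_div_cancel dvd_triv_left nonzero_mult_div_cancel_left zero_neq_numeral)
  have "odd (card {a \<in> Z2_pairs q (N div 2). True}) \<longleftrightarrow> (\<exists>n. N div 2 = lam q n)"
    using Z2_pairs_parity[OF q(1,2), of "N div 2" "\<lambda>_. True"] x_subgroup_parity(2)[OF q, of "N div 2"] by simp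
  then have "odd (card (subs q N)) \<longleftrightarrow> ((\<exists>n. N = lam q n) \<noteq> (even N \<and> (\<exists>n. N div 2 = lam q n)))"
    using conj_parity[OF q(1,2), of N "\<lambda>_ _. True"] x_subgroup_parity(1)[OF q, of N] by auto
  moreover have "\<not> ((\<exists>n. N = lam q n) \<and> even N)" using lam_odd[OF q(2)] by blast
  ultimately show "odd (card (subs q N)) \<longleftrightarrow> (\<exists>n. N = 2 * lam q n) \<or> (\<exists>n. N = lam q n)"
    unfolding half[symmetric] by blast
  let ?P = "\<lambda>a b. a = 0 \<and> rkf q N a b = 0"
  have e1: "{W \<in> subs q N. [gen_x] \<in> W \<and> ?P (fixc gen_x W) (fixc gen_y W)} = {}"
    using fixc_pos[of _ q N gen_x] by fastforce
  have e2: "{W \<in> subs q N. fixc gen_x W = 0 \<and> rk q W = 0} = {W \<in> subs q N. ?P (fixc gen_x W) (fixc gen_y W)}"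
    using rk_rkf by auto
  have "odd (card {a \<in> Z2_pairs q (N div 2). ?P (fixc gen_x (ker2 a)) (fixc gen_y (ker2 a))}) \<longleftrightarrow> (\<exists>n. N div 2 = lam q n)"
    if N: "even N"
  proof -
    have "?P (fixc gen_x (ker2 a)) (fixc gen_y (ker2 a)) \<longleftrightarrow> fixc gen_x (fst a) = 1 \<and> rk q (fst a) = 0"
      if a: "a \<in> Z2_pairs q (N div 2)" for a
    proof -
      obtain L \<psi> where aa: "a = (L, \<psi>)" by (cases a)
      have s: "ker2 (L, \<psi>) \<in> subs q N" using ker2_props(1)[OF a[unfolded aa] q(1,2)] N by simp
      show ?thesis unfolding aa fst_conv using ker2_type[OF q(1,2) a[unfolded aa]] rk_rkf[OF s] by simp
    qed
    then have "{a \<in> Z2_pairs q (N div 2). ?P (fixc gen_x (ker2 a)) (fixc gen_y (ker2 a))}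
        = {a \<in> Z2_pairs q (N div 2). (\<lambda>L. fixc gen_x L = 1 \<and> rk q L = 0) (fst a)}" by blast
    then have "odd (card {a \<in> Z2_pairs q (N div 2). ?P (fixc gen_x (ker2 a)) (fixc gen_y (ker2 a))}) \<longleftrightarrow>
      odd (card {L \<in> subs q (N div 2). [gen_x] \<in> L \<and> fixc gen_x L = 1 \<and> rk q L = 0 \<and> (fixc gen_x L = 1 \<and> rk q L = 0)})"
      by (simp only:) (rule Z2_pairs_parity[OF q(1,2), where R = "\<lambda>L. fixc gen_x L = 1 \<and> rk q L = 0"])
    also have "{L \<in> subs q (N div 2). [gen_x] \<in> L \<and> fixc gen_x L = 1 \<and> rk q L = 0 \<and> (fixc gen_x L = 1 \<and> rk q L = 0)}
      = {L \<in> subs q (N div 2). [gen_x] \<in> L \<and> fixc gen_x L = 1 \<and> rk q L = 0}" by blast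
    finally show ?thesis unfolding x_subgroup_parity(2)[OF q] .
  qed
  then show "odd (card {W \<in> subs q N. fixc gen_x W = 0 \<and> rk q W = 0}) \<longleftrightarrow> (\<exists>n. N = 2 * lam q n)"
    unfolding e2 conj_parity[OF q(1,2), of N ?P] e1 half[symmetric] by simp
  let ?Q = "\<lambda>a b. b = (0::nat)"
  have "even (card {a \<in> Z2_pairs q (N div 2). ?Q (fixc gen_x (ker2 a)) (fixc gen_y (ker2 a))})"
  proof -
    have "?Q (fixc gen_x (ker2 a)) (fixc gen_y (ker2 a)) \<longleftrightarrow> fixc gen_y (fst a) = 0"
      if a: "a \<in> Z2_pairs q (N div 2)" for a
    proof -
      obtain L \<psi> where aa: "a = (L, \<psi>)" by (cases a)
      show ?thesis unfolding aa fst_conv using ker2_props(4)[OF a[unfolded aa] q(1,2)] by simp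
    qed
    then have "{a \<in> Z2_pairs q (N div 2). ?Q (fixc gen_x (ker2 a)) (fixc gen_y (ker2 a))}
        = {a \<in> Z2_pairs q (N div 2). (\<lambda>L. fixc gen_y L = 0) (fst a)}" by blast
    then have "odd (card {a \<in> Z2_pairs q (N div 2). ?Q (fixc gen_x (ker2 a)) (fixc gen_y (ker2 a))}) \<longleftrightarrow>
      odd (card {L \<in> subs q (N div 2). [gen_x] \<in> L \<and> fixc gen_x L = 1 \<and> rk q L = 0 \<and> fixc gen_y L = 0})"
      by (simp only:) (rule Z2_pairs_parity[OF q(1,2), where R = "\<lambda>L. fixc gen_y L = 0"])
    also have "{L \<in> subs q (N div 2). [gen_x] \<in> L \<and> fixc gen_x L = 1 \<and> rk q L = 0 \<and> fixc gen_y L = 0} = {}"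
    proof (rule ccontr)
      assume "{L \<in> subs q (N div 2). [gen_x] \<in> L \<and> fixc gen_x L = 1 \<and> rk q L = 0 \<and> fixc gen_y L = 0} \<noteq> {}"
      then obtain L where L: "L \<in> subs q (N div 2)" "fixc gen_x L = 1" "rk q L = 0" "fixc gen_y L = 0" by blast
      have "(int q - 2) * int (N div 2) + int q = 0" using rk_subs[OF q(1) L(1)] L(2-4) by (simp add: algebra_simps)
      moreover have "(int q - 2) * int (N div 2) \<ge> 0" using q1 by simp
      ultimately show False using q1 by linarith
    qed
    finally show ?thesis by simp
  qed
  then show "even (card {W \<in> subs q N. fixc gen_y W = 0})"
    using conj_parity[OF q(1,2), of N ?Q] x_subgroup_parity(3)[OF q, of N] by auto
qed

section \<open>The amalgamated product and its centre\<close>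

text \<open>A positive word as a word over the generators and their inverses.\<close>

definition emb :: "xy list \<Rightarrow> xy word" where "emb w = map (\<lambda>s. (s, True)) w"

text \<open>The presented group \<open>GG\<close>, the element \<open>g w\<close> represented by a positive word \<open>w\<close>, and the central element
\<open>\<zeta> = x\<^sup>2 = y\<^sup>q\<close>.\<close>

locale gamma_pres =
  fixes m q :: nat
  assumes m1: "m \<ge> 1" and q1: "q \<ge> 1"
begin

abbreviation "RR \<equiv> Gamma_rels m q"
abbreviation "GG \<equiv> Gamma_group m q"
definition "g w = pres_class RR (emb w)"
definition "\<zeta> = g [gen_x, gen_x]"

sublocale G: group GG unfolding Gamma_group_def by (rule group_presented_group)

lemma g_closed [simp]: "g w \<in> carrier GG"
  by (simp add: g_def Gamma_group_def presented_group_def)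

lemma g_app: "g (u @ v) = g u \<otimes>\<^bsub>GG\<^esub> g v"
  by (simp add: g_def emb_def Gamma_group_def presented_group_mult)

lemma g_Nil: "g [] = \<one>\<^bsub>GG\<^esub>"
  by (simp add: g_def emb_def Gamma_group_def presented_group_def)

lemma g_Cons: "g (s # w) = g [s] \<otimes>\<^bsub>GG\<^esub> g w"
  using g_app[of "[s]" w] by simp

lemma g_replicate: "g (replicate n s) = g [s] [^]\<^bsub>GG\<^esub> n"
proof (induction n)
  case (Suc n)
  have "g (replicate (Suc n) s) = g (replicate n s @ [s])" by (simp add: replicate_append_same)
  then show ?case by (simp add: g_app Suc)
qed (simp add: g_Nil)

lemma g_rel_eq: "(emb u, emb v) \<in> RR \<Longrightarrow> g u = g v"
  unfolding g_def pres_class_eq_iff using pres_eq.relation[of "emb u" "emb v" RR "[]" "[]"] by simp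

lemma g_ordr: "g (replicate (ordr q s) s) = \<zeta>"
proof -
  have "g [gen_x, gen_x] = g (replicate q gen_y)"
    by (rule g_rel_eq) (simp add: emb_def Gamma_rels_def numeral_2_eq_2)
  then show ?thesis by (cases s) (simp_all add: \<zeta>_def numeral_2_eq_2)
qed

lemma zeta_closed [simp]: "\<zeta> \<in> carrier GG" by (simp add: \<zeta>_def)

lemma zeta_pow: "\<zeta> [^]\<^bsub>GG\<^esub> n = g (replicate (ordr q s * n) s)"
  unfolding g_ordr[of s, symmetric] g_replicate by (simp add: G.nat_pow_pow)

lemma zeta_m: "\<zeta> [^]\<^bsub>GG\<^esub> m = \<one>\<^bsub>GG\<^esub>"
proof -
  have "g (replicate (2 * m) gen_x) = g []" by (rule g_rel_eq) (simp add: emb_def Gamma_rels_def)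
  then show ?thesis using zeta_pow[of m gen_x] by (simp add: g_Nil)
qed

lemma zeta_mult: "\<zeta> [^]\<^bsub>GG\<^esub> (m * n) = \<one>\<^bsub>GG\<^esub>"
  using G.nat_pow_pow[of \<zeta> m n] zeta_m by simp

lemma zeta_gen: "\<zeta> \<otimes>\<^bsub>GG\<^esub> g [s] = g [s] \<otimes>\<^bsub>GG\<^esub> \<zeta>"
proof -
  have "replicate (ordr q s) s @ [s] = [s] @ replicate (ordr q s) s" by (simp add: replicate_append_same)
  then have "g (replicate (ordr q s) s @ [s]) = g ([s] @ replicate (ordr q s) s)" by simp
  then show ?thesis unfolding g_app g_ordr .
qed

lemma zeta_g: "\<zeta> \<otimes>\<^bsub>GG\<^esub> g w = g w \<otimes>\<^bsub>GG\<^esub> \<zeta>"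
proof (induction w)
  case (Cons s w)
  have "\<zeta> \<otimes>\<^bsub>GG\<^esub> g (s # w) = (\<zeta> \<otimes>\<^bsub>GG\<^esub> g [s]) \<otimes>\<^bsub>GG\<^esub> g w" unfolding g_Cons[of s w] by (simp add: G.m_assoc)
  also have "\<dots> = g [s] \<otimes>\<^bsub>GG\<^esub> (\<zeta> \<otimes>\<^bsub>GG\<^esub> g w)" unfolding zeta_gen by (simp add: G.m_assoc)
  also have "\<dots> = g (s # w) \<otimes>\<^bsub>GG\<^esub> \<zeta>" unfolding Cons g_Cons[of s w] by (simp add: G.m_assoc)
  finally show ?case .
qed (simp add: g_Nil)

text \<open>A common multiple of the orders of the two generators.\<close>

definition per :: nat where "per = 2 * q * m"

lemma per_pos: "per \<ge> 1" using m1 q1 by (simp add: per_def)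

lemma per_split: "per = ordr q s * (case s of gen_x \<Rightarrow> q * m | gen_y \<Rightarrow> 2 * m)"
  by (cases s) (simp_all add: per_def)

lemma g_per: "g (replicate per s) = \<one>\<^bsub>GG\<^esub>"
proof -
  have "(case s of gen_x \<Rightarrow> q * m | gen_y \<Rightarrow> 2 * m) = m * (case s of gen_x \<Rightarrow> q | gen_y \<Rightarrow> 2)"
    by (cases s) simp_all
  then show ?thesis unfolding per_split[of s] zeta_pow[symmetric] using zeta_mult by simp
qed

text \<open>A positive word for the same element: the inverse of a generator \<open>s\<close> is replaced by \<open>s\<^bsup>per - 1\<^esup>\<close>.\<close>

definition pos :: "xy word \<Rightarrow> xy list" where
  "pos u = concat (map (\<lambda>(s, b). if b then [s] else replicate (per - 1) s) u)"

lemma pos_simps [simp]: "pos [] = []" "pos ((s, b) # u) = (if b then [s] else replicate (per - 1) s) @ pos u"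
  "pos (u @ v) = pos u @ pos v"
  by (simp_all add: pos_def)

lemma pos_emb: "pos (emb w) = w"
  by (induction w) (simp_all add: emb_def)

lemma replicate_per: "replicate (per - 1) s @ [s] = replicate per s" "[s] @ replicate (per - 1) s = replicate per s"
proof -
  obtain p where p: "per = Suc p" using per_pos by (cases per) auto
  show "replicate (per - 1) s @ [s] = replicate per s" "[s] @ replicate (per - 1) s = replicate per s"
    unfolding p by (simp_all add: replicate_append_same)
qed

lemma g_pos: "pres_class RR u = g (pos u)"
proof (induction u)
  case Nil
  show ?case by (simp add: g_def emb_def)
next
  case (Cons a u)
  obtain s b where a: "a = (s, b)" by (cases a)
  have mult: "pres_class RR (v @ w) = pres_class RR v \<otimes>\<^bsub>GG\<^esub> pres_class RR w" for v w
    by (simp add: Gamma_group_def presented_group_mult)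
  have cls: "pres_class RR v \<in> carrier GG" for v by (simp add: Gamma_group_def presented_group_def)
  have "pres_class RR [a] = g (pos [a])"
  proof (cases b)
    case True
    then show ?thesis by (simp add: a g_def emb_def)
  next
    case False
    have "pres_eq RR ([] @ [(s, True), (s, \<not> True)] @ []) ([] @ [])" by (rule pres_eq.cancel)
    then have "pres_class RR ([(s, True)] @ [(s, False)]) = pres_class RR []" by (simp add: pres_class_eq_iff)
    then have 1: "g [s] \<otimes>\<^bsub>GG\<^esub> pres_class RR [(s, False)] = \<one>\<^bsub>GG\<^esub>"
      unfolding mult using g_Nil by (simp add: g_def emb_def)
    have 2: "g [s] \<otimes>\<^bsub>GG\<^esub> g (replicate (per - 1) s) = \<one>\<^bsub>GG\<^esub>"
      unfolding g_app[symmetric] replicate_per g_per ..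
    have trans_eq: "g [s] \<otimes>\<^bsub>GG\<^esub> pres_class RR [(s, False)] = g [s] \<otimes>\<^bsub>GG\<^esub> g (replicate (per - 1) s)"
      unfolding 1 2 ..
    have "pres_class RR [(s, False)] = g (replicate (per - 1) s)"
      by (rule G.l_cancel[OF trans_eq cls g_closed g_closed])
    then show ?thesis using False by (simp add: a)
  qed
  then have "pres_class RR (a # u) = g (pos [a]) \<otimes>\<^bsub>GG\<^esub> g (pos u)"
    using mult[of "[a]" u] Cons by simp
  then show ?case unfolding g_app[symmetric] by (simp add: a)
qed

lemma g_surj: "x \<in> carrier GG \<Longrightarrow> \<exists>w. x = g w"
  using g_pos by (auto simp: Gamma_group_def presented_group_def)

lemma zeta_int_mod: "\<zeta> [^]\<^bsub>GG\<^esub> (i::int) = \<zeta> [^]\<^bsub>GG\<^esub> nat (i mod int m)"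
proof -
  have "\<zeta> [^]\<^bsub>GG\<^esub> i = \<zeta> [^]\<^bsub>GG\<^esub> (int m * (i div int m) + i mod int m)" by simp
  also have "\<dots> = (\<zeta> [^]\<^bsub>GG\<^esub> int m) [^]\<^bsub>GG\<^esub> (i div int m) \<otimes>\<^bsub>GG\<^esub> \<zeta> [^]\<^bsub>GG\<^esub> (i mod int m)"
    by (simp only: G.int_pow_mult[OF zeta_closed] G.int_pow_pow[OF zeta_closed])
  also have "\<dots> = \<zeta> [^]\<^bsub>GG\<^esub> (i mod int m)"
    by (simp add: int_pow_int zeta_m G.int_pow_one)
  also have "\<dots> = \<zeta> [^]\<^bsub>GG\<^esub> (int (nat (i mod int m)))" using m1 by simp
  finally show ?thesis by (simp only: int_pow_int)
qed

lemma zeta_int: "\<zeta> [^]\<^bsub>GG\<^esub> (i::int) = g (replicate (2 * nat (i mod int m)) gen_x)"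
  using zeta_pow[of "nat (i mod int m)" gen_x] unfolding zeta_int_mod by (simp only: ordr_simps)

lemma zeta_central: "x \<in> carrier GG \<Longrightarrow> \<zeta> [^]\<^bsub>GG\<^esub> (i::int) \<otimes>\<^bsub>GG\<^esub> x = x \<otimes>\<^bsub>GG\<^esub> \<zeta> [^]\<^bsub>GG\<^esub> i"
proof -
  assume x: "x \<in> carrier GG"
  have *: "\<zeta> \<otimes>\<^bsub>GG\<^esub> x = x \<otimes>\<^bsub>GG\<^esub> \<zeta>" using g_surj[OF x] zeta_g by auto
  have "\<zeta> [^]\<^bsub>GG\<^esub> (n::nat) \<otimes>\<^bsub>GG\<^esub> x = x \<otimes>\<^bsub>GG\<^esub> \<zeta> [^]\<^bsub>GG\<^esub> n" for n
  proof (induction n)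
    case (Suc n)
    have "\<zeta> [^]\<^bsub>GG\<^esub> Suc n \<otimes>\<^bsub>GG\<^esub> x = \<zeta> [^]\<^bsub>GG\<^esub> n \<otimes>\<^bsub>GG\<^esub> (\<zeta> \<otimes>\<^bsub>GG\<^esub> x)" using x by (simp add: G.m_assoc)
    also have "\<dots> = (\<zeta> [^]\<^bsub>GG\<^esub> n \<otimes>\<^bsub>GG\<^esub> x) \<otimes>\<^bsub>GG\<^esub> \<zeta>" unfolding * using x by (simp add: G.m_assoc)
    also have "\<dots> = x \<otimes>\<^bsub>GG\<^esub> \<zeta> [^]\<^bsub>GG\<^esub> Suc n" unfolding Suc using x by (simp add: G.m_assoc)
    finally show ?case .
  qed (use x in simp)
  then show ?thesis unfolding zeta_int_mod .
qed

end

text \<open>If \<open>z\<close> has order dividing \<open>m\<close>, the set \<open>W\<close> and the functions in \<open>coc\<close> depend only on the element of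
\<open>\<Gamma>\<^sub>m(q)\<close> that a word represents (\<open>coc_g\<close>).\<close>

locale gamma_coc = gamma_pres m q + wcover A z q W for m q and A (structure) and z W +
  assumes zm: "z [^] m = \<one>"
begin

lemma coc_block:
  assumes p: "\<psi> \<in> coc q A z W"
  shows "a @ replicate (ordr q s * j) s @ b \<in> W \<longleftrightarrow> a @ b \<in> W"
    "a @ b \<in> W \<Longrightarrow> \<psi> (a @ replicate (ordr q s * j) s @ b) = z [^] j \<otimes> \<psi> (a @ b)"
proof -
  have "(a @ replicate (ordr q s * j) s @ b \<in> W \<longleftrightarrow> a @ b \<in> W) \<and>
    (a @ b \<in> W \<longrightarrow> \<psi> (a @ replicate (ordr q s * j) s @ b) = z [^] j \<otimes> \<psi> (a @ b))"
  proof (induction j)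
    case 0
    then show ?case using cocD(1)[OF p] by simp
  next
    case (Suc j)
    have e: "a @ replicate (ordr q s * Suc j) s @ b = a @ replicate (ordr q s) s @ (replicate (ordr q s * j) s @ b)"
      by (simp add: replicate_add)
    have w: "a @ replicate (ordr q s * Suc j) s @ b \<in> W \<longleftrightarrow> a @ b \<in> W"
      unfolding e W_rel using Suc by blast
    have "\<psi> (a @ replicate (ordr q s * Suc j) s @ b) = z [^] Suc j \<otimes> \<psi> (a @ b)" if ab: "a @ b \<in> W"
    proof -
      have m: "a @ (replicate (ordr q s * j) s @ b) \<in> W" using Suc ab by blast
      show ?thesis unfolding e cocD(3)[OF p m] using Suc ab cocD(1)[OF p ab] zpow_comm[OF z, of j]
        by (simp add: m_assoc[symmetric])
    qed
    then show ?case using w by blast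
  qed
  then show "a @ replicate (ordr q s * j) s @ b \<in> W \<longleftrightarrow> a @ b \<in> W"
    "a @ b \<in> W \<Longrightarrow> \<psi> (a @ replicate (ordr q s * j) s @ b) = z [^] j \<otimes> \<psi> (a @ b)" by blast+
qed

lemma z_mult: "z [^] (m * k) = \<one>"
  using nat_pow_pow[OF z, of m k] zm by simp

lemma coc_block_m:
  assumes p: "\<psi> \<in> coc q A z W" and n: "n = ordr q s * (m * k)"
  shows "(a @ replicate n s @ b \<in> W \<longleftrightarrow> a @ b \<in> W) \<and> (a @ b \<in> W \<longrightarrow> \<psi> (a @ replicate n s @ b) = \<psi> (a @ b))"
  unfolding n using coc_block[OF p, where a = a and s = s and j = "m * k" and b = b] cocD(1)[OF p, of "a @ b"] by (simp add: z_mult)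

lemma coc_pres:
  assumes p: "\<psi> \<in> coc q A z W" and e: "pres_eq RR u v"
  shows "(a @ pos u @ b \<in> W \<longleftrightarrow> a @ pos v @ b \<in> W) \<and>
     (a @ pos u @ b \<in> W \<longrightarrow> \<psi> (a @ pos u @ b) = \<psi> (a @ pos v @ b))"
  using e
proof (induction arbitrary: a b rule: pres_eq.induct)
  case (sym u v)
  from sym.IH[of a b] show ?case by auto
next
  case (trans u v w)
  from trans.IH(1)[of a b] trans.IH(2)[of a b] show ?case by auto
next
  case (cancel u s c v)
  have c: "pos [(s, c), (s, \<not> c)] = replicate per s" using replicate_per by (cases c) simp_all
  have n: "per = ordr q s * (m * (case s of gen_x \<Rightarrow> q | gen_y \<Rightarrow> 2))" by (cases s) (simp_all add: per_def)
  have e1: "a @ pos (u @ [(s, c), (s, \<not> c)] @ v) @ b = (a @ pos u) @ replicate per s @ (pos v @ b)"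
    unfolding pos_simps(3) c by simp
  have e2: "a @ pos (u @ v) @ b = (a @ pos u) @ (pos v @ b)" by simp
  show ?case unfolding e1 e2 using coc_block_m[OF p n, where a = "a @ pos u" and b = "pos v @ b"] by blast
next
  case (relation l r u v)
  let ?a = "a @ pos u" and ?b = "pos v @ b"
  have e: "a @ pos (u @ l @ v) @ b = ?a @ pos l @ ?b" "a @ pos (u @ r @ v) @ b = ?a @ pos r @ ?b" by simp_all
  have rep: "pos (replicate n (s, True)) = replicate n s" for n s by (induction n) simp_all
  have "(?a @ pos l @ ?b \<in> W \<longleftrightarrow> ?a @ pos r @ ?b \<in> W) \<and>
     (?a @ pos l @ ?b \<in> W \<longrightarrow> \<psi> (?a @ pos l @ ?b) = \<psi> (?a @ pos r @ ?b))"
    using relation unfolding Gamma_rels_def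
  proof (elim insertE emptyE Pair_inject)
    assume lr: "l = replicate (2 * m) (gen_x, True)" "r = []"
    have n: "2 * m = ordr q gen_x * (m * 1)" by simp
    show ?thesis unfolding lr rep using coc_block_m[OF p n, where a = ?a and b = ?b] by simp
  next
    assume lr: "l = replicate (q * m) (gen_y, True)" "r = []"
    have n: "q * m = ordr q gen_y * (m * 1)" by simp
    show ?thesis unfolding lr rep using coc_block_m[OF p n, where a = ?a and b = ?b] by simp
  next
    assume lr: "l = replicate 2 (gen_x, True)" "r = replicate q (gen_y, True)"
    have x: "?a @ replicate 2 gen_x @ ?b \<in> W \<longleftrightarrow> ?a @ ?b \<in> W" using W_rel[of ?a gen_x ?b] by simp
    have y: "?a @ replicate q gen_y @ ?b \<in> W \<longleftrightarrow> ?a @ ?b \<in> W" using W_rel[of ?a gen_y ?b] by simp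
    have "\<psi> (?a @ replicate 2 gen_x @ ?b) = \<psi> (?a @ replicate q gen_y @ ?b)" if "?a @ ?b \<in> W"
      using cocD(3)[OF p that, of gen_x] cocD(3)[OF p that, of gen_y] by simp
    then show ?thesis unfolding lr rep using x y by blast
  qed
  then show ?case unfolding e .
qed simp

lemma coc_g:
  assumes p: "\<psi> \<in> coc q A z W" and e: "g u = g v"
  shows "u \<in> W \<longleftrightarrow> v \<in> W" "u \<in> W \<Longrightarrow> \<psi> u = \<psi> v"
proof -
  have "pres_eq RR (emb u) (emb v)" using e by (simp add: g_def pres_class_eq_iff)
  from coc_pres[OF p this, of "[]" "[]"]
  show "u \<in> W \<longleftrightarrow> v \<in> W" "u \<in> W \<Longrightarrow> \<psi> u = \<psi> v" by (simp_all add: pos_emb)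
qed

end

text \<open>The order of \<open>\<zeta>\<close> is not less than \<open>m\<close>, as is seen in the cyclic quotient of order \<open>2 q m\<close> in which \<open>x\<close> is
mapped to \<open>q\<close> and \<open>y\<close> to 2.\<close>

lemma (in gamma_pres) zeta_order:
  assumes "\<zeta> [^]\<^bsub>GG\<^esub> (i::int) = \<one>\<^bsub>GG\<^esub>" shows "int m dvd i"
proof -
  let ?M = "2 * q * m"
  let ?A = "integer_mod_group ?M" and ?z = "int (2 * q) mod int ?M"
  let ?wt = "\<lambda>w. (\<Sum>s\<leftarrow>w. case s of gen_x \<Rightarrow> int q | gen_y \<Rightarrow> 2)"
  have M: "?M > 0" using m1 q1 by simp
  interpret A: group ?A by (rule group_integer_mod_group)
  have car: "carrier ?A = {0..<int ?M}" using M by (simp add: carrier_integer_mod_group)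
  have mul: "a \<otimes>\<^bsub>?A\<^esub> b = (a + b) mod int ?M" for a b by simp
  have zpow: "?z [^]\<^bsub>?A\<^esub> (n::nat) = (int (2 * q) * int n) mod int ?M" for n
  proof (induction n)
    case 0
    show ?case using M by simp
  next
    case (Suc n)
    have "int (2 * q) * int n + int (2 * q) = int (2 * q) * int (Suc n)" by (simp add: algebra_simps)
    then show ?case unfolding A.nat_pow_Suc Suc mul mod_add_eq by (simp only:)
  qed
  have wU: "wsub q UNIV" by (simp add: wsub_def)
  have oU: "orb UNIV = {UNIV}" by (auto simp: orb_def fold_del)
  interpret gamma_coc m q ?A ?z UNIV
  proof (unfold_locales)
    show "finite (carrier ?A)" unfolding car by simp
    show "?z \<in> carrier ?A" unfolding car using M by simp
    show "?z \<otimes>\<^bsub>?A\<^esub> a = a \<otimes>\<^bsub>?A\<^esub> ?z" for a unfolding mul by (simp add: add.commute)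
    show "wsub q UNIV" by (rule wU)
    show "finite (orb UNIV)" unfolding oU by simp
    show "q > 0" using q1 by simp
    show "?z [^]\<^bsub>?A\<^esub> m = \<one>\<^bsub>?A\<^esub>" unfolding zpow by simp
  qed
  have wtr: "?wt (replicate n s) = int n * (case s of gen_x \<Rightarrow> int q | gen_y \<Rightarrow> 2)" for n s
    by (induction n) (simp_all add: algebra_simps)
  have p: "(\<lambda>w. ?wt w mod int ?M) \<in> coc q ?A ?z UNIV"
    unfolding coc_def
  proof (intro CollectI conjI ballI allI impI)
    show "(\<lambda>w. ?wt w mod int ?M) \<in> UNIV \<rightarrow>\<^sub>E carrier ?A" unfolding car using M by (auto simp: PiE_def)
    fix u v show "?wt (u @ v) mod int ?M = (?wt u mod int ?M) \<otimes>\<^bsub>?A\<^esub> (?wt v mod int ?M)"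
      unfolding mul by (simp add: mod_add_eq)
  next
    fix s u v
    have "?wt (u @ replicate (ordr q s) s @ v) = int (2 * q) + ?wt (u @ v)"
      by (cases s) (simp_all add: sum_list_replicate)
    then show "?wt (u @ replicate (ordr q s) s @ v) mod int ?M = ?z \<otimes>\<^bsub>?A\<^esub> (?wt (u @ v) mod int ?M)"
      unfolding mul by (simp only: mod_add_eq)
  qed
  let ?k = "nat (i mod int m)"
  have "g (replicate (2 * ?k) gen_x) = g []" using assms unfolding zeta_int g_Nil .
  then have "?wt (replicate (2 * ?k) gen_x) mod int ?M = ?wt [] mod int ?M" by (rule coc_g(2)[OF p]) simp
  then have "int (2 * ?k) * int q mod int ?M = 0"
    unfolding wtr by (simp only: list.map sum_list.Nil mod_0 xy.case)
  then have "int ?M dvd int (2 * ?k) * int q" by (rule dvd_eq_mod_eq_0[THEN iffD2])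
  then have "int ?M dvd int (2 * ?k * q)" by (simp only: of_nat_mult)
  then have "(2 * q) * m dvd (2 * q) * ?k" by (simp only: of_nat_dvd_iff mult_ac)
  then have "m dvd ?k" using q1 by (simp only: nat_mult_dvd_cancel_disj) simp
  then have "int m dvd int ?k" by (simp only: of_nat_dvd_iff)
  also have "int ?k = i mod int m" using m1 by simp
  finally show ?thesis by (simp add: dvd_mod_iff)
qed

section \<open>Subgroups with homomorphisms as cocycles\<close>

lemma (in group) inv_cancel_left: "x \<in> carrier G \<Longrightarrow> y \<in> carrier G \<Longrightarrow> inv x \<otimes> (x \<otimes> y) = y"
  by (simp add: m_assoc[symmetric])

lemma (in group) rcoset_eq_iff:
  assumes D: "subgroup D G" and x: "x \<in> carrier G" and y: "y \<in> carrier G"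
  shows "D #> x = D #> y \<longleftrightarrow> x \<otimes> inv y \<in> D"
proof
  assume "D #> x = D #> y"
  then have "x \<in> D #> y" using rcos_self[OF x D] by simp
  then obtain h where h: "h \<in> D" "x = h \<otimes> y" by (auto simp: r_coset_def)
  have "h \<in> carrier G" using subgroup.mem_carrier[OF D h(1)] .
  then have "x \<otimes> inv y = h" using y by (simp add: h(2) m_assoc)
  then show "x \<otimes> inv y \<in> D" using h(1) by simp
next
  assume h: "x \<otimes> inv y \<in> D"
  have "x = (x \<otimes> inv y) \<otimes> y" using x y by (simp add: m_assoc)
  then have "x \<in> D #> y" unfolding r_coset_def using h by blast
  then show "D #> x = D #> y" using repr_independence[OF _ y D] by simp
qed

text \<open>A divisor \<open>d\<close> of \<open>m\<close> and a finite group \<open>H\<close> of order prime to \<open>m\<close>. The case \<open>d = m\<close> is included.\<close>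

locale gamma_pairs = gamma_pres m q for m q +
  fixes d :: nat and H :: "'h monoid"
  assumes dm: "d dvd m" and H: "group H" and finH: "finite (carrier H)"
    and cop: "coprime m (card (carrier H))"
begin

sublocale H: group H by (rule H)

text \<open>The group \<open>A = \<int>/d \<times> H\<close> of labels and its central element. Neither depends on \<open>m\<close>.\<close>

definition AA :: "(int \<times> 'h) monoid" where "AA = integer_mod_group d \<times>\<times> H"
definition zA :: "int \<times> 'h" where "zA = (1 mod int d, \<one>\<^bsub>H\<^esub>)"

lemma d1: "d \<ge> 1" using dm m1 by (cases d) auto

lemma AA_simps: "carrier AA = {0..<int d} \<times> carrier H" "\<one>\<^bsub>AA\<^esub> = (0, \<one>\<^bsub>H\<^esub>)"
  "x \<otimes>\<^bsub>AA\<^esub> y = ((fst x + fst y) mod int d, snd x \<otimes>\<^bsub>H\<^esub> snd y)"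
  using d1 by (simp_all add: AA_def carrier_integer_mod_group mult_DirProd')

lemma card_AA: "card (carrier AA) = d * card (carrier H)"
  by (simp add: AA_simps card_cartesian_product)

lemma central_AA: "central_group AA zA"
proof -
  interpret A: group AA unfolding AA_def by (rule DirProd_group[OF group_integer_mod_group H])
  show ?thesis
  proof unfold_locales
    show "finite (carrier AA)" using finH by (simp add: AA_simps)
    show "zA \<in> carrier AA" using d1 by (simp add: AA_simps zA_def)
    fix x assume "x \<in> carrier AA"
    then show "zA \<otimes>\<^bsub>AA\<^esub> x = x \<otimes>\<^bsub>AA\<^esub> zA" by (auto simp: AA_simps zA_def add.commute)
  qed
qed

lemma zA_pow: "zA [^]\<^bsub>AA\<^esub> (n::nat) = (int n mod int d, \<one>\<^bsub>H\<^esub>)"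
proof -
  interpret central_group AA zA by (rule central_AA)
  show ?thesis
  proof (induction n)
    case (Suc n)
    then show ?case unfolding nat_pow_Suc Suc AA_simps by (simp add: zA_def mod_add_eq add.commute)
  qed (simp add: AA_simps)
qed

lemma wcover_AA: "wsub q W \<Longrightarrow> finite (orb W) \<Longrightarrow> gamma_coc m q AA zA W"
proof -
  assume W: "wsub q W" "finite (orb W)"
  interpret central_group AA zA by (rule central_AA)
  show ?thesis
    by unfold_locales (use W q1 dm in \<open>simp_all add: zA_pow AA_simps\<close>)
qed

text \<open>The integral powers of \<open>\<zeta>\<close>.\<close>

definition Z :: "int \<Rightarrow> xy word set" where "Z i = \<zeta> [^]\<^bsub>GG\<^esub> i"

lemma Z_closed [simp]: "Z i \<in> carrier GG" by (simp add: Z_def)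
lemma Z_add: "Z (i + j) = Z i \<otimes>\<^bsub>GG\<^esub> Z j" unfolding Z_def by (rule G.int_pow_mult[OF zeta_closed])
lemma Z_0: "Z 0 = \<one>\<^bsub>GG\<^esub>" by (simp add: Z_def)
lemma Z_1: "Z 1 = \<zeta>" unfolding Z_def by (rule G.int_pow_1[OF zeta_closed])
lemma Z_neg: "Z (- i) = inv\<^bsub>GG\<^esub> (Z i)" unfolding Z_def by (rule G.int_pow_neg[OF zeta_closed])
lemma Z_comm: "x \<in> carrier GG \<Longrightarrow> Z i \<otimes>\<^bsub>GG\<^esub> x = x \<otimes>\<^bsub>GG\<^esub> Z i" unfolding Z_def by (rule zeta_central)
lemma Z_word: "Z i = g (replicate (2 * nat (i mod int m)) gen_x)" unfolding Z_def by (rule zeta_int)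

lemma Z_m: "Z (i * int m) = \<one>\<^bsub>GG\<^esub>" by (simp add: Z_word g_Nil)

text \<open>The subgroups \<open>D\<close> whose intersection with the group generated by \<open>\<zeta>\<close> is generated by \<open>\<zeta>\<^sup>d\<close>.\<close>

definition good :: "xy word set set \<Rightarrow> bool" where
  "good D \<longleftrightarrow> subgroup D GG \<and> (\<forall>i. Z i \<in> D \<longleftrightarrow> int d dvd i)"

text \<open>Such a subgroup together with a homomorphism to \<open>H\<close>.\<close>

definition pairs where "pairs = {(D, \<chi>). good D \<and> \<chi> \<in> Hom GG D H}"

lemma goodD: assumes "good D" shows "subgroup D GG" "Z i \<in> D \<longleftrightarrow> int d dvd i"
  using assms by (auto simp: good_def)

lemma HomD:
  assumes "\<chi> \<in> Hom GG D H"
  shows "x \<in> D \<Longrightarrow> \<chi> x \<in> carrier H" "x \<in> D \<Longrightarrow> y \<in> D \<Longrightarrow> \<chi> (x \<otimes>\<^bsub>GG\<^esub> y) = \<chi> x \<otimes>\<^bsub>H\<^esub> \<chi> y"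
    "\<chi> \<in> extensional D"
  using assms by (auto simp: Hom_def hom_def)

lemma chi_one: assumes D: "good D" and c: "\<chi> \<in> Hom GG D H" shows "\<chi> \<one>\<^bsub>GG\<^esub> = \<one>\<^bsub>H\<^esub>"
proof -
  have o: "\<one>\<^bsub>GG\<^esub> \<in> D" using subgroup.one_closed[OF goodD(1)[OF D]] .
  have "\<chi> \<one>\<^bsub>GG\<^esub> = \<chi> \<one>\<^bsub>GG\<^esub> \<otimes>\<^bsub>H\<^esub> \<chi> \<one>\<^bsub>GG\<^esub>" using HomD(2)[OF c o o] by simp
  then show ?thesis using HomD(1)[OF c o] by (metis H.l_cancel_one')
qed

text \<open>The value at a power of \<open>\<zeta>\<close> has order dividing both \<open>m\<close> and \<open>|H|\<close>. This is where the
coprimality enters.\<close>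

lemma chi_Z: assumes D: "good D" and c: "\<chi> \<in> Hom GG D H" and i: "int d dvd i" shows "\<chi> (Z i) = \<one>\<^bsub>H\<^esub>"
proof -
  have ZD: "Z i \<in> D" using goodD(2)[OF D] i by blast
  have cH: "\<chi> (Z i) \<in> carrier H" by (rule HomD(1)[OF c ZD])
  have pow: "\<chi> (Z (int n * i)) = \<chi> (Z i) [^]\<^bsub>H\<^esub> n" for n
  proof (induction n)
    case 0
    show ?case using chi_one[OF D c] by (simp add: Z_0)
  next
    case (Suc n)
    have ni: "Z (int n * i) \<in> D" using goodD(2)[OF D] i by simp
    have "int (Suc n) * i = int n * i + i" by (simp add: algebra_simps)
    then show ?case by (simp only: Z_add HomD(2)[OF c ni ZD] Suc H.nat_pow_Suc)
  qed
  have "Z (int m * i) = \<one>\<^bsub>GG\<^esub>" using Z_m[of i] by (simp add: mult.commute)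
  then have "\<chi> (Z i) [^]\<^bsub>H\<^esub> m = \<one>\<^bsub>H\<^esub>" using pow[of m] chi_one[OF D c] by simp
  then show ?thesis using H.coprime_root_trivial[OF cH finH] cop by (simp add: order_def)
qed

text \<open>The image of \<open>D\<close> in \<open>C\<^sub>2 * C\<^sub>q\<close>.\<close>

definition WW :: "xy word set set \<Rightarrow> xy list set" where
  "WW D = {w. \<exists>j. g w \<otimes>\<^bsub>GG\<^esub> Z j \<in> D}"

text \<open>The function on \<open>WW D\<close> that encodes \<open>D\<close> and \<open>\<chi>\<close>: if \<open>g w \<zeta>\<^sup>j\<close> lies in \<open>D\<close>, then \<open>w\<close> is mapped to the
residue of \<open>-j\<close> and to the value of \<open>\<chi>\<close> at this element. Both are independent of \<open>j\<close>, by \<open>goodD\<close> and \<open>chi_Z\<close>.\<close>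

definition ps :: "xy word set set \<Rightarrow> (xy word set \<Rightarrow> 'h) \<Rightarrow> xy list \<Rightarrow> int \<times> 'h" where
  "ps D \<chi> = (\<lambda>w\<in>WW D. let j = (SOME j. g w \<otimes>\<^bsub>GG\<^esub> Z j \<in> D) in ((- j) mod int d, \<chi> (g w \<otimes>\<^bsub>GG\<^esub> Z j)))"

lemma ps_val:
  assumes D: "good D" and c: "\<chi> \<in> Hom GG D H" and j: "g w \<otimes>\<^bsub>GG\<^esub> Z j \<in> D"
  shows "w \<in> WW D" "ps D \<chi> w = ((- j) mod int d, \<chi> (g w \<otimes>\<^bsub>GG\<^esub> Z j))"
proof -
  show w: "w \<in> WW D" using j by (auto simp: WW_def)
  define k where "k = (SOME j. g w \<otimes>\<^bsub>GG\<^esub> Z j \<in> D)"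
  have k: "g w \<otimes>\<^bsub>GG\<^esub> Z k \<in> D" unfolding k_def using j by (rule someI)
  interpret D: subgroup D GG by (rule goodD(1)[OF D])
  have e: "g w \<otimes>\<^bsub>GG\<^esub> Z j = (g w \<otimes>\<^bsub>GG\<^esub> Z k) \<otimes>\<^bsub>GG\<^esub> Z (j - k)"
    using Z_add[of k "j - k"] by (simp add: G.m_assoc)
  have "inv\<^bsub>GG\<^esub> (g w \<otimes>\<^bsub>GG\<^esub> Z k) \<otimes>\<^bsub>GG\<^esub> (g w \<otimes>\<^bsub>GG\<^esub> Z j) \<in> D" using j k by blast
  moreover have "inv\<^bsub>GG\<^esub> (g w \<otimes>\<^bsub>GG\<^esub> Z k) \<otimes>\<^bsub>GG\<^esub> (g w \<otimes>\<^bsub>GG\<^esub> Z j) = Z (j - k)"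
    unfolding e by (rule G.inv_cancel_left) simp_all
  ultimately have jk: "Z (j - k) \<in> D" by simp
  then have dj: "int d dvd j - k" using goodD(2)[OF D] by blast
  then have "(- j) mod int d = (- k) mod int d"
    by (metis dvd_minus_iff minus_diff_eq minus_diff_minus mod_eq_dvd_iff)
  moreover have "\<chi> (g w \<otimes>\<^bsub>GG\<^esub> Z j) = \<chi> (g w \<otimes>\<^bsub>GG\<^esub> Z k)"
    unfolding e HomD(2)[OF c k jk] chi_Z[OF D c dj] using HomD(1)[OF c k] by simp
  ultimately show "ps D \<chi> w = ((- j) mod int d, \<chi> (g w \<otimes>\<^bsub>GG\<^esub> Z j))"
    using w by (simp add: ps_def k_def Let_def)
qed

lemma WW_ex: "w \<in> WW D \<Longrightarrow> \<exists>j. g w \<otimes>\<^bsub>GG\<^esub> Z j \<in> D" by (simp add: WW_def)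

lemma gZ_app: "g (u @ v) \<otimes>\<^bsub>GG\<^esub> Z (i + j) = (g u \<otimes>\<^bsub>GG\<^esub> Z i) \<otimes>\<^bsub>GG\<^esub> (g v \<otimes>\<^bsub>GG\<^esub> Z j)"
proof -
  have "g (u @ v) \<otimes>\<^bsub>GG\<^esub> Z (i + j) = g u \<otimes>\<^bsub>GG\<^esub> (g v \<otimes>\<^bsub>GG\<^esub> Z i) \<otimes>\<^bsub>GG\<^esub> Z j"
    by (simp add: g_app Z_add G.m_assoc)
  also have "g v \<otimes>\<^bsub>GG\<^esub> Z i = Z i \<otimes>\<^bsub>GG\<^esub> g v" by (rule Z_comm[OF g_closed, symmetric])
  also have "g u \<otimes>\<^bsub>GG\<^esub> (Z i \<otimes>\<^bsub>GG\<^esub> g v) \<otimes>\<^bsub>GG\<^esub> Z j = (g u \<otimes>\<^bsub>GG\<^esub> Z i) \<otimes>\<^bsub>GG\<^esub> (g v \<otimes>\<^bsub>GG\<^esub> Z j)"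
    by (simp add: G.m_assoc)
  finally show ?thesis .
qed

lemma g_rel: "g (u @ replicate (ordr q s) s @ v) \<otimes>\<^bsub>GG\<^esub> Z j = g (u @ v) \<otimes>\<^bsub>GG\<^esub> Z (j + 1)"
proof -
  have "g (u @ replicate (ordr q s) s @ v) \<otimes>\<^bsub>GG\<^esub> Z j = g u \<otimes>\<^bsub>GG\<^esub> (Z 1 \<otimes>\<^bsub>GG\<^esub> g v) \<otimes>\<^bsub>GG\<^esub> Z j"
    by (simp add: g_app g_ordr Z_1 G.m_assoc)
  also have "\<dots> = g u \<otimes>\<^bsub>GG\<^esub> (g v \<otimes>\<^bsub>GG\<^esub> Z 1) \<otimes>\<^bsub>GG\<^esub> Z j" unfolding Z_comm[OF g_closed] ..
  also have "\<dots> = g (u @ v) \<otimes>\<^bsub>GG\<^esub> Z (1 + j)" by (simp add: g_app Z_add G.m_assoc)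
  finally show ?thesis by (simp only: add.commute)
qed

lemma WW_wsub: assumes D: "good D" shows "wsub q (WW D)"
  unfolding wsub_def
proof (intro conjI ballI allI)
  interpret D: subgroup D GG by (rule goodD(1)[OF D])
  show "[] \<in> WW D" unfolding WW_def by (intro CollectI exI[of _ 0]) (simp add: g_Nil Z_0)
  fix u v assume "u \<in> WW D"
  then obtain i where i: "g u \<otimes>\<^bsub>GG\<^esub> Z i \<in> D" using WW_ex by blast
  show "u @ v \<in> WW D \<longleftrightarrow> v \<in> WW D"
  proof
    assume "v \<in> WW D"
    then obtain j where j: "g v \<otimes>\<^bsub>GG\<^esub> Z j \<in> D" using WW_ex by blast
    have "g (u @ v) \<otimes>\<^bsub>GG\<^esub> Z (i + j) \<in> D" unfolding gZ_app using i j by blast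
    then show "u @ v \<in> WW D" unfolding WW_def by blast
  next
    assume "u @ v \<in> WW D"
    then obtain l where "g (u @ v) \<otimes>\<^bsub>GG\<^esub> Z l \<in> D" using WW_ex by blast
    then have "(g u \<otimes>\<^bsub>GG\<^esub> Z i) \<otimes>\<^bsub>GG\<^esub> (g v \<otimes>\<^bsub>GG\<^esub> Z (l - i)) \<in> D" using gZ_app[of u v i "l - i"] by simp
    then have "inv\<^bsub>GG\<^esub> (g u \<otimes>\<^bsub>GG\<^esub> Z i) \<otimes>\<^bsub>GG\<^esub> ((g u \<otimes>\<^bsub>GG\<^esub> Z i) \<otimes>\<^bsub>GG\<^esub> (g v \<otimes>\<^bsub>GG\<^esub> Z (l - i))) \<in> D"
      using i by blast
    then have "g v \<otimes>\<^bsub>GG\<^esub> Z (l - i) \<in> D" by (subst (asm) G.inv_cancel_left) simp_all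
    then show "v \<in> WW D" unfolding WW_def by blast
  qed
next
  fix s u v
  show "u @ replicate (ordr q s) s @ v \<in> WW D \<longleftrightarrow> u @ v \<in> WW D"
  proof
    assume "u @ replicate (ordr q s) s @ v \<in> WW D"
    then obtain j where "g (u @ replicate (ordr q s) s @ v) \<otimes>\<^bsub>GG\<^esub> Z j \<in> D" using WW_ex by blast
    then show "u @ v \<in> WW D" unfolding g_rel WW_def by blast
  next
    assume "u @ v \<in> WW D"
    then obtain j where "g (u @ v) \<otimes>\<^bsub>GG\<^esub> Z j \<in> D" using WW_ex by blast
    then have "g (u @ replicate (ordr q s) s @ v) \<otimes>\<^bsub>GG\<^esub> Z (j - 1) \<in> D" unfolding g_rel by simp
    then show "u @ replicate (ordr q s) s @ v \<in> WW D" unfolding WW_def by blast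
  qed
qed

lemma ps_coc: assumes D: "good D" and c: "\<chi> \<in> Hom GG D H" shows "ps D \<chi> \<in> coc q AA zA (WW D)"
  unfolding coc_def
proof (intro CollectI conjI ballI allI impI)
  show "ps D \<chi> \<in> WW D \<rightarrow>\<^sub>E carrier AA"
  proof (rule PiE_I)
    fix w assume "w \<in> WW D"
    then obtain j where j: "g w \<otimes>\<^bsub>GG\<^esub> Z j \<in> D" using WW_ex by blast
    show "ps D \<chi> w \<in> carrier AA" unfolding ps_val(2)[OF D c j] using HomD(1)[OF c j] d1 by (simp add: AA_simps)
  qed (simp add: ps_def)
next
  interpret D: subgroup D GG by (rule goodD(1)[OF D])
  fix u v assume "u \<in> WW D" "v \<in> WW D"
  then obtain i j where i: "g u \<otimes>\<^bsub>GG\<^esub> Z i \<in> D" and j: "g v \<otimes>\<^bsub>GG\<^esub> Z j \<in> D" using WW_ex by blast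
  have ij: "g (u @ v) \<otimes>\<^bsub>GG\<^esub> Z (i + j) \<in> D" unfolding gZ_app using i j by blast
  have "\<chi> (g (u @ v) \<otimes>\<^bsub>GG\<^esub> Z (i + j)) = \<chi> (g u \<otimes>\<^bsub>GG\<^esub> Z i) \<otimes>\<^bsub>H\<^esub> \<chi> (g v \<otimes>\<^bsub>GG\<^esub> Z j)"
    unfolding gZ_app by (rule HomD(2)[OF c i j])
  moreover have "(- (i + j)) mod int d = ((- i) mod int d + (- j) mod int d) mod int d"
    by (simp add: mod_add_eq)
  ultimately show "ps D \<chi> (u @ v) = ps D \<chi> u \<otimes>\<^bsub>AA\<^esub> ps D \<chi> v"
    unfolding ps_val(2)[OF D c ij] ps_val(2)[OF D c i] ps_val(2)[OF D c j] AA_simps by simp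
next
  fix s u v assume "u @ v \<in> WW D"
  then obtain j where j: "g (u @ v) \<otimes>\<^bsub>GG\<^esub> Z j \<in> D" using WW_ex by blast
  have j': "g (u @ replicate (ordr q s) s @ v) \<otimes>\<^bsub>GG\<^esub> Z (j - 1) \<in> D" unfolding g_rel using j by simp
  have "(- (j - 1)) mod int d = (1 mod int d + (- j) mod int d) mod int d" by (simp add: mod_add_eq)
  moreover have "\<chi> (g (u @ v) \<otimes>\<^bsub>GG\<^esub> Z j) \<in> carrier H" by (rule HomD(1)[OF c j])
  ultimately show "ps D \<chi> (u @ replicate (ordr q s) s @ v) = zA \<otimes>\<^bsub>AA\<^esub> ps D \<chi> (u @ v)"
    unfolding ps_val(2)[OF D c j] ps_val(2)[OF D c j'] AA_simps zA_def g_rel by simp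
qed

text \<open>The subgroup \<open>D\<close> consists of the elements on which the first component vanishes.\<close>

lemma pairs_recover:
  assumes D: "good D" and c: "\<chi> \<in> Hom GG D H"
  shows "D = {x. \<exists>w\<in>WW D. x = g w \<and> fst (ps D \<chi> w) = 0}"
    "w \<in> WW D \<Longrightarrow> fst (ps D \<chi> w) = 0 \<Longrightarrow> \<chi> (g w) = snd (ps D \<chi> w)"
proof -
  have mem: "g w \<in> D \<and> \<chi> (g w) = snd (ps D \<chi> w)" if w: "w \<in> WW D" and f: "fst (ps D \<chi> w) = 0" for w
  proof -
    interpret D: subgroup D GG by (rule goodD(1)[OF D])
    obtain j where j: "g w \<otimes>\<^bsub>GG\<^esub> Z j \<in> D" using WW_ex w by blast
    have "(- j) mod int d = 0" using f unfolding ps_val(2)[OF D c j] by simp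
    then have "int d dvd - j" by (rule dvd_eq_mod_eq_0[THEN iffD2])
    then have "Z (- j) \<in> D" using goodD(2)[OF D] by blast
    then have "(g w \<otimes>\<^bsub>GG\<^esub> Z j) \<otimes>\<^bsub>GG\<^esub> Z (- j) \<in> D" using j by blast
    moreover have "(g w \<otimes>\<^bsub>GG\<^esub> Z j) \<otimes>\<^bsub>GG\<^esub> Z (- j) = g w \<otimes>\<^bsub>GG\<^esub> Z 0"
      using Z_add[of j "- j"] by (simp add: G.m_assoc)
    ultimately have 0: "g w \<otimes>\<^bsub>GG\<^esub> Z 0 \<in> D" by simp
    then have "g w \<in> D" by (simp add: Z_0)
    moreover have "\<chi> (g w) = snd (ps D \<chi> w)" unfolding ps_val(2)[OF D c 0] by (simp add: Z_0)
    ultimately show ?thesis by blast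
  qed
  show "D = {x. \<exists>w\<in>WW D. x = g w \<and> fst (ps D \<chi> w) = 0}"
  proof (intro equalityI subsetI)
    fix x assume x: "x \<in> D"
    then have "x \<in> carrier GG" using subgroup.mem_carrier[OF goodD(1)[OF D]] by blast
    then obtain w where w: "x = g w" using g_surj by blast
    have 0: "g w \<otimes>\<^bsub>GG\<^esub> Z 0 \<in> D" using x w by (simp add: Z_0)
    show "x \<in> {x. \<exists>w\<in>WW D. x = g w \<and> fst (ps D \<chi> w) = 0}"
      using ps_val[OF D c 0] w by auto
  qed (use mem in blast)
  show "w \<in> WW D \<Longrightarrow> fst (ps D \<chi> w) = 0 \<Longrightarrow> \<chi> (g w) = snd (ps D \<chi> w)" using mem by blast
qed

lemma pairs_inj: "inj_on (\<lambda>(D, \<chi>). (WW D, ps D \<chi>)) pairs"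
proof (rule inj_onI, clarify)
  fix D \<chi> D' \<chi>'
  assume p: "(D, \<chi>) \<in> pairs" "(D', \<chi>') \<in> pairs" and e: "WW D = WW D'" "ps D \<chi> = ps D' \<chi>'"
  have D: "good D" "\<chi> \<in> Hom GG D H" and D': "good D'" "\<chi>' \<in> Hom GG D' H" using p by (auto simp: pairs_def)
  have DD: "D = D'" using pairs_recover(1)[OF D] pairs_recover(1)[OF D'] unfolding e by blast
  have "\<chi> = \<chi>'"
  proof (rule extensionalityI[of _ D])
    show "\<chi> \<in> extensional D" "\<chi>' \<in> extensional D" using HomD(3)[OF D(2)] HomD(3)[OF D'(2)] DD by auto
    fix x assume "x \<in> D"
    then obtain w where w: "w \<in> WW D" "x = g w" "fst (ps D \<chi> w) = 0" using pairs_recover(1)[OF D] by blast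
    have "\<chi> x = snd (ps D \<chi> w)" unfolding w(2) by (rule pairs_recover(2)[OF D w(1,3)])
    moreover have "\<chi>' x = snd (ps D' \<chi>' w)" unfolding w(2)
      by (rule pairs_recover(2)[OF D']) (use w e in auto)
    ultimately show "\<chi> x = \<chi>' x" unfolding e by simp
  qed
  then show "D = D' \<and> \<chi> = \<chi>'" using DD by blast
qed

text \<open>Two words lead to the same coset of \<open>WW D\<close> exactly if they lead to the same coset of the product of \<open>D\<close> with
the group generated by \<open>\<zeta>\<close>.\<close>

lemma residual_eq:
  assumes D: "good D"
  shows "fold del u (WW D) = fold del v (WW D) \<longleftrightarrow> (\<exists>j. g u \<otimes>\<^bsub>GG\<^esub> Z j \<otimes>\<^bsub>GG\<^esub> inv\<^bsub>GG\<^esub> (g v) \<in> D)"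
proof
  interpret D: subgroup D GG by (rule goodD(1)[OF D])
  assume e: "fold del u (WW D) = fold del v (WW D)"
  obtain t where t: "inv\<^bsub>GG\<^esub> (g v) = g t" using g_surj[of "inv\<^bsub>GG\<^esub> (g v)"] by auto
  have "g (v @ t) \<otimes>\<^bsub>GG\<^esub> Z 0 \<in> D" unfolding g_app t[symmetric] by (simp add: Z_0)
  then have "v @ t \<in> WW D" unfolding WW_def by blast
  then have "t \<in> fold del v (WW D)" by (simp add: fold_del)
  then have "u @ t \<in> WW D" unfolding e[symmetric] by (simp add: fold_del)
  then obtain j where "g (u @ t) \<otimes>\<^bsub>GG\<^esub> Z (j + 0) \<in> D" using WW_ex by auto
  then show "\<exists>j. g u \<otimes>\<^bsub>GG\<^esub> Z j \<otimes>\<^bsub>GG\<^esub> inv\<^bsub>GG\<^esub> (g v) \<in> D"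
    unfolding gZ_app t by (intro exI[of _ j]) (simp add: Z_0)
next
  interpret D: subgroup D GG by (rule goodD(1)[OF D])
  assume "\<exists>j. g u \<otimes>\<^bsub>GG\<^esub> Z j \<otimes>\<^bsub>GG\<^esub> inv\<^bsub>GG\<^esub> (g v) \<in> D"
  then obtain j where j: "g u \<otimes>\<^bsub>GG\<^esub> Z j \<otimes>\<^bsub>GG\<^esub> inv\<^bsub>GG\<^esub> (g v) \<in> D" by blast
  let ?x = "g u \<otimes>\<^bsub>GG\<^esub> Z j \<otimes>\<^bsub>GG\<^esub> inv\<^bsub>GG\<^esub> (g v)"
  have x: "?x \<otimes>\<^bsub>GG\<^esub> (g (v @ t) \<otimes>\<^bsub>GG\<^esub> Z i) = g (u @ t) \<otimes>\<^bsub>GG\<^esub> Z (j + i)" for t i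
  proof -
    have "?x \<otimes>\<^bsub>GG\<^esub> (g (v @ t) \<otimes>\<^bsub>GG\<^esub> Z i) = g u \<otimes>\<^bsub>GG\<^esub> Z j \<otimes>\<^bsub>GG\<^esub> ((inv\<^bsub>GG\<^esub> (g v) \<otimes>\<^bsub>GG\<^esub> g v) \<otimes>\<^bsub>GG\<^esub> (g t \<otimes>\<^bsub>GG\<^esub> Z i))"
      unfolding g_app by (simp only: G.m_assoc g_closed Z_closed G.inv_closed G.m_closed)
    then show ?thesis unfolding gZ_app by simp
  qed
  have "u @ t \<in> WW D \<longleftrightarrow> v @ t \<in> WW D" for t
  proof
    assume "v @ t \<in> WW D"
    then obtain i where "g (v @ t) \<otimes>\<^bsub>GG\<^esub> Z i \<in> D" using WW_ex by blast
    then have "g (u @ t) \<otimes>\<^bsub>GG\<^esub> Z (j + i) \<in> D" unfolding x[symmetric] using j by blast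
    then show "u @ t \<in> WW D" unfolding WW_def by blast
  next
    assume "u @ t \<in> WW D"
    then obtain l where "g (u @ t) \<otimes>\<^bsub>GG\<^esub> Z (j + (l - j)) \<in> D" using WW_ex by force
    then have "?x \<otimes>\<^bsub>GG\<^esub> (g (v @ t) \<otimes>\<^bsub>GG\<^esub> Z (l - j)) \<in> D" unfolding x .
    then have "inv\<^bsub>GG\<^esub> ?x \<otimes>\<^bsub>GG\<^esub> (?x \<otimes>\<^bsub>GG\<^esub> (g (v @ t) \<otimes>\<^bsub>GG\<^esub> Z (l - j))) \<in> D" using j by blast
    moreover have "inv\<^bsub>GG\<^esub> ?x \<otimes>\<^bsub>GG\<^esub> (?x \<otimes>\<^bsub>GG\<^esub> y) = y" if "y \<in> carrier GG" for y
      using that by (intro G.inv_cancel_left) simp_all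
    ultimately have "g (v @ t) \<otimes>\<^bsub>GG\<^esub> Z (l - j) \<in> D" by simp
    then show "v @ t \<in> WW D" unfolding WW_def by blast
  qed
  then show "fold del u (WW D) = fold del v (WW D)" by (simp add: fold_del)
qed

text \<open>A coset of \<open>D\<close> is given by a coset of \<open>WW D\<close> and by a residue modulo \<open>d\<close>.\<close>

lemma index_bij:
  assumes D: "good D"
  shows "\<exists>h. bij_betw h (orb (WW D) \<times> {0..<int d}) (rcosets\<^bsub>GG\<^esub> D)"
proof -
  have sD: "subgroup D GG" by (rule goodD(1)[OF D])
  interpret D: subgroup D GG by (rule sD)
  define t where "t V = (SOME w. fold del w (WW D) = V)" for V
  have t: "fold del (t V) (WW D) = V" if "V \<in> orb (WW D)" for V
  proof -
    have "\<exists>w. fold del w (WW D) = V" using that unfolding orb_def by blast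
    then show ?thesis unfolding t_def by (rule someI_ex)
  qed
  define h where "h = (\<lambda>(V, j). D #>\<^bsub>GG\<^esub> (g (t V) \<otimes>\<^bsub>GG\<^esub> Z j))"
  have "bij_betw h (orb (WW D) \<times> {0..<int d}) (rcosets\<^bsub>GG\<^esub> D)"
  proof (rule bij_betw_imageI)
    show "inj_on h (orb (WW D) \<times> {0..<int d})"
    proof (rule inj_onI, clarify)
      fix V i V' j
      assume V: "V \<in> orb (WW D)" "V' \<in> orb (WW D)" and ij: "i \<in> {0..<int d}" "j \<in> {0..<int d}"
        and e: "h (V, i) = h (V', j)"
      have "(g (t V) \<otimes>\<^bsub>GG\<^esub> Z i) \<otimes>\<^bsub>GG\<^esub> inv\<^bsub>GG\<^esub> (g (t V') \<otimes>\<^bsub>GG\<^esub> Z j) \<in> D"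
        using e unfolding h_def prod.case by (subst (asm) G.rcoset_eq_iff[OF sD]) simp_all
      moreover have x: "(g (t V) \<otimes>\<^bsub>GG\<^esub> Z i) \<otimes>\<^bsub>GG\<^esub> inv\<^bsub>GG\<^esub> (g (t V') \<otimes>\<^bsub>GG\<^esub> Z j)
          = g (t V) \<otimes>\<^bsub>GG\<^esub> Z (i - j) \<otimes>\<^bsub>GG\<^esub> inv\<^bsub>GG\<^esub> (g (t V'))"
        using Z_add[of i "- j"] by (simp add: G.inv_mult_group Z_neg G.m_assoc)
      ultimately have in_D: "g (t V) \<otimes>\<^bsub>GG\<^esub> Z (i - j) \<otimes>\<^bsub>GG\<^esub> inv\<^bsub>GG\<^esub> (g (t V')) \<in> D" by simp
      then have "fold del (t V) (WW D) = fold del (t V') (WW D)" unfolding residual_eq[OF D] by blast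
      then have VV: "V = V'" unfolding t[OF V(1)] t[OF V(2)] .
      have "g (t V) \<otimes>\<^bsub>GG\<^esub> Z (i - j) \<otimes>\<^bsub>GG\<^esub> inv\<^bsub>GG\<^esub> (g (t V)) = Z (i - j)"
        by (simp add: Z_comm[symmetric] G.m_assoc)
      then have "Z (i - j) \<in> D" using in_D unfolding VV by simp
      then have "int d dvd i - j" using goodD(2)[OF D] by blast
      then have "i mod int d = j mod int d" by (simp only: mod_eq_dvd_iff)
      then show "V = V' \<and> i = j" using VV ij by simp
    qed
    show "h ` (orb (WW D) \<times> {0..<int d}) = rcosets\<^bsub>GG\<^esub> D"
    proof (intro equalityI subsetI)
      fix C assume "C \<in> h ` (orb (WW D) \<times> {0..<int d})"
      then show "C \<in> rcosets\<^bsub>GG\<^esub> D" by (auto simp: h_def RCOSETS_def)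
    next
      fix C assume "C \<in> rcosets\<^bsub>GG\<^esub> D"
      then obtain x where x: "x \<in> carrier GG" "C = D #>\<^bsub>GG\<^esub> x" by (auto simp: RCOSETS_def)
      then obtain w where w: "x = g w" using g_surj by blast
      let ?V = "fold del w (WW D)"
      have V: "?V \<in> orb (WW D)" unfolding orb_def by blast
      have "fold del w (WW D) = fold del (t ?V) (WW D)" unfolding t[OF V] ..
      then obtain j where j: "g w \<otimes>\<^bsub>GG\<^esub> Z j \<otimes>\<^bsub>GG\<^esub> inv\<^bsub>GG\<^esub> (g (t ?V)) \<in> D" unfolding residual_eq[OF D] by blast
      let ?i = "(- j) mod int d"
      have "int d dvd (- ?i) - j" by (metis add_uminus_conv_diff diff_minus_eq_add dvd_minus_iff minus_diff_eq mod_eq_dvd_iff mod_mod_trivial uminus_add_conv_diff)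
      then have "Z (- ?i - j) \<in> D" using goodD(2)[OF D] by blast
      then have "(g w \<otimes>\<^bsub>GG\<^esub> Z j \<otimes>\<^bsub>GG\<^esub> inv\<^bsub>GG\<^esub> (g (t ?V))) \<otimes>\<^bsub>GG\<^esub> Z (- ?i - j) \<in> D" using j by blast
      moreover have "(g w \<otimes>\<^bsub>GG\<^esub> Z j \<otimes>\<^bsub>GG\<^esub> inv\<^bsub>GG\<^esub> (g (t ?V))) \<otimes>\<^bsub>GG\<^esub> Z (- ?i - j) = g w \<otimes>\<^bsub>GG\<^esub> inv\<^bsub>GG\<^esub> (g (t ?V) \<otimes>\<^bsub>GG\<^esub> Z ?i)"
      proof -
        have "(g w \<otimes>\<^bsub>GG\<^esub> Z j \<otimes>\<^bsub>GG\<^esub> inv\<^bsub>GG\<^esub> (g (t ?V))) \<otimes>\<^bsub>GG\<^esub> Z (- ?i - j)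
          = g w \<otimes>\<^bsub>GG\<^esub> (Z j \<otimes>\<^bsub>GG\<^esub> (inv\<^bsub>GG\<^esub> (g (t ?V)) \<otimes>\<^bsub>GG\<^esub> Z (- ?i - j)))" by (simp add: G.m_assoc)
        also have "inv\<^bsub>GG\<^esub> (g (t ?V)) \<otimes>\<^bsub>GG\<^esub> Z (- ?i - j) = Z (- ?i - j) \<otimes>\<^bsub>GG\<^esub> inv\<^bsub>GG\<^esub> (g (t ?V))"
          by (rule Z_comm[symmetric]) simp
        also have "Z j \<otimes>\<^bsub>GG\<^esub> (Z (- ?i - j) \<otimes>\<^bsub>GG\<^esub> inv\<^bsub>GG\<^esub> (g (t ?V))) = Z (- ?i) \<otimes>\<^bsub>GG\<^esub> inv\<^bsub>GG\<^esub> (g (t ?V))"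
          using Z_add[of j "- ?i - j"] by (simp add: G.m_assoc[symmetric])
        also have "\<dots> = inv\<^bsub>GG\<^esub> (g (t ?V) \<otimes>\<^bsub>GG\<^esub> Z ?i)" unfolding Z_neg by (simp add: G.inv_mult_group)
        finally show ?thesis .
      qed
      ultimately have "D #>\<^bsub>GG\<^esub> g w = D #>\<^bsub>GG\<^esub> (g (t ?V) \<otimes>\<^bsub>GG\<^esub> Z ?i)"
        by (subst G.rcoset_eq_iff[OF sD]) simp_all
      then have "C = h (?V, ?i)" unfolding x(2) w h_def by simp
      moreover have "?i \<in> {0..<int d}" using d1 by simp
      ultimately show "C \<in> h ` (orb (WW D) \<times> {0..<int d})" using V by blast
    qed
  qed
  then show ?thesis by blast
qed

lemma index_card: assumes "good D" shows "card (rcosets\<^bsub>GG\<^esub> D) = card (orb (WW D)) * d"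
proof -
  obtain h where "bij_betw h (orb (WW D) \<times> {0..<int d}) (rcosets\<^bsub>GG\<^esub> D)" using index_bij[OF assms] by blast
  from bij_betw_same_card[OF this] show ?thesis by (simp add: card_cartesian_product)
qed

end

section \<open>Sums over subgroups and their parity\<close>

context gamma_pairs begin

text \<open>Conversely a cocycle \<open>\<psi>\<close> on \<open>W\<close> defines \<open>D\<close> as the set of elements on which its first component vanishes,
and \<open>\<chi>\<close> as its second component.\<close>

lemma pairs_surj:
  assumes W: "wsub q W" "finite (orb W)" and p: "\<psi> \<in> coc q AA zA W"
  shows "\<exists>D \<chi>. (D, \<chi>) \<in> pairs \<and> WW D = W \<and> ps D \<chi> = \<psi>"
proof -
  interpret C: gamma_coc m q AA zA W by (rule wcover_AA[OF W])
  note pc = C.cocD[OF p]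
  define D where "D = {x. \<exists>w\<in>W. x = g w \<and> fst (\<psi> w) = 0}"
  define \<chi> where "\<chi> = (\<lambda>x\<in>D. snd (\<psi> (SOME w. w \<in> W \<and> x = g w)))"
  have inD: "g w \<in> D \<longleftrightarrow> w \<in> W \<and> fst (\<psi> w) = 0" for w
  proof
    assume "g w \<in> D"
    then obtain v where v: "v \<in> W" "g v = g w" "fst (\<psi> v) = 0" unfolding D_def by auto
    then show "w \<in> W \<and> fst (\<psi> w) = 0" using C.coc_g[OF p v(2)] by simp
  qed (auto simp: D_def)
  have chi: "\<chi> (g w) = snd (\<psi> w)" if "g w \<in> D" for w
  proof -
    have w: "w \<in> W" using that inD by blast
    let ?v = "SOME v. v \<in> W \<and> g w = g v"
    have v: "?v \<in> W \<and> g w = g ?v" by (rule someI[where x = w]) (use w in simp)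
    have "\<psi> w = \<psi> ?v" by (rule C.coc_g(2)[OF p _ w]) (use v in blast)
    then show ?thesis using that by (simp add: \<chi>_def)
  qed
  have val: "fst (\<psi> w) \<in> {0..<int d}" "snd (\<psi> w) \<in> carrier H" if "w \<in> W" for w
    using pc(1)[OF that] by (auto simp: AA_simps)
  have psi_Nil: "\<psi> [] = (0, \<one>\<^bsub>H\<^esub>)" using C.coc_Nil[OF p] by (simp add: AA_simps)
  have Dsub: "subgroup D GG"
  proof (rule subgroup.intro)
    show "D \<subseteq> carrier GG" by (auto simp: D_def)
    show "\<one>\<^bsub>GG\<^esub> \<in> D" unfolding g_Nil[symmetric] inD using C.W_Nil psi_Nil by simp
    fix x y assume "x \<in> D" "y \<in> D"
    then obtain u v where uv: "x = g u" "y = g v" "u \<in> W" "v \<in> W" "fst (\<psi> u) = 0" "fst (\<psi> v) = 0" unfolding D_def by blast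
    have "g (u @ v) \<in> D" unfolding inD using uv pc(2)[OF uv(3,4)] C.W_app[OF uv(3), of v] by (simp add: AA_simps)
    then show "x \<otimes>\<^bsub>GG\<^esub> y \<in> D" unfolding uv(1,2) g_app .
  next
    fix x assume "x \<in> D"
    then obtain u where u: "x = g u" "u \<in> W" "fst (\<psi> u) = 0" unfolding D_def by blast
    obtain t where t: "inv\<^bsub>GG\<^esub> (g u) = g t" using g_surj[of "inv\<^bsub>GG\<^esub> (g u)"] by auto
    have e: "g (u @ t) = g []" unfolding g_app t[symmetric] g_Nil by simp
    have ut: "u @ t \<in> W" using C.coc_g(1)[OF p e] C.W_Nil by blast
    have tW: "t \<in> W" using C.W_app[OF u(2), of t] ut by blast
    have "\<psi> (u @ t) = (0, \<one>\<^bsub>H\<^esub>)" using C.coc_g(2)[OF p e ut] psi_Nil by simp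
    then have "(0 + fst (\<psi> t)) mod int d = 0" using pc(2)[OF u(2) tW] u(3) by (simp add: AA_simps)
    then have "fst (\<psi> t) = 0" using val(1)[OF tW] by simp
    then show "inv\<^bsub>GG\<^esub> x \<in> D" unfolding u(1) t inD using tW by blast
  qed
  have shift: "(w @ replicate (2 * nat (i mod int m)) gen_x \<in> W \<longleftrightarrow> w \<in> W) \<and>
     (w \<in> W \<longrightarrow> \<psi> (w @ replicate (2 * nat (i mod int m)) gen_x) = ((i + fst (\<psi> w)) mod int d, snd (\<psi> w)))" for w i
  proof -
    let ?j = "nat (i mod int m)"
    have j: "int ?j mod int d = i mod int d" using m1 dm by (simp add: mod_mod_cancel)
    have "\<psi> (w @ replicate (ordr q gen_x * ?j) gen_x @ []) = ((i + fst (\<psi> w)) mod int d, snd (\<psi> w))" if w: "w \<in> W"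
    proof -
      have w0: "w @ [] \<in> W" using w by simp
      have "\<psi> (w @ replicate (ordr q gen_x * ?j) gen_x @ []) = zA [^]\<^bsub>AA\<^esub> ?j \<otimes>\<^bsub>AA\<^esub> \<psi> (w @ [])"
        by (rule C.coc_block(2)[OF p w0])
      also have "\<dots> = ((i mod int d + fst (\<psi> w)) mod int d, \<one>\<^bsub>H\<^esub> \<otimes>\<^bsub>H\<^esub> snd (\<psi> w))"
        unfolding zA_pow j AA_simps fst_conv snd_conv append_Nil2 ..
      also have "\<dots> = ((i + fst (\<psi> w)) mod int d, snd (\<psi> w))"
        using val(2)[OF w] by (simp add: mod_add_left_eq)
      finally show ?thesis .
    qed
    moreover have "w @ replicate (ordr q gen_x * ?j) gen_x @ [] \<in> W \<longleftrightarrow> w \<in> W"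
      using C.coc_block(1)[OF p, where a = w and s = gen_x and j = ?j and b = "[]"] by simp
    ultimately show ?thesis by simp
  qed
  have gZ: "g w \<otimes>\<^bsub>GG\<^esub> Z i = g (w @ replicate (2 * nat (i mod int m)) gen_x)" for w i
    by (simp only: Z_word g_app)
  have gZD: "g w \<otimes>\<^bsub>GG\<^esub> Z i \<in> D \<longleftrightarrow> w \<in> W \<and> int d dvd i + fst (\<psi> w)" for w i
    unfolding gZ inD using shift[of w i] by (auto simp: dvd_eq_mod_eq_0)
  have "Z i \<in> D \<longleftrightarrow> int d dvd i" for i
    using gZD[of "[]" i] C.W_Nil psi_Nil by (simp add: g_Nil)
  then have good: "good D" using Dsub by (simp add: good_def)
  have "\<chi> \<in> Hom GG D H"
    unfolding Hom_def hom_def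
  proof (intro IntI CollectI conjI ballI)
    show "\<chi> \<in> extensional D" by (simp add: \<chi>_def)
    show "\<chi> \<in> carrier (GG\<lparr>carrier := D\<rparr>) \<rightarrow> carrier H"
    proof
      fix x assume "x \<in> carrier (GG\<lparr>carrier := D\<rparr>)"
      then have "x \<in> D" by simp
      then obtain w where w: "x = g w" "w \<in> W" unfolding D_def by blast
      then show "\<chi> x \<in> carrier H" using chi[of w] \<open>x \<in> D\<close> val(2)[OF w(2)] by simp
    qed
    fix x y assume "x \<in> carrier (GG\<lparr>carrier := D\<rparr>)" "y \<in> carrier (GG\<lparr>carrier := D\<rparr>)"
    then have xy: "x \<in> D" "y \<in> D" by simp_all
    obtain u v where uv: "x = g u" "y = g v" "u \<in> W" "v \<in> W" using xy unfolding D_def by blast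
    have "g (u @ v) \<in> D" using subgroup.m_closed[OF Dsub xy] unfolding uv(1,2) g_app .
    then have "\<chi> (g (u @ v)) = snd (\<psi> u) \<otimes>\<^bsub>H\<^esub> snd (\<psi> v)" using chi[of "u @ v"] pc(2)[OF uv(3,4)] by (simp add: AA_simps)
    then show "\<chi> (x \<otimes>\<^bsub>GG\<lparr>carrier := D\<rparr>\<^esub> y) = \<chi> x \<otimes>\<^bsub>H\<^esub> \<chi> y"
      using chi xy unfolding uv(1,2) g_app by simp
  qed
  note c = this
  have WD: "WW D = W"
  proof (intro equalityI subsetI)
    fix w assume "w \<in> WW D"
    then show "w \<in> W" using WW_ex gZD by blast
  next
    fix w assume "w \<in> W"
    then have "g w \<otimes>\<^bsub>GG\<^esub> Z (- fst (\<psi> w)) \<in> D" unfolding gZD by simp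
    then show "w \<in> WW D" unfolding WW_def by blast
  qed
  have "ps D \<chi> = \<psi>"
  proof (rule extensionalityI[of _ W])
    show "ps D \<chi> \<in> extensional W" unfolding WD[symmetric] by (simp add: ps_def)
    show "\<psi> \<in> extensional W" using pc(4) by (simp add: PiE_def)
    fix w assume w: "w \<in> W"
    let ?i = "- fst (\<psi> w)"
    have j: "g w \<otimes>\<^bsub>GG\<^esub> Z ?i \<in> D" unfolding gZD using w by simp
    have "\<chi> (g w \<otimes>\<^bsub>GG\<^esub> Z ?i) = snd (\<psi> w)"
      using chi j shift[of w ?i] w unfolding gZ by simp
    moreover have "(- ?i) mod int d = fst (\<psi> w)" using val(1)[OF w] by simp
    ultimately show "ps D \<chi> w = \<psi> w" unfolding ps_val(2)[OF good c j] by simp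
  qed
  then show ?thesis using good c WD by (auto simp: pairs_def)
qed

text \<open>The pairs with a subgroup of index \<open>n\<close>.\<close>

definition pairs_n :: "nat \<Rightarrow> (xy word set set \<times> (xy word set \<Rightarrow> 'h)) set" where
  "pairs_n n = {(D, \<chi>) \<in> pairs. card (rcosets\<^bsub>GG\<^esub> D) = n}"

lemma finite_coc_AA: "W \<in> subs q N \<Longrightarrow> finite (coc q AA zA W)"
proof -
  assume W: "W \<in> subs q N"
  interpret C: gamma_coc m q AA zA W by (rule wcover_AA) (use W in \<open>auto simp: subs_def\<close>)
  show ?thesis by (rule C.finite_coc)
qed

lemma card_pairs:
  assumes n: "n \<ge> 1"
  shows "finite (pairs_n n)"
    "card (pairs_n n) = (if d dvd n then \<Sum>W\<in>subs q (n div d). card (coc q AA zA W) else 0)"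
proof -
  let ?F = "\<lambda>(D, \<chi>). (WW D, ps D \<chi>)"
  let ?S = "Sigma (subs q (n div d)) (\<lambda>W. coc q AA zA W)"
  have fs: "finite (subs q N)" for N by (rule finite_subs) (use q1 in simp)
  have img: "WW D \<in> subs q (n div d) \<and> ps D \<chi> \<in> coc q AA zA (WW D) \<and> d dvd n" if p: "(D, \<chi>) \<in> pairs_n n" for D \<chi>
  proof -
    have D: "good D" "\<chi> \<in> Hom GG D H" and c: "card (orb (WW D)) * d = n"
      using p index_card[of D] by (auto simp: pairs_n_def pairs_def)
    have "card (orb (WW D)) \<noteq> 0" using c n by (cases "card (orb (WW D)) = 0") auto
    then have "finite (orb (WW D))" by (meson card.infinite)
    then show ?thesis using WW_wsub[OF D(1)] ps_coc[OF D] c d1 by (auto simp: subs_def)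
  qed
  have inj: "inj_on ?F (pairs_n n)" using pairs_inj by (rule inj_on_subset) (auto simp: pairs_n_def)
  have "finite (pairs_n n) \<and> card (pairs_n n) = (if d dvd n then \<Sum>W\<in>subs q (n div d). card (coc q AA zA W) else 0)"
  proof (cases "d dvd n")
    case True
    have "?F ` pairs_n n = ?S"
    proof (intro equalityI subsetI)
      fix a assume "a \<in> ?F ` pairs_n n"
      then show "a \<in> ?S" using img by auto
    next
      fix a assume "a \<in> ?S"
      then obtain W \<psi> where a: "a = (W, \<psi>)" "W \<in> subs q (n div d)" "\<psi> \<in> coc q AA zA W" by auto
      then obtain D \<chi> where D: "(D, \<chi>) \<in> pairs" "WW D = W" "ps D \<chi> = \<psi>"
        using pairs_surj[of W \<psi>] by (auto simp: subs_def)
      have "card (rcosets\<^bsub>GG\<^esub> D) = n"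
        using index_card[of D] D a(2) True by (auto simp: pairs_def subs_def)
      then have "(D, \<chi>) \<in> pairs_n n" using D(1) by (simp add: pairs_n_def)
      then show "a \<in> ?F ` pairs_n n" using D a(1) by force
    qed
    then have b: "bij_betw ?F (pairs_n n) ?S" using inj by (simp add: bij_betw_def)
    have fS: "finite ?S" using fs finite_coc_AA by blast
    have "\<forall>W\<in>subs q (n div d). finite (coc q AA zA W)" using finite_coc_AA by blast
    then have "card ?S = (\<Sum>W\<in>subs q (n div d). card (coc q AA zA W))" by (rule card_SigmaI[OF fs])
    then show ?thesis using bij_betw_same_card[OF b] bij_betw_finite[OF b] fS True by simp
  next
    case False
    then have "pairs_n n = {}" using img by auto
    then show ?thesis using False by simp
  qed
  then show "finite (pairs_n n)"
    "card (pairs_n n) = (if d dvd n then \<Sum>W\<in>subs q (n div d). card (coc q AA zA W) else 0)" by blast+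
qed

lemma triv_Hom: assumes "good D" shows "(\<lambda>x\<in>D. \<one>\<^bsub>H\<^esub>) \<in> Hom GG D H"
  using subgroup.m_closed[OF goodD(1)[OF assms]] by (auto simp: Hom_def hom_def)

text \<open>The right-hand side depends on \<open>d\<close>, \<open>q\<close>, \<open>H\<close> and \<open>n\<close>, but not on \<open>m\<close>.\<close>

lemma hom_sum_good:
  assumes n: "n \<ge> 1"
  shows "finite {D. good D \<and> card (rcosets\<^bsub>GG\<^esub> D) = n}"
    "(\<Sum>D | good D \<and> card (rcosets\<^bsub>GG\<^esub> D) = n. card (Hom GG D H))
      = (if d dvd n then \<Sum>W\<in>subs q (n div d). card (coc q AA zA W) else 0)"
proof -
  let ?S = "{D. good D \<and> card (rcosets\<^bsub>GG\<^esub> D) = n}"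
  have e: "pairs_n n = Sigma ?S (\<lambda>D. Hom GG D H)" by (auto simp: pairs_n_def pairs_def)
  \<comment> \<open>Every subgroup has the trivial homomorphism, so there are only finitely many subgroups.\<close>
  have "?S = fst ` pairs_n n"
  proof (intro equalityI subsetI)
    fix D assume D: "D \<in> ?S"
    then have "(D, \<lambda>x\<in>D. \<one>\<^bsub>H\<^esub>) \<in> pairs_n n" unfolding e using triv_Hom by blast
    then show "D \<in> fst ` pairs_n n" by force
  qed (auto simp: e)
  then show fS: "finite ?S" using card_pairs(1)[OF n] by simp
  have "finite (Hom GG D H)" if "D \<in> ?S" for D
  proof -
    have "Hom GG D H \<subseteq> snd ` pairs_n n" unfolding e using that by force
    then show ?thesis using card_pairs(1)[OF n] finite_surj by blast
  qed
  then have "card (pairs_n n) = (\<Sum>D\<in>?S. card (Hom GG D H))" unfolding e by (intro card_SigmaI[OF fS]) blast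
  then show "(\<Sum>D | good D \<and> card (rcosets\<^bsub>GG\<^esub> D) = n. card (Hom GG D H))
      = (if d dvd n then \<Sum>W\<in>subs q (n div d). card (coc q AA zA W) else 0)"
    using card_pairs(2)[OF n] by simp
qed

lemma AA_pow: "x \<in> carrier AA \<Longrightarrow> x [^]\<^bsub>AA\<^esub> (n::nat) = ((int n * fst x) mod int d, snd x [^]\<^bsub>H\<^esub> n)"
proof -
  assume x: "x \<in> carrier AA"
  interpret C: central_group AA zA by (rule central_AA)
  show ?thesis
  proof (induction n)
    case (Suc n)
    have "(int n * fst x mod int d + fst x) mod int d = (int n * fst x + fst x) mod int d" by (rule mod_add_left_eq)
    also have "int n * fst x + fst x = int (Suc n) * fst x" by (simp add: algebra_simps)
    finally show ?case unfolding C.nat_pow_Suc Suc AA_simps by simp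
  qed (simp add: AA_simps)
qed

lemma card_mod_inverse:
  fixes l :: nat
  assumes l: "Factorial_Ring.prime l"
  shows "card {i \<in> {0..<int d}. (int l * i) mod int d = 1 mod int d} = (if l dvd d then 0 else 1)"
proof (cases "l dvd d")
  case True
  have "{i \<in> {0..<int d}. (int l * i) mod int d = 1 mod int d} = {}"
  proof (rule ccontr)
    assume "\<not> ?thesis"
    then obtain i where "(int l * i) mod int d = 1 mod int d" by blast
    then have "int d dvd int l * i - 1" by (simp only: mod_eq_dvd_iff)
    moreover have "int l dvd int d" using True by simp
    ultimately have "int l dvd int l * i - 1" by (meson dvd_trans)
    then have "int l dvd 1" by (metis dvd_diffD1 dvd_triv_left dvd_diff_commute dvd_add_right_iff diff_add_cancel)
    then show False using l by auto
  qed
  from arg_cong[OF this, of card] show ?thesis unfolding card.empty using True by simp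
next
  case False
  have "coprime l d" using l False by (rule prime_imp_coprime)
  then have cp: "coprime (int l) (int d)" by simp
  obtain x where x: "[int l * x = 1] (mod int d)" using cong_solve_coprime_int[OF cp] by blast
  have "{i \<in> {0..<int d}. (int l * i) mod int d = 1 mod int d} = {x mod int d}"
  proof (intro equalityI subsetI)
    fix i assume i: "i \<in> {i \<in> {0..<int d}. (int l * i) mod int d = 1 mod int d}"
    then have "[int l * i = int l * x] (mod int d)" using x by (simp add: cong_def)
    then have "[i = x] (mod int d)" using cong_mult_lcancel[OF cp] by blast
    then show "i \<in> {x mod int d}" using i by (simp add: cong_def)
  next
    fix i assume "i \<in> {x mod int d}"
    then show "i \<in> {i \<in> {0..<int d}. (int l * i) mod int d = 1 mod int d}"
      using x d1 by (simp add: cong_def mod_mult_right_eq)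
  qed
  from arg_cong[OF this, of card] show ?thesis using False by simp
qed

text \<open>An \<open>l\<close>-th root of the central element of \<open>A\<close> consists of an inverse of \<open>l\<close> modulo \<open>d\<close> and an \<open>l\<close>-th root
of 1 in \<open>H\<close>.\<close>

lemma card_roots:
  assumes l: "Factorial_Ring.prime l"
  shows "card {\<alpha> \<in> carrier AA. \<alpha> [^]\<^bsub>AA\<^esub> l = zA}
    = (if l dvd d then 0 else card {h \<in> carrier H. h [^]\<^bsub>H\<^esub> l = \<one>\<^bsub>H\<^esub>})"
proof -
  have "{\<alpha> \<in> carrier AA. \<alpha> [^]\<^bsub>AA\<^esub> l = zA}
    = {i \<in> {0..<int d}. (int l * i) mod int d = 1 mod int d} \<times> {h \<in> carrier H. h [^]\<^bsub>H\<^esub> l = \<one>\<^bsub>H\<^esub>}"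
    using AA_pow by (auto simp: AA_simps zA_def)
  from arg_cong[OF this, of card] show ?thesis unfolding card_cartesian_product card_mod_inverse[OF l] by simp
qed

lemma inv_fixed_iff: "h \<in> carrier H \<Longrightarrow> inv\<^bsub>H\<^esub> h = h \<longleftrightarrow> h [^]\<^bsub>H\<^esub> (2::nat) = \<one>\<^bsub>H\<^esub>"
proof -
  assume h: "h \<in> carrier H"
  have "h [^]\<^bsub>H\<^esub> (2::nat) = h \<otimes>\<^bsub>H\<^esub> h" using h by (simp add: numeral_2_eq_2)
  moreover have "inv\<^bsub>H\<^esub> h = h \<longleftrightarrow> h \<otimes>\<^bsub>H\<^esub> h = \<one>\<^bsub>H\<^esub>"
    by (metis H.inv_equality H.r_inv h)
  ultimately show ?thesis by (simp only:)
qed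

lemma square_roots_parity: "odd (card {h \<in> carrier H. h [^]\<^bsub>H\<^esub> (2::nat) = \<one>\<^bsub>H\<^esub>}) \<longleftrightarrow> odd (card (carrier H))"
proof -
  obtain k where "card (carrier H) = card {h \<in> carrier H. inv\<^bsub>H\<^esub> h = h} + 2 * k"
    using involution_card[OF finH, of "\<lambda>h. inv\<^bsub>H\<^esub> h"] by auto
  moreover have "{h \<in> carrier H. inv\<^bsub>H\<^esub> h = h} = {h \<in> carrier H. h [^]\<^bsub>H\<^esub> (2::nat) = \<one>\<^bsub>H\<^esub>}"
    using inv_fixed_iff by blast
  ultimately show ?thesis by simp
qed

lemma odd_roots_odd:
  assumes q: "odd q"
  shows "odd (card {h \<in> carrier H. h [^]\<^bsub>H\<^esub> q = \<one>\<^bsub>H\<^esub>})"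
proof -
  let ?S = "{h \<in> carrier H. h [^]\<^bsub>H\<^esub> q = \<one>\<^bsub>H\<^esub>}"
  have fS: "finite ?S" using finH by simp
  have 1: "inv\<^bsub>H\<^esub> h \<in> ?S" if "h \<in> ?S" for h using that H.nat_pow_inv[of h q] by simp
  have 2: "inv\<^bsub>H\<^esub> (inv\<^bsub>H\<^esub> h) = h" if "h \<in> ?S" for h using that by simp
  obtain k where k: "card ?S = card {h \<in> ?S. inv\<^bsub>H\<^esub> h = h} + 2 * k"
    using involution_card[of ?S "\<lambda>h. inv\<^bsub>H\<^esub> h", OF fS 1 2] by blast
  have "{h \<in> ?S. inv\<^bsub>H\<^esub> h = h} = {\<one>\<^bsub>H\<^esub>}"
  proof (intro equalityI subsetI)
    fix h assume "h \<in> {h \<in> ?S. inv\<^bsub>H\<^esub> h = h}"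
    then have h: "h \<in> carrier H" "h [^]\<^bsub>H\<^esub> q = \<one>\<^bsub>H\<^esub>" "h [^]\<^bsub>H\<^esub> (2::nat) = \<one>\<^bsub>H\<^esub>"
      using inv_fixed_iff by auto
    obtain j where j: "q = 2 * j + 1" using q by (auto elim: oddE)
    have "h [^]\<^bsub>H\<^esub> (2 * j) = \<one>\<^bsub>H\<^esub>" using H.nat_pow_pow[OF h(1), of 2 j] h(3) by simp
    then have "h [^]\<^bsub>H\<^esub> (2 * j + 1) = h" using h(1) by simp
    then have "h = \<one>\<^bsub>H\<^esub>" using h(2) unfolding j by simp
    then show "h \<in> {\<one>\<^bsub>H\<^esub>}" by simp
  qed auto
  then show ?thesis unfolding k by simp
qed

text \<open>In the formula \<open>wcover.card_coc\<close> the number of square roots of the central element of \<open>A\<close> is odd exactly if \<open>d |H|\<close> is odd, and the number of its \<open>q\<close>-th roots is odd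
exactly if \<open>q\<close> does not divide \<open>d\<close>.\<close>

lemma coc_parity:
  assumes q: "Factorial_Ring.prime q" "odd q" and W: "W \<in> subs q N"
  shows "odd (card (coc q AA zA W)) \<longleftrightarrow>
    (odd (d * card (carrier H)) \<or> (fixc gen_x W = 0 \<and> rk q W = 0)) \<and> (\<not> q dvd d \<or> fixc gen_y W = 0)"
proof -
  interpret C: gamma_coc m q AA zA W by (rule wcover_AA) (use W in \<open>auto simp: subs_def\<close>)
  have r2: "odd (C.roots 2) \<longleftrightarrow> odd (d * card (carrier H))"
    unfolding C.roots_def card_roots[OF two_is_prime_nat] using square_roots_parity by auto
  have rq: "odd (C.roots q) \<longleftrightarrow> \<not> q dvd d"
    unfolding C.roots_def card_roots[OF q(1)] using odd_roots_odd[OF q(2)] by auto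
  show ?thesis unfolding C.card_coc(1)[OF q(1)] card_AA using r2 rq by auto
qed

end

context gamma_pres begin

lemma Gamma_zeta_eq: "Gamma_zeta m q = \<zeta>"
proof -
  have "pres_gen RR gen_x = g [gen_x]" by (simp add: pres_gen_def g_def emb_def)
  moreover have "g (replicate 2 gen_x) = g [gen_x, gen_x]" by (simp add: numeral_2_eq_2)
  ultimately show ?thesis unfolding Gamma_zeta_def \<zeta>_def by (simp only: g_replicate)
qed

lemma zeta_order_iff: "\<zeta> [^]\<^bsub>GG\<^esub> (i::int) = \<one>\<^bsub>GG\<^esub> \<longleftrightarrow> int m dvd i"
proof
  assume "int m dvd i"
  then show "\<zeta> [^]\<^bsub>GG\<^esub> i = \<one>\<^bsub>GG\<^esub>" unfolding zeta_int by (simp add: g_Nil)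
qed (rule zeta_order)

lemma trivial_intersection_iff:
  assumes D: "subgroup D GG"
  shows "D \<inter> generate GG {Gamma_zeta m q} = {\<one>\<^bsub>GG\<^esub>} \<longleftrightarrow> (\<forall>i::int. \<zeta> [^]\<^bsub>GG\<^esub> i \<in> D \<longleftrightarrow> int m dvd i)"
proof -
  have gen: "generate GG {Gamma_zeta m q} = {\<zeta> [^]\<^bsub>GG\<^esub> k | k. k \<in> (UNIV :: int set)}"
    unfolding Gamma_zeta_eq by (rule G.generate_pow[OF zeta_closed])
  have one: "\<one>\<^bsub>GG\<^esub> \<in> D" by (rule subgroup.one_closed[OF D])
  have one': "\<one>\<^bsub>GG\<^esub> \<in> generate GG {Gamma_zeta m q}" by (rule generate.one)
  show ?thesis
  proof
    assume e: "D \<inter> generate GG {Gamma_zeta m q} = {\<one>\<^bsub>GG\<^esub>}"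
    show "\<forall>i::int. \<zeta> [^]\<^bsub>GG\<^esub> i \<in> D \<longleftrightarrow> int m dvd i"
    proof (intro allI iffI)
      fix i :: int assume "\<zeta> [^]\<^bsub>GG\<^esub> i \<in> D"
      moreover have "\<zeta> [^]\<^bsub>GG\<^esub> i \<in> generate GG {Gamma_zeta m q}" unfolding gen by blast
      ultimately have "\<zeta> [^]\<^bsub>GG\<^esub> i = \<one>\<^bsub>GG\<^esub>" using e by blast
      then show "int m dvd i" by (rule zeta_order)
    next
      fix i :: int assume "int m dvd i"
      then have "\<zeta> [^]\<^bsub>GG\<^esub> i = \<one>\<^bsub>GG\<^esub>" by (rule zeta_order_iff[THEN iffD2])
      then show "\<zeta> [^]\<^bsub>GG\<^esub> i \<in> D" using one by simp
    qed
  next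
    assume a: "\<forall>i::int. \<zeta> [^]\<^bsub>GG\<^esub> i \<in> D \<longleftrightarrow> int m dvd i"
    show "D \<inter> generate GG {Gamma_zeta m q} = {\<one>\<^bsub>GG\<^esub>}"
    proof (intro equalityI subsetI)
      fix x assume "x \<in> D \<inter> generate GG {Gamma_zeta m q}"
      then obtain k :: int where k: "x = \<zeta> [^]\<^bsub>GG\<^esub> k" "\<zeta> [^]\<^bsub>GG\<^esub> k \<in> D" unfolding gen by blast
      then have "x = \<one>\<^bsub>GG\<^esub>" using a[rule_format, of k] zeta_order_iff[of k] by (simp only:)
      then show "x \<in> {\<one>\<^bsub>GG\<^esub>}" by simp
    next
      fix x assume "x \<in> {\<one>\<^bsub>GG\<^esub>}"
      then show "x \<in> D \<inter> generate GG {Gamma_zeta m q}" using one one' by simp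
    qed
  qed
qed

text \<open>Every subgroup is good for some divisor \<open>d\<close> of \<open>m\<close>: the least positive exponent of a power of \<open>\<zeta>\<close> in it.\<close>

lemma ex_period:
  assumes D: "subgroup D GG"
  shows "\<exists>d. d dvd m \<and> (\<forall>i::int. \<zeta> [^]\<^bsub>GG\<^esub> i \<in> D \<longleftrightarrow> int d dvd i)"
proof -
  define P where "P = (\<lambda>j::nat. j > 0 \<and> \<zeta> [^]\<^bsub>GG\<^esub> int j \<in> D)"
  define d where "d = Least P"
  have one: "\<one>\<^bsub>GG\<^esub> \<in> D" by (rule subgroup.one_closed[OF D])
  have zm: "\<zeta> [^]\<^bsub>GG\<^esub> int m \<in> D" using zeta_order_iff[of "int m"] one by simp
  then have "P m" using m1 by (simp add: P_def)
  then have "P d" unfolding d_def by (rule LeastI)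
  then have d: "d > 0" "\<zeta> [^]\<^bsub>GG\<^esub> int d \<in> D" by (auto simp: P_def)
  have mult: "\<zeta> [^]\<^bsub>GG\<^esub> (int d * k) \<in> D" for k
    using G.subgroup_int_pow_closed[OF D d(2), of k] G.int_pow_pow[OF zeta_closed, of "int d" k] by simp
  have iff: "\<zeta> [^]\<^bsub>GG\<^esub> i \<in> D \<longleftrightarrow> int d dvd i" for i
  proof
    assume i: "\<zeta> [^]\<^bsub>GG\<^esub> i \<in> D"
    have "\<zeta> [^]\<^bsub>GG\<^esub> (i + int d * (- (i div int d))) \<in> D"
      unfolding G.int_pow_mult[OF zeta_closed] by (rule subgroup.m_closed[OF D i mult])
    moreover have "i + int d * (- (i div int d)) = int (nat (i mod int d))"
      using d(1) by (simp add: minus_mult_div_eq_mod)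
    ultimately have "\<zeta> [^]\<^bsub>GG\<^esub> int (nat (i mod int d)) \<in> D" by (simp only:)
    moreover have "nat (i mod int d) < d" using d(1) by (simp add: nat_less_iff)
    then have "\<not> P (nat (i mod int d))" unfolding d_def by (rule not_less_Least)
    ultimately have "nat (i mod int d) = 0" unfolding P_def by (metis not_gr_zero)
    then have "i mod int d = 0" using d(1) by (simp add: nat_eq_iff)
    then show "int d dvd i" by (rule dvd_eq_mod_eq_0[THEN iffD2])
  next
    assume "int d dvd i"
    then obtain k where "i = int d * k" by (elim dvdE)
    then show "\<zeta> [^]\<^bsub>GG\<^esub> i \<in> D" using mult by simp
  qed
  moreover have "d dvd m" using iff[of "int m"] zm by simp
  ultimately show ?thesis by blast
qed

end

text \<open>In the group with \<open>m = d\<close> the good subgroups are those that meet the group generated by \<open>\<zeta>\<close> trivially.\<close>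

lemma (in gamma_pairs) Gamma_hom_sum_1_eq:
  assumes n: "n \<ge> 1"
  shows "Gamma_hom_sum_1 d q H n = (if d dvd n then \<Sum>W\<in>subs q (n div d). card (coc q AA zA W) else 0)"
proof -
  have cd: "coprime d (card (carrier H))" using cop dm by (meson coprime_divisors dvd_refl)
  interpret E: gamma_pairs d q d H by unfold_locales (use d1 q1 finH cd in simp_all)
  have "{D. D \<in> subgroups_of_index (Gamma_group d q) n \<and>
      D \<inter> generate (Gamma_group d q) {Gamma_zeta d q} = {\<one>\<^bsub>Gamma_group d q\<^esub>}}
    = {D. E.good D \<and> card (rcosets\<^bsub>Gamma_group d q\<^esub> D) = n}"
    unfolding subgroups_of_index_def E.good_def E.Z_def using E.trivial_intersection_iff by blast
  then show ?thesis unfolding Gamma_hom_sum_1_def using E.hom_sum_good(2)[OF n] by simp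
qed

lemma (in gamma_pres) subgroup_hom_sum_eq:
  fixes H :: "'h monoid"
  assumes n: "n \<ge> 1" and H: "group H" "finite (carrier H)" "coprime m (card (carrier H))"
  shows "subgroup_hom_sum GG H n = (\<Sum>d | d dvd m. Gamma_hom_sum_1 d q H n)"
proof -
  define S where "S = (\<lambda>d. {D. subgroup D GG \<and> (\<forall>i::int. \<zeta> [^]\<^bsub>GG\<^esub> i \<in> D \<longleftrightarrow> int d dvd i) \<and> card (rcosets\<^bsub>GG\<^esub> D) = n})"
  have fin: "finite (S d)" and sum: "(\<Sum>D\<in>S d. card (Hom GG D H)) = Gamma_hom_sum_1 d q H n" if d: "d dvd m" for d
  proof -
    interpret P: gamma_pairs m q d H by (intro gamma_pairs.intro gamma_pairs_axioms.intro gamma_pres_axioms d H)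
    have S: "S d = {D. P.good D \<and> card (rcosets\<^bsub>GG\<^esub> D) = n}" unfolding S_def P.good_def P.Z_def by blast
    show "finite (S d)" unfolding S by (rule P.hom_sum_good(1)[OF n])
    show "(\<Sum>D\<in>S d. card (Hom GG D H)) = Gamma_hom_sum_1 d q H n"
      unfolding S P.hom_sum_good(2)[OF n] P.Gamma_hom_sum_1_eq[OF n] ..
  qed
  have "subgroups_of_index GG n = (\<Union>d\<in>{d. d dvd m}. S d)"
    unfolding subgroups_of_index_def S_def using ex_period by blast
  moreover have "finite {d. d dvd m}" using m1 by simp
  moreover have "S d \<inter> S e = {}" if "d \<noteq> e" for d e
  proof (rule ccontr)
    assume "S d \<inter> S e \<noteq> {}"
    then obtain D where "\<And>i::int. \<zeta> [^]\<^bsub>GG\<^esub> i \<in> D \<longleftrightarrow> int d dvd i" "\<And>i::int. \<zeta> [^]\<^bsub>GG\<^esub> i \<in> D \<longleftrightarrow> int e dvd i"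
      unfolding S_def by blast
    then have "int d dvd i \<longleftrightarrow> int e dvd i" for i by blast
    from this[of "int d"] this[of "int e"] have "d dvd e" "e dvd d" by simp_all
    then show False using that by (simp add: dvd_antisym)
  qed
  ultimately have "subgroup_hom_sum GG H n = (\<Sum>d | d dvd m. \<Sum>D\<in>S d. card (Hom GG D H))"
    unfolding subgroup_hom_sum_def using fin by (simp only:) (intro sum.UNION_disjoint, auto)
  also have "\<dots> = (\<Sum>d | d dvd m. Gamma_hom_sum_1 d q H n)" by (intro sum.cong) (use sum in auto)
  finally show ?thesis .
qed

lemma lam_closed_form:
  assumes "q \<ge> 3"
  shows "real (lam q s) = (2 * (real q - 1) ^ Suc s - real q) / (real q - 2)"
proof -
  have "(real q - 2) * real (lam q s) = 2 * (real q - 1) ^ Suc s - real q"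
  proof (induction s)
    case (Suc s)
    have r: "real (q - 1) = real q - 1" using assms by simp
    have "(real q - 2) * real (lam q (Suc s)) = (real q - 1) * ((real q - 2) * real (lam q s)) + (real q - 2) * real q"
      unfolding lam.simps of_nat_add of_nat_mult r by (simp add: algebra_simps)
    also have "\<dots> = 2 * (real q - 1) ^ Suc (Suc s) - real q" unfolding Suc by (simp add: algebra_simps)
    finally show ?case .
  qed simp
  then show ?thesis using assms by (simp add: field_simps)
qed

lemma index_formula_iff:
  assumes "q \<ge> 3"
  shows "(\<exists>\<sigma>::nat. \<sigma> \<ge> 1 \<and> real n = real c * ((2 * (real q - 1) ^ \<sigma> - real q) / (real q - 2)))
    \<longleftrightarrow> (\<exists>s. n = c * lam q s)"
proof
  assume "\<exists>\<sigma>::nat. \<sigma> \<ge> 1 \<and> real n = real c * ((2 * (real q - 1) ^ \<sigma> - real q) / (real q - 2))"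
  then obtain \<sigma> :: nat where s: "\<sigma> \<ge> 1" "real n = real c * ((2 * (real q - 1) ^ \<sigma> - real q) / (real q - 2))" by blast
  obtain s where "\<sigma> = Suc s" using s(1) by (cases \<sigma>) auto
  then have "real n = real c * real (lam q s)" using s(2) lam_closed_form[OF assms, of s] by (simp only:)
  then have "n = c * lam q s" by (metis of_nat_eq_iff of_nat_mult)
  then show "\<exists>s. n = c * lam q s" ..
next
  assume "\<exists>s. n = c * lam q s"
  then obtain s where "n = c * lam q s" ..
  then have "real n = real c * ((2 * (real q - 1) ^ Suc s - real q) / (real q - 2))"
    using lam_closed_form[OF assms, of s] by (simp only: of_nat_mult)
  then show "\<exists>\<sigma>::nat. \<sigma> \<ge> 1 \<and> real n = real c * ((2 * (real q - 1) ^ \<sigma> - real q) / (real q - 2))"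
    by (intro exI[of _ "Suc s"]) simp
qed

lemma (in gamma_pairs) Gamma_hom_sum_1_parity:
  assumes n: "n \<ge> 1" and q: "Factorial_Ring.prime q" "odd q" "q - 1 = 2 ^ k"
  shows "odd (Gamma_hom_sum_1 d q H n) \<longleftrightarrow> (\<not> q dvd d \<and> (\<exists>s. n = (2 * d) * lam q s)) \<or>
    (odd d \<and> \<not> q dvd d \<and> odd (card (carrier H)) \<and> (\<exists>s. n = d * lam q s))"
proof (cases "d dvd n")
  case False
  then have "Gamma_hom_sum_1 d q H n = 0" using Gamma_hom_sum_1_eq[OF n] by simp
  moreover have "d dvd d * lam q s" "d dvd (2 * d) * lam q s" for s by simp_all
  ultimately show ?thesis using False by (metis even_zero)
next
  case True
  then obtain N where N: "n = d * N" by (elim dvdE)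
  have d0: "d > 0" using d1 by simp
  have iff: "(\<exists>s. n = (2 * d) * lam q s) \<longleftrightarrow> (\<exists>s. N = 2 * lam q s)" "(\<exists>s. n = d * lam q s) \<longleftrightarrow> (\<exists>s. N = lam q s)"
    unfolding N using d0 by auto
  have q1: "q > 1" by (rule prime_gt_1_nat[OF q(1)])
  have "q \<noteq> 2" using q(2) by auto
  then have q3: "q \<ge> 3" using q1 by linarith
  define P where "P = (\<lambda>W. (odd (d * card (carrier H)) \<or> (fixc gen_x W = 0 \<and> rk q W = 0)) \<and> (\<not> q dvd d \<or> fixc gen_y W = 0))"
  have fs: "finite (subs q N)" by (rule finite_subs) (use q1 in simp)
  have "{W \<in> subs q N. odd (card (coc q AA zA W))} = {W \<in> subs q N. P W}"
    unfolding P_def by (intro Collect_cong conj_cong[OF HOL.refl] coc_parity[OF q(1,2)])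
  moreover have "Gamma_hom_sum_1 d q H n = (\<Sum>W\<in>subs q N. card (coc q AA zA W))"
    using Gamma_hom_sum_1_eq[OF n] True d0 by (simp add: N)
  ultimately have o: "odd (Gamma_hom_sum_1 d q H n) \<longleftrightarrow> odd (card {W \<in> subs q N. P W})"
    by (simp only: odd_sum_card[OF fs])
  show ?thesis
  proof (cases "q dvd d")
    case qd: False
    show ?thesis
    proof (cases "odd (d * card (carrier H))")
      case True
      then have "{W \<in> subs q N. P W} = subs q N" unfolding P_def using qd by blast
      then show ?thesis unfolding o iff using subs_parity(1)[OF q, of N] True qd by auto
    next
      case False
      then have "{W \<in> subs q N. P W} = {W \<in> subs q N. fixc gen_x W = 0 \<and> rk q W = 0}" unfolding P_def using qd by blast
      then show ?thesis unfolding o iff using subs_parity(2)[OF q, of N] False qd by auto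
    qed
  next
    case qd: True
    show ?thesis
    proof (cases "odd (d * card (carrier H))")
      case True
      then have "{W \<in> subs q N. P W} = {W \<in> subs q N. fixc gen_y W = 0}" unfolding P_def using qd by simp
      then show ?thesis unfolding o using subs_parity(3)[OF q, of N] qd by auto
    next
      case False
      \<comment> \<open>By \<open>rk_subs\<close> no subgroup has \<open>a = b = r = 0\<close>.\<close>
      have "{W \<in> subs q N. P W} = {}"
      proof (rule ccontr)
        assume "{W \<in> subs q N. P W} \<noteq> {}"
        then obtain W where W: "W \<in> subs q N" "fixc gen_x W = 0" "rk q W = 0" "fixc gen_y W = 0"
          unfolding P_def using qd False by blast
        have "(int q - 2) * int N + 2 * int q = 0" using rk_subs[OF q(1) W(1)] W(2-4) by simp
        moreover have "(int q - 2) * int N \<ge> 0" using q3 by simp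
        ultimately show False using q3 by linarith
      qed
      then have "card {W \<in> subs q N. P W} = 0" by (simp only: card.empty)
      then show ?thesis unfolding o using qd by simp
    qed
  qed
qed

theorem corollary27:
  fixes m n q :: nat and H :: "'h monoid"
  assumes "m \<ge> 1" and "n \<ge> 1"
    and "fermat_prime q"
    and "group H" and "finite (carrier H)"
    and "gcd m (card (carrier H)) = 1"
  shows "subgroup_hom_sum (Gamma_group m q) H n = (\<Sum>d | d dvd m. Gamma_hom_sum_1 d q H n) \<and>
    (\<forall>d. d dvd m \<longrightarrow>
      ([Gamma_hom_sum_1 d q H n = 1] (mod 2) \<longleftrightarrow>
        (\<not> q dvd d \<and>
          (\<exists>\<sigma>::nat. \<sigma> \<ge> 1 \<and>
            real n = 2 * real d * ((2 * (real q - 1) ^ \<sigma> - real q) / (real q - 2)))) \<or>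
        (\<not> 2 dvd d \<and> \<not> q dvd d \<and> \<not> 2 dvd card (carrier H) \<and>
          (\<exists>\<sigma>::nat. \<sigma> \<ge> 1 \<and>
            real n = real d * ((2 * (real q - 1) ^ \<sigma> - real q) / (real q - 2))))))"
proof -
  obtain k where q: "Factorial_Ring.prime q" "odd q" "q - 1 = 2 ^ k"
    using assms(3) unfolding fermat_prime_def by blast
  have "q \<noteq> 2" using q(2) by auto
  then have q3: "q \<ge> 3" using prime_gt_1_nat[OF q(1)] by linarith
  have cop: "coprime m (card (carrier H))" using assms(6) by (simp add: coprime_iff_gcd_eq_1)
  interpret gamma_pres m q using assms(1) q3 by unfold_locales simp_all
  have "[Gamma_hom_sum_1 d q H n = 1] (mod 2) \<longleftrightarrow>
        (\<not> q dvd d \<and>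
          (\<exists>\<sigma>::nat. \<sigma> \<ge> 1 \<and>
            real n = 2 * real d * ((2 * (real q - 1) ^ \<sigma> - real q) / (real q - 2)))) \<or>
        (\<not> 2 dvd d \<and> \<not> q dvd d \<and> \<not> 2 dvd card (carrier H) \<and>
          (\<exists>\<sigma>::nat. \<sigma> \<ge> 1 \<and>
            real n = real d * ((2 * (real q - 1) ^ \<sigma> - real q) / (real q - 2))))"
    if d: "d dvd m" for d
  proof -
    have P: "gamma_pairs m q d H"
      by (intro gamma_pairs.intro gamma_pairs_axioms.intro gamma_pres_axioms d assms(4,5) cop)
    have c: "[N = 1] (mod 2) \<longleftrightarrow> odd N" for N :: nat by (simp add: cong_def odd_iff_mod_2_eq_one)
    show ?thesis
      unfolding c gamma_pairs.Gamma_hom_sum_1_parity[OF P assms(2) q]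
      using index_formula_iff[OF q3, of n "2 * d"] index_formula_iff[OF q3, of n d] by simp
  qed
  then show ?thesis using subgroup_hom_sum_eq[OF assms(2,4,5) cop] by blast
qed

end
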